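(* Let $\beta>0$, $\sigma>0$, $\alpha>0$ and let $M_t$ be the maximum position at time $t$ of the two-type reducible branching Brownian motion with parameters $(\beta,\sigma^2,\alpha)$. Assume $(\beta,\sigma^2)\in\mathcal C_{I}$, where $$\mathcal C_{I}=\left\{(\beta,\sigma^2):\ \sigma^2>\frac{\mathbf 1_{\{\beta\le 1\}}}{\beta}+\mathbf 1_{\{\beta>1\}}\frac{\beta}{2\beta-1}\right\}.$$ Then for every $\theta>1$ the limit $$\lim_{t\to\infty}\frac1t\ln \mathbb P\left(M_t\ge \sqrt{2\beta\sigma^2\theta^2}\; t\right)=A$$ exists, where: (i) if $\sigma^2\ge 1$, then $A=\beta(1-\theta^2)$; (ii) if $\beta>1$ and $\sigma^2<1$, then $$A=\begin{cases}\beta(1-\theta^2), & \theta^2\le \dfrac{(\beta-1)\sigma^2}{(1-\sigma^2)\beta},\\[2mm] 1-\theta^2\beta\sigma^2, & \theta^2\ge \dfrac{\beta-1}{(1-\sigma^2)\sigma^2\beta},\\[2mm] \dfrac{-2\sqrt{\beta(\beta-1)(1-\sigma^2)}\,\sigma\theta+\beta-\sigma^2}{1-\sigma^2}, & \dfrac{(\beta-1)\sigma^2}{(1-\sigma^2)\beta}<\theta^2<\dfrac{\beta-1}{(1-\sigma^2)\sigma^2\beta}.\end{cases}$$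
   Context: The two-type reducible branching Brownian motion with parameters $(\beta,\sigma^2,\alpha)$ is the following continuous-time particle system on the real line. Each particle has a type, $1$ or $2$. The system starts at time $0$ from a single particle of type $1$ located at $0$. Each particle of type $1$ moves as a Brownian motion with variance $\sigma^2$ (i.e. as $\sigma B$ with $B$ a standard Brownian motion), branches at rate $\beta$ (at an exponential time of parameter $\beta$ it is replaced by two particles of type $1$ at its current position), and in addition gives birth to particles of type $2$, at its current position, at rate $\alpha$. Each particle of type $2$ moves as a standard Brownian motion (variance $1$) and branches at rate $1$ into two particles of type $2$; type $2$ particles never produce type $1$ particles. Given their birth times and positions, all particles move and reproduce independently. $\mathcal N_t$ denotes the set of all particles (of both types) alive at time $t$, $X^u_t$ the position of $u\in\mathcal N_t$ at time $t$, and $M_t=\max\{X^u_t:u\in\mathcal N_t\}$. *)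

theory Defs
  imports "HOL-Probability.Probability"
begin

text \<open>Path continuity and the value at time 0 are required at every sample point, not only almost
  surely, so that evaluating a path at a random time is measurable without completing the space.\<close>

locale standard_brownian_motion = prob_space M
  for M :: "'a measure" and W :: "real \<Rightarrow> 'a \<Rightarrow> real" +
  assumes measurable_value: "\<And>t. 0 \<le> t \<Longrightarrow> W t \<in> borel_measurable M"
    and start: "\<And>\<omega>. \<omega> \<in> space M \<Longrightarrow> W 0 \<omega> = 0"
    and continuous_paths: "\<And>\<omega>. \<omega> \<in> space M \<Longrightarrow> continuous_on {0..} (\<lambda>t. W t \<omega>)"
    and gaussian_increments: "\<And>s t. 0 \<le> s \<Longrightarrow> s < t \<Longrightarrow>
      distributed M lborel (\<lambda>\<omega>. W t \<omega> - W s \<omega>) (normal_density 0 (sqrt (t - s)))"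
    and independent_increments: "\<And>(n::nat) r. 0 \<le> r 0 \<Longrightarrow> (\<forall>i<n. r i \<le> r (Suc i)) \<Longrightarrow>
      indep_vars (\<lambda>_. borel) (\<lambda>i \<omega>. W (r (Suc i)) \<omega> - W (r i) \<omega>) {..<n}"

text \<open>Particles carry Ulam--Harris labels, the two children of the individual \<open>w\<close> of a line of
  descent being \<open>False # w\<close> and \<open>True # w\<close>. \<open>Type1 v\<close> is the type 1 particle \<open>v\<close>; \<open>Type2 v k w\<close>
  is the descendant \<open>w\<close> of the \<open>k\<close>-th particle of type 2 to which \<open>Type1 v\<close> gives birth
  (counting from \<open>k = 0\<close>).\<close>

datatype particle = Type1 "bool list" | Type2 "bool list" nat "bool list"

text \<open>The sources of randomness: the time until a particle splits, the gap between the births of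
  the \<open>(k - 1)\<close>-st and the \<open>k\<close>-th type 2 children of a type 1 particle (from its own birth if
  \<open>k = 0\<close>), and the Brownian motion driving a particle during its life.\<close>

datatype clock = Split particle | Gap "bool list" nat | Motion particle

fun branching_rate :: "real \<Rightarrow> particle \<Rightarrow> real" where
  "branching_rate \<beta> (Type1 v) = \<beta>"
| "branching_rate \<beta> (Type2 v k w) = 1"

fun diffusivity :: "real \<Rightarrow> particle \<Rightarrow> real" where
  "diffusivity \<sigma> (Type1 v) = \<sigma>"
| "diffusivity \<sigma> (Type2 v k w) = 1"

text \<open>For a fixed sample point, \<open>T u\<close> is the lifetime of \<open>u\<close>, \<open>G v k\<close> the \<open>k\<close>-th gap of
  \<open>Type1 v\<close>, and \<open>B u\<close> the path driving \<open>u\<close>, run from the birth of \<open>u\<close>.\<close>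

definition child_age :: "(bool list \<Rightarrow> nat \<Rightarrow> real) \<Rightarrow> bool list \<Rightarrow> nat \<Rightarrow> real" where
  "child_age G v k = (\<Sum>j\<le>k. G v j)"

text \<open>Sum over the strict ancestors of an individual within its line: a particle is born when and
  where its parent dies.\<close>

primrec sum_ancestors :: "(bool list \<Rightarrow> real) \<Rightarrow> real \<Rightarrow> bool list \<Rightarrow> real" where
  "sum_ancestors f x [] = x"
| "sum_ancestors f x (c # w) = sum_ancestors f x w + f w"

definition birth_time1 :: "(particle \<Rightarrow> real) \<Rightarrow> bool list \<Rightarrow> real" where
  "birth_time1 T v = sum_ancestors (\<lambda>w. T (Type1 w)) 0 v"

definition birth_position1 :: "real \<Rightarrow> (particle \<Rightarrow> real) \<Rightarrow> (particle \<Rightarrow> real \<Rightarrow> real) \<Rightarrow>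
    bool list \<Rightarrow> real" where
  "birth_position1 \<sigma> T B v =
     sum_ancestors (\<lambda>w. diffusivity \<sigma> (Type1 w) * B (Type1 w) (T (Type1 w))) 0 v"

fun birth_time :: "(particle \<Rightarrow> real) \<Rightarrow> (bool list \<Rightarrow> nat \<Rightarrow> real) \<Rightarrow> particle \<Rightarrow> real" where
  "birth_time T G (Type1 v) = birth_time1 T v"
| "birth_time T G (Type2 v k w) =
     sum_ancestors (\<lambda>w'. T (Type2 v k w')) (birth_time1 T v + child_age G v k) w"

fun birth_position :: "real \<Rightarrow> (particle \<Rightarrow> real) \<Rightarrow> (bool list \<Rightarrow> nat \<Rightarrow> real) \<Rightarrow>
    (particle \<Rightarrow> real \<Rightarrow> real) \<Rightarrow> particle \<Rightarrow> real" where
  "birth_position \<sigma> T G B (Type1 v) = birth_position1 \<sigma> T B v"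
| "birth_position \<sigma> T G B (Type2 v k w) =
     sum_ancestors
       (\<lambda>w'. diffusivity \<sigma> (Type2 v k w') * B (Type2 v k w') (T (Type2 v k w')))
       (birth_position1 \<sigma> T B v + diffusivity \<sigma> (Type1 v) * B (Type1 v) (child_age G v k))
       w"

text \<open>The gaps are an infinite sequence for every \<open>v\<close>; only the births that fall within the
  lifetime of \<open>Type1 v\<close> take place.\<close>

fun is_born :: "(particle \<Rightarrow> real) \<Rightarrow> (bool list \<Rightarrow> nat \<Rightarrow> real) \<Rightarrow> particle \<Rightarrow> bool" where
  "is_born T G (Type1 v) \<longleftrightarrow> True"
| "is_born T G (Type2 v k w) \<longleftrightarrow> child_age G v k < T (Type1 v)"

definition alive_particles :: "(particle \<Rightarrow> real) \<Rightarrow> (bool list \<Rightarrow> nat \<Rightarrow> real) \<Rightarrow> real \<Rightarrow> particle set"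
  where "alive_particles T G t =
    {u. is_born T G u \<and> birth_time T G u \<le> t \<and> t < birth_time T G u + T u}"

definition particle_position :: "real \<Rightarrow> (particle \<Rightarrow> real) \<Rightarrow> (bool list \<Rightarrow> nat \<Rightarrow> real) \<Rightarrow>
    (particle \<Rightarrow> real \<Rightarrow> real) \<Rightarrow> real \<Rightarrow> particle \<Rightarrow> real" where
  "particle_position \<sigma> T G B t u =
     birth_position \<sigma> T G B u + diffusivity \<sigma> u * B u (t - birth_time T G u)"

text \<open>The set of particles alive at time \<open>t\<close> is almost surely finite and nonempty.\<close>

definition max_position :: "real \<Rightarrow> (particle \<Rightarrow> real) \<Rightarrow> (bool list \<Rightarrow> nat \<Rightarrow> real) \<Rightarrow>
    (particle \<Rightarrow> real \<Rightarrow> real) \<Rightarrow> real \<Rightarrow> real" where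
  "max_position \<sigma> T G B t = Max (particle_position \<sigma> T G B t ` alive_particles T G t)"

text \<open>The information carried by each source; a motion is a random element of the product space of
  functions on \<open>{0..}\<close>.\<close>

fun clock_algebra :: "'a measure \<Rightarrow> (particle \<Rightarrow> 'a \<Rightarrow> real) \<Rightarrow> (bool list \<Rightarrow> nat \<Rightarrow> 'a \<Rightarrow> real) \<Rightarrow>
    (particle \<Rightarrow> real \<Rightarrow> 'a \<Rightarrow> real) \<Rightarrow> clock \<Rightarrow> 'a measure" where
  "clock_algebra M T G B (Split u) = vimage_algebra (space M) (T u) borel"
| "clock_algebra M T G B (Gap v k) = vimage_algebra (space M) (G v k) borel"
| "clock_algebra M T G B (Motion u) =
     vimage_algebra (space M) (\<lambda>\<omega>. \<lambda>s\<in>{0..}. B u s \<omega>) (\<Pi>\<^sub>M s\<in>{0..}. borel)"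

text \<open>The type 2 children of a type 1 particle are born at the points, up to its death, of a
  Poisson process of rate \<open>\<alpha>\<close>, given by its i.i.d. exponential gaps. Exponential variables are
  taken positive at every sample point, again only to avoid measurability problems on null sets.
  The parameter \<open>\<sigma>\<close> does not occur here: it enters the system through \<open>diffusivity\<close>, which scales
  the standard motions \<open>B\<close>.\<close>

locale two_type_reducible_bbm_clocks = prob_space M
  for M :: "'a measure" and \<beta> \<alpha> :: real
    and T :: "particle \<Rightarrow> 'a \<Rightarrow> real"
    and G :: "bool list \<Rightarrow> nat \<Rightarrow> 'a \<Rightarrow> real"
    and B :: "particle \<Rightarrow> real \<Rightarrow> 'a \<Rightarrow> real" +
  assumes lifetimes: "\<And>u. distributed M lborel (T u) (exponential_density (branching_rate \<beta> u))"
    and lifetimes_pos: "\<And>u \<omega>. \<omega> \<in> space M \<Longrightarrow> 0 < T u \<omega>"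
    and gaps: "\<And>v k. distributed M lborel (G v k) (exponential_density \<alpha>)"
    and gaps_pos: "\<And>v k \<omega>. \<omega> \<in> space M \<Longrightarrow> 0 < G v k \<omega>"
    and motions: "\<And>u. standard_brownian_motion M (B u)"
    and independent: "indep_sets (\<lambda>c. sets (clock_algebra M T G B c)) UNIV"

definition region_C_I :: "(real \<times> real) set" where
  "region_C_I = {(b, s). s > of_bool (b \<le> 1) / b + of_bool (b > 1) * (b / (2 * b - 1))}"

end

theory Submission
  imports Defs
begin

text \<open>Upper bound. Let \<open>S\<close> and \<open>Y\<close> be the duration and the displacement of a line of descent with rate
  \<open>b\<close> and diffusivity \<open>d\<close> through \<open>n\<close> generations; then
  \<open>E exp (\<mu> Y - \<kappa> S) = (b / (b + \<kappa> - \<mu>\<^sup>2 d\<^sup>2 / 2)) ^ n\<close>. For \<open>\<kappa> > b + \<mu>\<^sup>2 d\<^sup>2 / 2\<close> this is summable over the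
  binary tree and bounds the expected number of particles above a level. For the particles of type 2
  descending from a birth at time \<open>r\<close> and place \<open>y\<close> the expected number may be exponentially large;
  there \<open>min 1 e \<le> e powr p\<close> turns the first moment bound at the tilt \<open>\<mu> / p\<close> into one that is still
  integrable against \<open>exp (\<mu> y - \<kappa> r)\<close>.

  Lower bound. The optimal path travels a share \<open>s\<close> of the time as type 1 at velocity \<open>a1\<close> and the
  rest as type 2 at velocity \<open>a2\<close>. In the region considered the numbers of particles following
  either phase decay exponentially, so a second moment argument on the tree whose edges are blocks
  of \<open>K\<close> generations with the right duration and displacement shows that the probability of survival
  is of the order of the mean number of survivors. The mean of one block is found by tilting.\<close>

text \<open>At \<open>\<kappa> = b + \<mu>\<^sup>2 * d\<^sup>2 / 2\<close> the ratio per generation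
  is exactly 1/2 and cancels the doubling of words. The rate is the Legendre transform
  \<open>\<kappa> - \<mu> * x\<close> of this critical value at the velocity \<open>x\<close> of the
  level. The upper bound works just above the critical value; the lower bound works at it, where
  under the tilted law a generation lasts \<open>1 / (2 * b)\<close> on average.

  Counting generations rather than time puts independence on the labels: disjoint sets of labels
  carry independent clocks, which takes the place of the Markov property. The price is that a line
  arrives at a random time. Blocks confine its duration, and the last particle must outlive the
  remaining small share of \<open>t\<close>.

  The region and \<open>\<theta> > 1\<close> enter only in the closing case analysis. They put the
  velocity of each phase in use above the speed of its type,
  \<open>sqrt (2 * \<beta>) * \<sigma>\<close> or \<open>sqrt 2\<close>, so that the block means
  decay; for \<open>\<sigma>\<^sup>2 \<ge> 1\<close> they also yield the power
  \<open>p\<close>.\<close>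

instance particle :: countable
  by countable_datatype

section \<open>Independence of the clocks\<close>

context two_type_reducible_bbm_clocks
begin

definition clocks_algebra :: "clock set \<Rightarrow> 'a measure" where
  "clocks_algebra I = sigma (space M) (\<Union>c\<in>I. sets (clock_algebra M T G B c))"

lemma space_clock_algebra [simp]: "space (clock_algebra M T G B c) = space M"
  by (cases c) auto

lemma sets_clock_algebra_subset: "sets (clock_algebra M T G B c) \<subseteq> sets M"
  using independent by (auto simp: indep_sets_def)

lemma clocks_generators: "(\<Union>c\<in>I. sets (clock_algebra M T G B c)) \<subseteq> Pow (space M)"
  using sets_clock_algebra_subset sets.space_closed by blast

lemma space_clocks_algebra [simp]: "space (clocks_algebra I) = space M"
  by (simp add: clocks_algebra_def space_measure_of_conv)

lemma sets_clocks_algebra: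
  "sets (clocks_algebra I) = sigma_sets (space M) (\<Union>c\<in>I. sets (clock_algebra M T G B c))"
  by (simp add: clocks_algebra_def clocks_generators sets_measure_of)

lemma sets_clocks_algebra_subset: "sets (clocks_algebra I) \<subseteq> sets M"
  unfolding sets_clocks_algebra using sets_clock_algebra_subset
  by (intro sets.sigma_sets_subset) auto

lemma sets_clocks_algebra_mono: "I \<subseteq> J \<Longrightarrow> sets (clocks_algebra I) \<subseteq> sets (clocks_algebra J)"
  unfolding sets_clocks_algebra by (intro sigma_sets_mono') auto

lemma measurable_from_clocks_algebra:
  "f \<in> measurable (clocks_algebra I) N \<Longrightarrow> f \<in> measurable M N"
  using sets_clocks_algebra_subset[of I] by (auto simp: measurable_def)

lemma measurable_clocks_algebra_mono:
  "f \<in> measurable (clocks_algebra I) N \<Longrightarrow> I \<subseteq> J \<Longrightarrow> f \<in> measurable (clocks_algebra J) N"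
  using sets_clocks_algebra_mono[of I J] by (auto simp: measurable_def)

lemma measurable_from_clock_algebra:
  assumes "f \<in> measurable (clock_algebra M T G B c) N" "c \<in> I"
  shows "f \<in> measurable (clocks_algebra I) N"
proof -
  have "sets (clock_algebra M T G B c) \<subseteq> sets (clocks_algebra I)"
    unfolding sets_clocks_algebra using assms(2) by auto
  with assms(1) show ?thesis by (auto simp: measurable_def)
qed

lemma indep_clocks_algebra:
  assumes "I \<inter> J = {}"
  shows "indep_set (sets (clocks_algebra I)) (sets (clocks_algebra J))"
proof -
  have "indep_sets (\<lambda>j. sigma_sets (space M) (\<Union>i\<in>case_bool I J j. sets (clock_algebra M T G B i))) UNIV"
  proof (rule indep_sets_collect_sigma)
    show "indep_sets (\<lambda>c. sets (clock_algebra M T G B c)) (\<Union>j\<in>UNIV. case_bool I J j)"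
      by (rule indep_sets_mono_index[OF _ independent]) auto
    show "Int_stable (sets (clock_algebra M T G B c))" for c
      by (rule sets.Int_stable)
    show "disjoint_family_on (case_bool I J) UNIV"
      using assms by (auto simp: disjoint_family_on_def split: bool.splits)
  qed
  then show ?thesis
    unfolding indep_set_def sets_clocks_algebra
    by (rule iffD1[OF indep_sets_cong, rotated -1]) (auto split: bool.splits)
qed

text \<open>Disjoint sets of clocks can be sampled independently of each other. This is what allows to
  evaluate a motion at a random time, and the birth of a line to be frozen while the line is
  averaged.\<close>

lemma nn_integral_decouple:
  assumes "I \<inter> J = {}"
    and h: "h \<in> borel_measurable (clocks_algebra I \<Otimes>\<^sub>M clocks_algebra J)"
  shows "(\<integral>\<^sup>+\<omega>. h (\<omega>, \<omega>) \<partial>M) = (\<integral>\<^sup>+\<omega>'. (\<integral>\<^sup>+\<omega>. h (\<omega>', \<omega>) \<partial>M) \<partial>M)"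
proof -
  let ?I = "clocks_algebra I" and ?J = "clocks_algebra J"
  have id1: "(\<lambda>\<omega>. \<omega>) \<in> measurable M ?I" and id2: "(\<lambda>\<omega>. \<omega>) \<in> measurable M ?J"
    by (rule measurable_from_clocks_algebra[OF measurable_ident_sets[OF refl]])+
  \<comment> \<open>The identity is read once as a random element of \<open>?I\<close> and once of
    \<open>?J\<close>. Independence of the two copies makes the law of the diagonal map a product
    measure, to which Tonelli's theorem applies.\<close>
  have "indep_var ?I (\<lambda>\<omega>. \<omega>) ?J (\<lambda>\<omega>. \<omega>)"
    unfolding indep_var_eq
  proof (intro conjI id1 id2)
    have eq: "sigma_sets (space M) {(\<lambda>\<omega>. \<omega>) -` A \<inter> space M |A. A \<in> sets (clocks_algebra K)}
        = sets (clocks_algebra K)" for K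
    proof -
      have "{(\<lambda>\<omega>. \<omega>) -` A \<inter> space M |A. A \<in> sets (clocks_algebra K)} = sets (clocks_algebra K)"
      proof -
        have *: "A \<inter> space M = A" if "A \<in> sets (clocks_algebra K)" for A
          using sets.sets_into_space[OF that] by auto
        show ?thesis
          unfolding vimage_ident
        proof (intro equalityI subsetI)
          fix A assume "A \<in> {A \<inter> space M |A. A \<in> sets (clocks_algebra K)}"
          then obtain A' where "A = A' \<inter> space M" "A' \<in> sets (clocks_algebra K)" by blast
          then show "A \<in> sets (clocks_algebra K)" by (simp add: *)
        next
          fix A assume "A \<in> sets (clocks_algebra K)"
          then show "A \<in> {A \<inter> space M |A. A \<in> sets (clocks_algebra K)}"
            by (intro CollectI exI[of _ A]) (simp add: *)
        qed
      qed
      then show ?thesis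
        using sets.sigma_sets_eq[of "clocks_algebra K"] by simp
    qed
    show "indep_set (sigma_sets (space M) {(\<lambda>\<omega>. \<omega>) -` A \<inter> space M |A. A \<in> sets ?I})
        (sigma_sets (space M) {(\<lambda>\<omega>. \<omega>) -` A \<inter> space M |A. A \<in> sets ?J})"
      unfolding eq by (rule indep_clocks_algebra) fact
  qed
  then have D: "distr M ?I (\<lambda>\<omega>. \<omega>) \<Otimes>\<^sub>M distr M ?J (\<lambda>\<omega>. \<omega>) = distr M (?I \<Otimes>\<^sub>M ?J) (\<lambda>\<omega>. (\<omega>, \<omega>))"
    by (simp add: indep_var_distribution_eq)
  interpret I: prob_space "distr M ?I (\<lambda>\<omega>. \<omega>)" by (rule prob_space_distr) (rule id1)
  interpret J: prob_space "distr M ?J (\<lambda>\<omega>. \<omega>)" by (rule prob_space_distr) (rule id2)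
  interpret pair_sigma_finite "distr M ?I (\<lambda>\<omega>. \<omega>)" "distr M ?J (\<lambda>\<omega>. \<omega>)" ..
  have h': "h \<in> borel_measurable (distr M ?I (\<lambda>\<omega>. \<omega>) \<Otimes>\<^sub>M distr M ?J (\<lambda>\<omega>. \<omega>))"
    using h by (simp cong: measurable_cong_sets sets_pair_measure_cong)
  have h2: "(\<lambda>\<omega>. h (\<omega>', \<omega>)) \<in> borel_measurable ?J" if "\<omega>' \<in> space M" for \<omega>'
    using h by (rule measurable_compose[rotated]) (use that in simp)
  have "(\<integral>\<^sup>+\<omega>. h (\<omega>, \<omega>) \<partial>M) = (\<integral>\<^sup>+z. h z \<partial>distr M (?I \<Otimes>\<^sub>M ?J) (\<lambda>\<omega>. (\<omega>, \<omega>)))"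
    using h id1 id2 by (subst nn_integral_distr) auto
  also have "\<dots> = (\<integral>\<^sup>+\<omega>'. \<integral>\<^sup>+\<omega>. h (\<omega>', \<omega>) \<partial>distr M ?J (\<lambda>\<omega>. \<omega>) \<partial>distr M ?I (\<lambda>\<omega>. \<omega>))"
    unfolding D[symmetric] using h' by (rule J.nn_integral_fst[symmetric])
  also have "\<dots> = (\<integral>\<^sup>+\<omega>'. \<integral>\<^sup>+\<omega>. h (\<omega>', \<omega>) \<partial>distr M ?J (\<lambda>\<omega>. \<omega>) \<partial>M)"
    using J.borel_measurable_nn_integral_fst[OF h'] id1
    by (subst nn_integral_distr) auto
  also have "\<dots> = (\<integral>\<^sup>+\<omega>'. \<integral>\<^sup>+\<omega>. h (\<omega>', \<omega>) \<partial>M \<partial>M)"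
    using h2 id2 by (intro nn_integral_cong, subst nn_integral_distr) auto
  finally show ?thesis .
qed

lemma nn_integral_decouple_mult:
  assumes "I \<inter> J = {}"
    and f: "f \<in> borel_measurable (clocks_algebra I)" and g: "g \<in> borel_measurable (clocks_algebra J)"
  shows "(\<integral>\<^sup>+\<omega>. f \<omega> * g \<omega> \<partial>M) = (\<integral>\<^sup>+\<omega>. f \<omega> \<partial>M) * (\<integral>\<^sup>+\<omega>. g \<omega> \<partial>M)"
proof -
  have "(\<lambda>(x, y). f x * g y) \<in> borel_measurable (clocks_algebra I \<Otimes>\<^sub>M clocks_algebra J)"
    using f g by measurable
  from nn_integral_decouple[OF assms(1) this] show ?thesis
    using measurable_from_clocks_algebra[OF f] measurable_from_clocks_algebra[OF g]
    by (simp add: nn_integral_cmult nn_integral_multc)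
qed

section \<open>The clocks as random variables\<close>

lemma measurable_lifetime: "Split u \<in> I \<Longrightarrow> T u \<in> borel_measurable (clocks_algebra I)"
  by (rule measurable_from_clock_algebra[of _ "Split u"]) (auto intro: measurable_vimage_algebra1)

lemma measurable_gap: "Gap v k \<in> I \<Longrightarrow> G v k \<in> borel_measurable (clocks_algebra I)"
  by (rule measurable_from_clock_algebra[of _ "Gap v k"]) (auto intro: measurable_vimage_algebra1)

lemma measurable_motion:
  assumes "Motion u \<in> I" "0 \<le> s"
  shows "B u s \<in> borel_measurable (clocks_algebra I)"
proof (rule measurable_from_clock_algebra[OF _ assms(1)])
  let ?A = "clock_algebra M T G B (Motion u)"
  have "(\<lambda>\<omega>. \<lambda>s\<in>{0..}. B u s \<omega>) \<in> measurable ?A (\<Pi>\<^sub>M s\<in>{0..}. borel)"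
    unfolding clock_algebra.simps by (rule measurable_vimage_algebra1) (auto simp: space_PiM)
  from measurable_compose[OF this measurable_component_singleton[of s]]
  show "B u s \<in> borel_measurable ?A" using assms(2) by simp
qed

text \<open>Constant on negative times, so that a path can be evaluated at
  \<open>r - elapsed\<close>, which is negative outside the event of interest, and is jointly
  measurable in time and sample point on the whole real line.\<close>

definition motion :: "particle \<Rightarrow> real \<Rightarrow> 'a \<Rightarrow> real" where
  "motion u s \<omega> = B u (max 0 s) \<omega>"

lemma motion_eq: "0 \<le> s \<Longrightarrow> motion u s \<omega> = B u s \<omega>"
  by (simp add: motion_def)

text \<open>Continuity of the paths: rounding the time down to a multiple of
  \<open>1 / Suc n\<close> leaves countably many times, and the values at the rounded times
  converge.\<close>

lemma measurable_motion_pair: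
  assumes "Motion u \<in> I"
  shows "(\<lambda>(s, \<omega>). motion u s \<omega>) \<in> borel_measurable (borel \<Otimes>\<^sub>M clocks_algebra I)"
proof -
  interpret W: standard_brownian_motion M "B u" by (rule motions)
  let ?q = "\<lambda>n s. real_of_int \<lfloor>s * real (Suc n)\<rfloor> / real (Suc n)"
  have "(\<lambda>p. motion u (?q n (fst p)) (snd p)) \<in> borel_measurable (borel \<Otimes>\<^sub>M clocks_algebra I)" for n
  proof (rule measurable_compose_countable[where g = "\<lambda>p. \<lfloor>fst p * real (Suc n)\<rfloor>" and
        f = "\<lambda>i p. motion u (real_of_int i / real (Suc n)) (snd p)"])
    show "(\<lambda>p. motion u (real_of_int i / real (Suc n)) (snd p)) \<in>
        borel_measurable (borel \<Otimes>\<^sub>M clocks_algebra I)" for i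
      unfolding motion_def
      by (rule measurable_compose[OF measurable_snd measurable_motion[OF assms]]) simp
  qed measurable
  moreover have "(\<lambda>n. motion u (?q n (fst p)) (snd p)) \<longlonglongrightarrow> motion u (fst p) (snd p)"
    if p: "p \<in> space (borel \<Otimes>\<^sub>M clocks_algebra I)" for p
  proof -
    obtain s \<omega> where [simp]: "p = (s, \<omega>)" by (cases p)
    have \<omega>: "\<omega> \<in> space M" using p by (simp add: space_pair_measure)
    have "(\<lambda>n. ?q n s) \<longlonglongrightarrow> s"
    proof (rule LIMSEQ_I)
      fix e :: real assume "e > 0"
      then obtain N where N: "inverse (real (Suc N)) < e"
        using reals_Archimedean by blast
      have "norm (?q n s - s) < e" if "n \<ge> N" for n
      proof -
        have "\<bar>real_of_int \<lfloor>s * real (Suc n)\<rfloor> - s * real (Suc n)\<bar> \<le> 1" by linarith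
        moreover have "?q n s - s = (real_of_int \<lfloor>s * real (Suc n)\<rfloor> - s * real (Suc n)) / real (Suc n)"
          by (simp add: diff_divide_distrib)
        ultimately have "norm (?q n s - s) \<le> inverse (real (Suc n))"
          by (simp add: divide_inverse abs_mult mult_right_le_one_le)
        also have "\<dots> \<le> inverse (real (Suc N))" using that by simp
        finally show ?thesis using N by simp
      qed
      then show "\<exists>no. \<forall>n\<ge>no. norm (?q n s - s) < e" by blast
    qed
    then have lim: "(\<lambda>n. max 0 (?q n s)) \<longlonglongrightarrow> max 0 s" by (intro tendsto_intros)
    have "((\<lambda>t. B u t \<omega>) \<longlongrightarrow> B u (max 0 s) \<omega>) (at (max 0 s) within {0..})"
      using W.continuous_paths[OF \<omega>] by (simp add: continuous_on)
    then have "continuous (at (max 0 s) within {0..}) (\<lambda>t. B u t \<omega>)"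
      by (simp add: continuous_within)
    then have "(\<lambda>n. B u (max 0 (?q n s)) \<omega>) \<longlonglongrightarrow> B u (max 0 s) \<omega>"
      by (rule continuous_within_tendsto_compose') (use lim in auto)
    then show ?thesis by (simp add: motion_def)
  qed
  ultimately have "(\<lambda>p. motion u (fst p) (snd p)) \<in> borel_measurable (borel \<Otimes>\<^sub>M clocks_algebra I)"
    by (rule borel_measurable_LIMSEQ_metric)
  then show ?thesis by (simp add: case_prod_beta')
qed

lemma measurable_motion_compose:
  assumes "Motion u \<in> I" "f \<in> borel_measurable N" "g \<in> measurable N (clocks_algebra I)"
  shows "(\<lambda>x. motion u (f x) (g x)) \<in> borel_measurable N"
  using measurable_compose[OF measurable_Pair[OF assms(2,3)] measurable_motion_pair[OF assms(1)]]
  by simp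

end

section \<open>Exponential moments of lifetimes, gaps and motions\<close>

lemma nn_integral_exponential_density:
  assumes "0 < b" "c < b"
  shows "(\<integral>\<^sup>+x. ennreal (exponential_density b x) * ennreal (exp (c * x)) \<partial>lborel) = ennreal (b / (b - c))"
proof -
  interpret E: prob_space "density lborel (exponential_density (b - c))"
    by (rule prob_space_exponential_density) (use assms in simp)
  have "(\<integral>\<^sup>+x. ennreal (exponential_density (b - c) x) \<partial>lborel) = 1"
    using E.emeasure_space_1 by (simp add: emeasure_density)
  moreover have "ennreal (exponential_density b x) * ennreal (exp (c * x)) =
      ennreal (b / (b - c)) * ennreal (exponential_density (b - c) x)" for x
  proof -
    have "b * exp (- x * b) * exp (c * x) = b * exp (- x * (b - c))"
      by (simp add: mult_exp_exp algebra_simps)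
    also have "\<dots> = b / (b - c) * ((b - c) * exp (- x * (b - c)))"
      using assms by simp
    finally have "b * exp (- x * b) * exp (c * x) = b / (b - c) * ((b - c) * exp (- x * (b - c)))" .
    then show ?thesis
      using assms by (simp add: exponential_density_def ennreal_mult'[symmetric])
  qed
  ultimately show ?thesis by (simp add: nn_integral_cmult)
qed

lemma nn_integral_normal_density_exp:
  assumes "0 < s"
  shows "(\<integral>\<^sup>+x. ennreal (normal_density 0 s x) * ennreal (exp (c * x)) \<partial>lborel) = ennreal (exp (c\<^sup>2 * s\<^sup>2 / 2))"
proof -
  interpret N: prob_space "density lborel (normal_density (c * s\<^sup>2) s)"
    by (rule prob_space_normal_density) fact
  have "(\<integral>\<^sup>+x. ennreal (normal_density (c * s\<^sup>2) s x) \<partial>lborel) = 1"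
    using N.emeasure_space_1 by (simp add: emeasure_density)
  moreover have "ennreal (normal_density 0 s x) * ennreal (exp (c * x)) =
      ennreal (exp (c\<^sup>2 * s\<^sup>2 / 2)) * ennreal (normal_density (c * s\<^sup>2) s x)" for x
  proof -
    have "- (x\<^sup>2) / (2 * s\<^sup>2) + c * x = c\<^sup>2 * s\<^sup>2 / 2 + - ((x - c * s\<^sup>2)\<^sup>2) / (2 * s\<^sup>2)"
      using assms by (simp add: field_simps power2_eq_square)
    then have "exp (- (x\<^sup>2) / (2 * s\<^sup>2)) * exp (c * x) =
        exp (c\<^sup>2 * s\<^sup>2 / 2) * exp (- ((x - c * s\<^sup>2)\<^sup>2) / (2 * s\<^sup>2))"
      unfolding mult_exp_exp by simp
    then have "normal_density 0 s x * exp (c * x) = exp (c\<^sup>2 * s\<^sup>2 / 2) * normal_density (c * s\<^sup>2) s x"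
      by (simp add: normal_density_def)
    then show ?thesis by (simp add: ennreal_mult'[symmetric])
  qed
  ultimately show ?thesis by (simp add: nn_integral_cmult)
qed

context two_type_reducible_bbm_clocks
begin

lemma lifetime_measurable [measurable]: "T u \<in> borel_measurable M"
  using measurable_from_clocks_algebra[OF measurable_lifetime[of u UNIV]] by simp

lemma gap_measurable [measurable]: "G v k \<in> borel_measurable M"
  using measurable_from_clocks_algebra[OF measurable_gap[of v k UNIV]] by simp

lemma motion_measurable [measurable]: "motion u s \<in> borel_measurable M"
  unfolding motion_def[abs_def]
  using measurable_from_clocks_algebra[OF measurable_motion[of u UNIV "max 0 s"]] by simp

lemma nn_integral_lifetime_exp:
  assumes "0 < branching_rate \<beta> u" "c < branching_rate \<beta> u"
  shows "(\<integral>\<^sup>+\<omega>. exp (c * T u \<omega>) \<partial>M) = branching_rate \<beta> u / (branching_rate \<beta> u - c)"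
  using nn_integral_exponential_density[OF assms]
    distributed_nn_integral[OF lifetimes, of "\<lambda>x. ennreal (exp (c * x))"] by simp

lemma nn_integral_gap_exp:
  assumes "0 < \<alpha>" "c < \<alpha>"
  shows "(\<integral>\<^sup>+\<omega>. exp (c * G v k \<omega>) \<partial>M) = \<alpha> / (\<alpha> - c)"
  using nn_integral_exponential_density[OF assms]
    distributed_nn_integral[OF gaps, of "\<lambda>x. ennreal (exp (c * x))"] by simp

lemma distributed_motion:
  assumes "0 < s"
  shows "distributed M lborel (motion u s) (normal_density 0 (sqrt s))"
proof -
  interpret W: standard_brownian_motion M "B u" by (rule motions)
  have "distributed M lborel (\<lambda>\<omega>. B u s \<omega> - B u 0 \<omega>) (normal_density 0 (sqrt (s - 0)))"
    by (rule W.gaussian_increments) (use assms in auto)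
  moreover have "distr M lborel (\<lambda>\<omega>. B u s \<omega> - B u 0 \<omega>) = distr M lborel (motion u s)"
    by (rule distr_cong) (use assms in \<open>auto simp: motion_eq W.start\<close>)
  ultimately show ?thesis by (auto simp: distributed_def)
qed

lemma motion_0: "\<omega> \<in> space M \<Longrightarrow> motion u 0 \<omega> = 0"
proof -
  interpret W: standard_brownian_motion M "B u" by (rule motions)
  show "\<omega> \<in> space M \<Longrightarrow> motion u 0 \<omega> = 0" by (simp add: motion_def W.start)
qed

lemma nn_integral_motion_exp:
  assumes "0 \<le> s"
  shows "(\<integral>\<^sup>+\<omega>. exp (c * motion u s \<omega>) \<partial>M) = ennreal (exp (c\<^sup>2 * s / 2))"
proof (cases "s = 0")
  case True
  have "(\<integral>\<^sup>+\<omega>. exp (c * motion u s \<omega>) \<partial>M) = (\<integral>\<^sup>+\<omega>. 1 \<partial>M)"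
    by (rule nn_integral_cong) (simp add: True motion_0)
  with True show ?thesis by (simp add: emeasure_space_1)
next
  case False
  with assms have "0 < s" by simp
  then show ?thesis
    using nn_integral_normal_density_exp[of "sqrt s" c]
      distributed_nn_integral[OF distributed_motion, of s "\<lambda>x. ennreal (exp (c * x))"] by simp
qed

text \<open>Symmetry of the centred normal law; at time 0 the motion is 0 and the probability is 1.
  The bound is paid twice in the lower bound: at the birth of the type 2 particle and in the last
  lifetime.\<close>

lemma emeasure_motion_nonneg:
  assumes "0 \<le> s"
  shows "ennreal (1 / 2) \<le> emeasure M {\<omega> \<in> space M. 0 \<le> motion u s \<omega>}"
proof (cases "s = 0")
  case True
  then have "{\<omega> \<in> space M. 0 \<le> motion u s \<omega>} = space M" by (auto simp: motion_0)
  moreover have "ennreal (1 / 2) \<le> ennreal 1" by (rule ennreal_leI) simp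
  ultimately show ?thesis by (simp only: emeasure_space_1 ennreal_1)
next
  case False
  with assms have s: "0 < s" by simp
  let ?g = "normal_density 0 (sqrt s)"
  have 1: "emeasure M {\<omega> \<in> space M. 0 \<le> motion u s \<omega>} =
      (\<integral>\<^sup>+x. ennreal (?g x) * indicator {0..} x \<partial>lborel)"
    using distributed_emeasure[OF distributed_motion[OF s], of "{0..}" u]
    by (simp add: vimage_def Int_def conj_commute)
  have 2: "emeasure M {\<omega> \<in> space M. motion u s \<omega> \<le> 0} =
      (\<integral>\<^sup>+x. ennreal (?g x) * indicator {..0} x \<partial>lborel)"
    using distributed_emeasure[OF distributed_motion[OF s], of "{..0}" u]
    by (simp add: vimage_def Int_def conj_commute)
  have "(\<integral>\<^sup>+x. ennreal (?g x) * indicator {..0} x \<partial>lborel) =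
      (\<integral>\<^sup>+x. ennreal (?g (- x)) * indicator {..0} (- x) \<partial>lborel)"
    using nn_integral_real_affine[of "\<lambda>x. ennreal (?g x) * indicator {..0} x" "-1" 0] by simp
  also have "\<dots> = (\<integral>\<^sup>+x. ennreal (?g x) * indicator {0..} x \<partial>lborel)"
    by (rule nn_integral_cong) (auto simp: normal_density_def indicator_def)
  finally have eq: "emeasure M {\<omega> \<in> space M. motion u s \<omega> \<le> 0} =
      emeasure M {\<omega> \<in> space M. 0 \<le> motion u s \<omega>}" using 1 2 by simp
  have "1 = prob (space M)" by (simp add: prob_space)
  also have "space M = {\<omega> \<in> space M. motion u s \<omega> \<le> 0} \<union> {\<omega> \<in> space M. 0 \<le> motion u s \<omega>}"
    by auto
  also have "prob \<dots> \<le> prob {\<omega> \<in> space M. motion u s \<omega> \<le> 0} + prob {\<omega> \<in> space M. 0 \<le> motion u s \<omega>}"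
    by (rule measure_Un_le) measurable
  also have "\<dots> = 2 * prob {\<omega> \<in> space M. 0 \<le> motion u s \<omega>}"
    using eq by (simp add: measure_def)
  finally have "1 / 2 \<le> prob {\<omega> \<in> space M. 0 \<le> motion u s \<omega>}" by simp
  then show ?thesis unfolding emeasure_eq_measure by (rule ennreal_leI)
qed

text \<open>\<open>R\<close> and \<open>f\<close> are functions of clocks other than the motion of
  \<open>u\<close>, so they can be frozen while the motion is averaged.\<close>

lemma nn_integral_motion_at:
  assumes "Motion u \<notin> I" and R: "R \<in> borel_measurable (clocks_algebra I)"
    and f: "f \<in> borel_measurable (clocks_algebra I)" and h: "h \<in> borel_measurable borel"
  shows "(\<integral>\<^sup>+\<omega>. f \<omega> * h (motion u (R \<omega>) \<omega>) \<partial>M) =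
    (\<integral>\<^sup>+\<omega>. f \<omega> * (\<integral>\<^sup>+\<omega>'. h (motion u (R \<omega>) \<omega>') \<partial>M) \<partial>M)"
proof -
  let ?P = "clocks_algebra I \<Otimes>\<^sub>M clocks_algebra {Motion u}"
  note [measurable] = R f h
  have [measurable]: "(\<lambda>p. motion u (R (fst p)) (snd p)) \<in> borel_measurable ?P"
    by (rule measurable_motion_compose[of _ "{Motion u}"]) auto
  have "(\<lambda>(\<omega>, \<omega>'). f \<omega> * h (motion u (R \<omega>) \<omega>')) \<in> borel_measurable ?P"
    by measurable
  from nn_integral_decouple[OF _ this] assms(1)
  show ?thesis by (simp add: nn_integral_cmult)
qed

text \<open>Nonnegativity of \<open>R\<close> is asked only where \<open>f\<close> is nonzero:
  \<open>f\<close> may then carry the indicator of the event that the particle has been born by the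
  time in question.\<close>

lemma nn_integral_motion_at_exp:
  assumes "Motion u \<notin> I" and R: "R \<in> borel_measurable (clocks_algebra I)"
    and f: "f \<in> borel_measurable (clocks_algebra I)" and nn: "\<And>\<omega>. \<omega> \<in> space M \<Longrightarrow> f \<omega> \<noteq> 0 \<Longrightarrow> 0 \<le> R \<omega>"
  shows "(\<integral>\<^sup>+\<omega>. f \<omega> * ennreal (exp (c * motion u (R \<omega>) \<omega>)) \<partial>M) =
    (\<integral>\<^sup>+\<omega>. f \<omega> * ennreal (exp (c\<^sup>2 * R \<omega> / 2)) \<partial>M)"
proof -
  have "(\<integral>\<^sup>+\<omega>. f \<omega> * ennreal (exp (c * motion u (R \<omega>) \<omega>)) \<partial>M) =
    (\<integral>\<^sup>+\<omega>. f \<omega> * (\<integral>\<^sup>+\<omega>'. ennreal (exp (c * motion u (R \<omega>) \<omega>')) \<partial>M) \<partial>M)"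
    using nn_integral_motion_at[OF assms(1) R f, of "\<lambda>x. ennreal (exp (c * x))"] by simp
  also have "\<dots> = (\<integral>\<^sup>+\<omega>. f \<omega> * ennreal (exp (c\<^sup>2 * R \<omega> / 2)) \<partial>M)"
  proof (rule nn_integral_cong)
    fix \<omega> assume "\<omega> \<in> space M"
    with nn show "f \<omega> * (\<integral>\<^sup>+\<omega>'. ennreal (exp (c * motion u (R \<omega>) \<omega>')) \<partial>M) =
        f \<omega> * ennreal (exp (c\<^sup>2 * R \<omega> / 2))"
      by (cases "f \<omega> = 0") (auto simp: nn_integral_motion_exp)
  qed
  finally show ?thesis .
qed

section \<open>Lines of descent\<close>

definition own_clocks :: "particle set \<Rightarrow> clock set" where
  "own_clocks U = Split ` U \<union> Motion ` U"

text \<open>Lines are coded by maps \<open>\<nu>\<close> from words to particles; the type 1 tree,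
  each type 2 tree and the same-type subtree below any particle are of this form. Only strict
  ancestors contribute, so the sums refer to the birth of \<open>\<nu> w\<close>.\<close>

definition elapsed :: "(bool list \<Rightarrow> particle) \<Rightarrow> bool list \<Rightarrow> 'a \<Rightarrow> real" where
  "elapsed \<nu> w \<omega> = sum_ancestors (\<lambda>w'. T (\<nu> w') \<omega>) 0 w"

definition travelled :: "real \<Rightarrow> (bool list \<Rightarrow> particle) \<Rightarrow> bool list \<Rightarrow> 'a \<Rightarrow> real" where
  "travelled d \<nu> w \<omega> = sum_ancestors (\<lambda>w'. d * motion (\<nu> w') (T (\<nu> w') \<omega>) \<omega>) 0 w"

definition ancestral_clocks :: "(bool list \<Rightarrow> particle) \<Rightarrow> nat \<Rightarrow> clock set" where
  "ancestral_clocks \<nu> n = own_clocks (\<nu> ` {w. length w < n})"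

lemma elapsed_simps [simp]:
  "elapsed \<nu> [] \<omega> = 0" "elapsed \<nu> (c # w) \<omega> = elapsed \<nu> w \<omega> + T (\<nu> w) \<omega>"
  by (auto simp: elapsed_def)

lemma travelled_simps [simp]:
  "travelled d \<nu> [] \<omega> = 0"
  "travelled d \<nu> (c # w) \<omega> = travelled d \<nu> w \<omega> + d * motion (\<nu> w) (T (\<nu> w) \<omega>) \<omega>"
  by (auto simp: travelled_def)

lemma elapsed_nonneg: "\<omega> \<in> space M \<Longrightarrow> 0 \<le> elapsed \<nu> w \<omega>"
  by (induction w) (auto simp: lifetimes_pos less_imp_le)

lemma ancestral_clocks_mono: "m \<le> n \<Longrightarrow> ancestral_clocks \<nu> m \<subseteq> ancestral_clocks \<nu> n"
  by (auto simp: ancestral_clocks_def own_clocks_def)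

lemma ancestral_clocks_Suc:
  "length w < n \<Longrightarrow> Split (\<nu> w) \<in> ancestral_clocks \<nu> n"
  "length w < n \<Longrightarrow> Motion (\<nu> w) \<in> ancestral_clocks \<nu> n"
  by (auto simp: ancestral_clocks_def own_clocks_def)

lemma measurable_lifetime_motion:
  assumes "Split u \<in> I" "Motion u \<in> I"
  shows "(\<lambda>\<omega>. motion u (T u \<omega>) \<omega>) \<in> borel_measurable (clocks_algebra I)"
  by (rule measurable_motion_compose[OF assms(2) measurable_lifetime[OF assms(1)] measurable_ident_sets[OF refl]])

lemma measurable_line_aux:
  "ancestral_clocks \<nu> (length w) \<subseteq> I \<Longrightarrow>
    elapsed \<nu> w \<in> borel_measurable (clocks_algebra I) \<and>
    travelled d \<nu> w \<in> borel_measurable (clocks_algebra I)"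
proof (induction w)
  case (Cons c w)
  have "ancestral_clocks \<nu> (length w) \<subseteq> I"
    using Cons.prems ancestral_clocks_mono[of "length w" "length (c # w)" \<nu>] by auto
  then have [measurable]: "elapsed \<nu> w \<in> borel_measurable (clocks_algebra I)"
      "travelled d \<nu> w \<in> borel_measurable (clocks_algebra I)"
    using Cons.IH by auto
  have m: "Split (\<nu> w) \<in> I" "Motion (\<nu> w) \<in> I"
    using Cons.prems ancestral_clocks_Suc[of w "length (c # w)" \<nu>] by auto
  note [measurable] = measurable_lifetime[OF m(1)] measurable_lifetime_motion[OF m]
  show ?case by (simp cong: measurable_cong)
qed (simp cong: measurable_cong)

lemmas measurable_elapsed = measurable_line_aux[THEN conjunct1]
  and measurable_travelled = measurable_line_aux[THEN conjunct2]

lemma nn_integral_lifetime_motion_exp: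
  assumes b: "0 < branching_rate \<beta> u" and \<kappa>: "l\<^sup>2 * d\<^sup>2 / 2 < branching_rate \<beta> u + \<kappa>"
  shows "(\<integral>\<^sup>+\<omega>. ennreal (exp (l * (d * motion u (T u \<omega>) \<omega>) - \<kappa> * T u \<omega>)) \<partial>M) =
    ennreal (branching_rate \<beta> u / (branching_rate \<beta> u + \<kappa> - l\<^sup>2 * d\<^sup>2 / 2))"
proof -
  note [measurable] = measurable_lifetime[of u "{Split u}"]
  have "(\<integral>\<^sup>+\<omega>. ennreal (exp (l * (d * motion u (T u \<omega>) \<omega>) - \<kappa> * T u \<omega>)) \<partial>M) =
      (\<integral>\<^sup>+\<omega>. ennreal (exp (- \<kappa> * T u \<omega>)) * ennreal (exp ((l * d) * motion u (T u \<omega>) \<omega>)) \<partial>M)"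
    by (simp add: ennreal_mult'[symmetric] mult_exp_exp algebra_simps)
  also have "\<dots> = (\<integral>\<^sup>+\<omega>. ennreal (exp (- \<kappa> * T u \<omega>)) * ennreal (exp ((l * d)\<^sup>2 * T u \<omega> / 2)) \<partial>M)"
    by (rule nn_integral_motion_at_exp[of _ "{Split u}"]) (auto simp: lifetimes_pos less_imp_le)
  also have "\<dots> = (\<integral>\<^sup>+\<omega>. ennreal (exp ((l\<^sup>2 * d\<^sup>2 / 2 - \<kappa>) * T u \<omega>)) \<partial>M)"
    by (simp add: ennreal_mult'[symmetric] mult_exp_exp algebra_simps)
  also have "\<dots> = ennreal (branching_rate \<beta> u / (branching_rate \<beta> u + \<kappa> - l\<^sup>2 * d\<^sup>2 / 2))"
    by (subst nn_integral_lifetime_exp) (use b \<kappa> in \<open>auto simp: algebra_simps\<close>)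
  finally show ?thesis .
qed

text \<open>Induction along the line: by injectivity of \<open>\<nu>\<close>, the lifetime and
  motion of the parent use clocks outside its \<open>ancestral_clocks\<close>, so every generation
  contributes one independent factor.\<close>

lemma nn_integral_line_exp:
  assumes "inj \<nu>" and rate: "\<And>w. branching_rate \<beta> (\<nu> w) = b" and b: "0 < b"
    and \<kappa>: "l\<^sup>2 * d\<^sup>2 / 2 < b + \<kappa>"
  shows "(\<integral>\<^sup>+\<omega>. ennreal (exp (l * travelled d \<nu> w \<omega> - \<kappa> * elapsed \<nu> w \<omega>)) \<partial>M) =
    ennreal ((b / (b + \<kappa> - l\<^sup>2 * d\<^sup>2 / 2)) ^ length w)"
proof (induction w)
  case Nil
  then show ?case by (simp add: emeasure_space_1)
next
  case (Cons c w)
  let ?I = "ancestral_clocks \<nu> (length w)" and ?J = "{Split (\<nu> w), Motion (\<nu> w)}"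
  note [measurable] = measurable_elapsed[of \<nu> w ?I] measurable_travelled[of \<nu> w ?I]
    measurable_lifetime[of "\<nu> w" ?J] measurable_lifetime_motion[of "\<nu> w" ?J]
  have node: "(\<integral>\<^sup>+\<omega>. ennreal (exp (l * (d * motion (\<nu> w) (T (\<nu> w) \<omega>) \<omega>) - \<kappa> * T (\<nu> w) \<omega>)) \<partial>M) =
      ennreal (b / (b + \<kappa> - l\<^sup>2 * d\<^sup>2 / 2))"
    using nn_integral_lifetime_motion_exp[of "\<nu> w" l d \<kappa>] rate b \<kappa> by simp
  have "?I \<inter> ?J = {}"
    using injD[OF \<open>inj \<nu>\<close>] by (auto simp: ancestral_clocks_def own_clocks_def)
  then have "(\<integral>\<^sup>+\<omega>. ennreal (exp (l * travelled d \<nu> w \<omega> - \<kappa> * elapsed \<nu> w \<omega>)) *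
        ennreal (exp (l * (d * motion (\<nu> w) (T (\<nu> w) \<omega>) \<omega>) - \<kappa> * T (\<nu> w) \<omega>)) \<partial>M) =
      ennreal ((b / (b + \<kappa> - l\<^sup>2 * d\<^sup>2 / 2)) ^ length w) * ennreal (b / (b + \<kappa> - l\<^sup>2 * d\<^sup>2 / 2))"
    by (subst nn_integral_decouple_mult[of ?I ?J])
      (auto simp: Cons.IH node)
  then show ?case
    using b \<kappa> by (simp add: ennreal_mult'[symmetric] mult_exp_exp algebra_simps)
qed

end

section \<open>First moment bounds\<close>

lemma finite_words: "finite {w :: bool list. length w = n}" "finite {w :: bool list. length w < n}"
  and card_words: "card {w :: bool list. length w = n} = 2 ^ n"
proof -
  show "finite {w :: bool list. length w = n}" and "card {w :: bool list. length w = n} = 2 ^ n"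
    using finite_lists_length_eq[of "UNIV :: bool set" n] card_lists_length_eq[of "UNIV :: bool set" n]
    by simp_all
  show "finite {w :: bool list. length w < n}"
    by (rule finite_subset[OF _ finite_lists_length_le[of "UNIV :: bool set" n]]) auto
qed

lemma emeasure_words_level_le:
  fixes A :: "bool list \<Rightarrow> 'a set"
  assumes A: "\<And>w. A w \<in> sets M" and le: "\<And>w. emeasure M (A w) \<le> ennreal (c * \<rho> ^ length w)"
    and "0 \<le> c" "0 \<le> \<rho>"
  shows "emeasure M (\<Union>w\<in>{w. length w = n}. A w) \<le> ennreal (c * (2 * \<rho>) ^ n)"
proof -
  have "emeasure M (\<Union>w\<in>{w. length w = n}. A w) \<le> (\<Sum>w\<in>{w. length w = n}. emeasure M (A w))"
    by (rule emeasure_subadditive_finite) (auto simp: finite_words A)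
  also have "\<dots> \<le> (\<Sum>w\<in>{w :: bool list. length w = n}. ennreal (c * \<rho> ^ n))"
    by (rule sum_mono) (use le in force)
  also have "\<dots> = ennreal (c * (2 * \<rho>) ^ n)"
    using assms(3,4)
    by (simp add: card_words ennreal_of_nat_eq_real_of_nat ennreal_mult'[symmetric]
        power_mult_distrib ac_simps)
  finally show ?thesis .
qed

lemma emeasure_UN_words_le:
  fixes A :: "bool list \<Rightarrow> 'a set"
  assumes A: "\<And>w. A w \<in> sets M" and le: "\<And>w. emeasure M (A w) \<le> ennreal (c * \<rho> ^ length w)"
    and "0 \<le> c" "0 \<le> \<rho>" "\<rho> < 1 / 2"
  shows "emeasure M (\<Union>w. A w) \<le> ennreal (c / (1 - 2 * \<rho>))"
proof -
  have "(\<Union>w. A w) = (\<Union>n. \<Union>w\<in>{w. length w = n}. A w)" by auto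
  moreover have "range (\<lambda>n. \<Union>w\<in>{w. length w = n}. A w) \<subseteq> sets M"
    using A finite_words by auto
  ultimately have "emeasure M (\<Union>w. A w) \<le> (\<Sum>n. emeasure M (\<Union>w\<in>{w. length w = n}. A w))"
    using emeasure_subadditive_countably by metis
  also have "\<dots> \<le> (\<Sum>n. ennreal (c * (2 * \<rho>) ^ n))"
    by (rule suminf_le) (use emeasure_words_level_le[OF A le assms(3,4)] in auto)
  also have "\<dots> = ennreal (c / (1 - 2 * \<rho>))"
  proof -
    have "(\<lambda>n. c * (2 * \<rho>) ^ n) sums (c * (1 / (1 - 2 * \<rho>)))"
      by (intro sums_mult geometric_sums) (use assms in auto)
    moreover have "0 \<le> c * (2 * \<rho>) ^ n" for n
      using assms by simp
    ultimately have "(\<Sum>n. ennreal (c * (2 * \<rho>) ^ n)) = ennreal (c * (1 / (1 - 2 * \<rho>)))"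
      by (intro suminf_ennreal_eq)
    then show ?thesis by simp
  qed
  finally show ?thesis .
qed

text \<open>Borel-Cantelli over the generations: the probabilities that some word of length
  \<open>n\<close> occurs are summable, so almost surely no long word occurs.\<close>

lemma (in finite_measure) AE_finite_words:
  fixes A :: "bool list \<Rightarrow> 'a set"
  assumes A: "\<And>w. A w \<in> sets M" and le: "\<And>w. emeasure M (A w) \<le> ennreal (c * \<rho> ^ length w)"
    and "0 \<le> c" "0 \<le> \<rho>" "\<rho> < 1 / 2"
  shows "AE x in M. finite {w. x \<in> A w}"
proof -
  let ?B = "\<lambda>n. \<Union>w\<in>{w. length w = n}. A w"
  have B: "?B n \<in> sets M" for n
    using A finite_words by auto
  have "summable (\<lambda>n. measure M (?B n))"
  proof (rule summable_comparison_test')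
    show "summable (\<lambda>n. c * (2 * \<rho>) ^ n)"
      by (intro summable_mult summable_geometric) (use assms in auto)
    show "norm (measure M (?B n)) \<le> c * (2 * \<rho>) ^ n" for n
      using emeasure_words_level_le[OF A le assms(3,4), of n] assms(3,4)
      by (simp add: emeasure_eq_measure)
  qed
  with B have "AE x in M. eventually (\<lambda>n. x \<in> space M - ?B n) sequentially"
    by (intro borel_cantelli_AE1) (auto simp: less_top[symmetric])
  then show ?thesis
  proof (rule AE_mp[OF _ AE_I2], intro impI)
    fix x assume "eventually (\<lambda>n. x \<in> space M - ?B n) sequentially"
    then obtain N where "\<And>n. n \<ge> N \<Longrightarrow> x \<notin> ?B n" by (auto simp: eventually_sequentially)
    then have "{w. x \<in> A w} \<subseteq> {w. length w < N}" by (auto simp: not_less[symmetric])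
    then show "finite {w. x \<in> A w}" using finite_words finite_subset by blast
  qed
qed

lemma min_one_le_powr: "0 \<le> x \<Longrightarrow> 0 < p \<Longrightarrow> p \<le> 1 \<Longrightarrow> min 1 x \<le> (x :: real) powr p"
  using powr_mono'[of p 1 x] ge_one_powr_ge_zero[of x p] by (cases "x \<le> 1") (auto simp: min_def)

context two_type_reducible_bbm_clocks
begin

text \<open>Time \<open>r\<close> and level \<open>z\<close> are relative to the root of the line,
  so that a tree founded at a random time and place is treated by shifting both.\<close>

definition line_above :: "real \<Rightarrow> (bool list \<Rightarrow> particle) \<Rightarrow> real \<Rightarrow> real \<Rightarrow> bool list \<Rightarrow> 'a \<Rightarrow> bool" where
  "line_above d \<nu> r z w \<omega> \<longleftrightarrow> elapsed \<nu> w \<omega> \<le> r \<and> r < elapsed \<nu> w \<omega> + T (\<nu> w) \<omega> \<and>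
     z \<le> travelled d \<nu> w \<omega> + d * motion (\<nu> w) (r - elapsed \<nu> w \<omega>) \<omega>"

lemma measurable_line_M [measurable]:
  "elapsed \<nu> w \<in> borel_measurable M" "travelled d \<nu> w \<in> borel_measurable M"
  by (rule measurable_from_clocks_algebra[OF measurable_elapsed[of _ _ UNIV]], simp)
     (rule measurable_from_clocks_algebra[OF measurable_travelled[of _ _ UNIV]], simp)

lemma motion_at_measurable:
  assumes "f \<in> borel_measurable M"
  shows "(\<lambda>\<omega>. motion u (f \<omega>) \<omega>) \<in> borel_measurable M"
proof (rule measurable_motion_compose[of _ UNIV])
  show "(\<lambda>\<omega>. \<omega>) \<in> measurable M (clocks_algebra UNIV)"
    by (rule measurable_from_clocks_algebra[OF measurable_ident_sets[OF refl]])
qed (use assms in auto)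

lemma line_above_measurable [measurable]: "Measurable.pred M (line_above d \<nu> r z w)"
proof -
  have [measurable]: "(\<lambda>\<omega>. motion (\<nu> w) (r - elapsed \<nu> w \<omega>) \<omega>) \<in> borel_measurable M"
    by (rule motion_at_measurable) measurable
  show ?thesis unfolding line_above_def[abs_def] by measurable
qed

text \<open>Markov's inequality for the exponential of \<open>l\<close> times the height above
  \<open>z\<close>. When \<open>elapsed \<nu> w \<omega> \<le> r\<close>, the unfinished lifetime
  contributes at most \<open>exp (\<kappa> * (r - elapsed \<nu> w \<omega>))\<close>; this moves
  \<open>r\<close> into a constant and leaves the weight of a line of complete generations.\<close>

lemma emeasure_line_above_le:
  assumes \<nu>: "inj \<nu>" "\<And>w. branching_rate \<beta> (\<nu> w) = b" "0 < b"
    and \<kappa>: "b + l\<^sup>2 * d\<^sup>2 / 2 < \<kappa>" and "0 \<le> l"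
  shows "emeasure M {\<omega> \<in> space M. line_above d \<nu> r z w \<omega>}
    \<le> ennreal (exp (\<kappa> * r - l * z) * (b / (b + \<kappa> - l\<^sup>2 * d\<^sup>2 / 2)) ^ length w)"
proof -
  let ?I = "ancestral_clocks \<nu> (length w)"
  let ?f = "\<lambda>\<omega>. indicator {..r} (elapsed \<nu> w \<omega>) * ennreal (exp (l * travelled d \<nu> w \<omega> - l * z))"
  have I: "Motion (\<nu> w) \<notin> ?I"
    using injD[OF \<nu>(1)] by (auto simp: ancestral_clocks_def own_clocks_def)
  note [measurable] = measurable_elapsed[of \<nu> w ?I] measurable_travelled[of \<nu> w ?I]
  have "emeasure M {\<omega> \<in> space M. line_above d \<nu> r z w \<omega>} =
      (\<integral>\<^sup>+\<omega>. indicator {\<omega> \<in> space M. line_above d \<nu> r z w \<omega>} \<omega> \<partial>M)" by simp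
  also have "\<dots> \<le> (\<integral>\<^sup>+\<omega>. ?f \<omega> * ennreal (exp ((l * d) * motion (\<nu> w) (r - elapsed \<nu> w \<omega>) \<omega>)) \<partial>M)"
  proof (rule nn_integral_mono)
    fix \<omega>
    have "1 \<le> exp (l * travelled d \<nu> w \<omega> - l * z) * exp ((l * d) * motion (\<nu> w) (r - elapsed \<nu> w \<omega>) \<omega>)"
      if "z \<le> travelled d \<nu> w \<omega> + d * motion (\<nu> w) (r - elapsed \<nu> w \<omega>) \<omega>"
      using mult_left_mono[OF that \<open>0 \<le> l\<close>] by (simp add: mult_exp_exp algebra_simps)
    then show "indicator {\<omega> \<in> space M. line_above d \<nu> r z w \<omega>} \<omega> \<le>
        ?f \<omega> * ennreal (exp ((l * d) * motion (\<nu> w) (r - elapsed \<nu> w \<omega>) \<omega>))"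
      by (auto simp: indicator_def line_above_def ennreal_mult'[symmetric])
  qed
  also have "\<dots> = (\<integral>\<^sup>+\<omega>. ?f \<omega> * ennreal (exp ((l * d)\<^sup>2 * (r - elapsed \<nu> w \<omega>) / 2)) \<partial>M)"
    by (rule nn_integral_motion_at_exp[OF I]) (auto simp: indicator_def split: if_splits)
  also have "\<dots> \<le> (\<integral>\<^sup>+\<omega>. ennreal (exp (\<kappa> * r - l * z)) *
      ennreal (exp (l * travelled d \<nu> w \<omega> - \<kappa> * elapsed \<nu> w \<omega>)) \<partial>M)"
  proof (rule nn_integral_mono)
    fix \<omega>
    have "(l * d)\<^sup>2 * (r - elapsed \<nu> w \<omega>) / 2 \<le> \<kappa> * (r - elapsed \<nu> w \<omega>)" if "elapsed \<nu> w \<omega> \<le> r"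
    proof -
      have "(l * d)\<^sup>2 / 2 \<le> \<kappa>" using \<kappa> \<open>0 < b\<close> by (simp add: power_mult_distrib)
      then show ?thesis using mult_right_mono[of "(l * d)\<^sup>2 / 2" \<kappa> "r - elapsed \<nu> w \<omega>"] that by simp
    qed
    then show "?f \<omega> * ennreal (exp ((l * d)\<^sup>2 * (r - elapsed \<nu> w \<omega>) / 2)) \<le>
        ennreal (exp (\<kappa> * r - l * z)) * ennreal (exp (l * travelled d \<nu> w \<omega> - \<kappa> * elapsed \<nu> w \<omega>))"
      by (auto simp: indicator_def ennreal_mult'[symmetric] mult_exp_exp algebra_simps)
  qed
  also have "\<dots> = ennreal (exp (\<kappa> * r - l * z)) *
      ennreal ((b / (b + \<kappa> - l\<^sup>2 * d\<^sup>2 / 2)) ^ length w)"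
    using nn_integral_line_exp[OF \<nu>, of l d \<kappa> w] \<kappa> \<nu>(3) by (simp add: nn_integral_cmult)
  finally show ?thesis by (simp add: ennreal_mult'[symmetric])
qed

text \<open>For \<open>p < 1\<close> the bound is of use below the speed of the branching Brownian motion, where the
  expected number of particles is exponentially large.\<close>

lemma emeasure_tree_above_le:
  assumes b: "0 < b" and p: "0 < p" "p \<le> 1" and "0 \<le> \<mu>" and \<kappa>: "p * b + \<mu>\<^sup>2 * d\<^sup>2 / (2 * p) < \<kappa>"
  obtains K where "0 \<le> K" and "\<And>\<nu> r z. inj \<nu> \<Longrightarrow> (\<And>w. branching_rate \<beta> (\<nu> w) = b) \<Longrightarrow>
    emeasure M {\<omega> \<in> space M. \<exists>w. line_above d \<nu> r z w \<omega>} \<le> ennreal (K * exp (\<kappa> * r - \<mu> * z))"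
proof
  define l k where "l = \<mu> / p" and "k = \<kappa> / p"
  define \<rho> where "\<rho> = b / (b + k - l\<^sup>2 * d\<^sup>2 / 2)"
  have "p * (b + l\<^sup>2 * d\<^sup>2 / 2) = p * b + \<mu>\<^sup>2 * d\<^sup>2 / (2 * p)" and "p * k = \<kappa>"
    using p by (simp_all add: l_def k_def field_simps power2_eq_square)
  then have "p * (b + l\<^sup>2 * d\<^sup>2 / 2) < p * k"
    using \<kappa> by simp
  then have k: "b + l\<^sup>2 * d\<^sup>2 / 2 < k" using p by simp
  \<comment> \<open>Above criticality the denominator of \<open>\<rho>\<close> exceeds
    \<open>2 * b\<close>, so the ratio beats the doubling of words and the union bound
    converges.\<close>
  then have \<rho>: "0 \<le> \<rho>" "\<rho> < 1 / 2"
    using b by (auto simp: \<rho>_def field_simps)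
  let ?K = "(1 / (1 - 2 * \<rho>)) powr p"
  show "0 \<le> ?K" by simp
  fix \<nu> :: "bool list \<Rightarrow> particle" and r z
  assume \<nu>: "inj \<nu>" "\<And>w. branching_rate \<beta> (\<nu> w) = b"
  let ?E = "{\<omega> \<in> space M. \<exists>w. line_above d \<nu> r z w \<omega>}"
  have "?E = (\<Union>w. {\<omega> \<in> space M. line_above d \<nu> r z w \<omega>})" by auto
  then have "emeasure M ?E \<le> ennreal (exp (k * r - l * z) / (1 - 2 * \<rho>))"
    using emeasure_UN_words_le[of "\<lambda>w. {\<omega> \<in> space M. line_above d \<nu> r z w \<omega>}" M "exp (k * r - l * z)" \<rho>]
      emeasure_line_above_le[OF \<nu> b k, of r z] \<open>0 \<le> \<mu>\<close> p \<rho>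
    by (simp add: \<rho>_def l_def)
  then have "prob ?E \<le> exp (k * r - l * z) / (1 - 2 * \<rho>)"
    using \<rho> by (simp add: emeasure_eq_measure)
  then have "prob ?E \<le> min 1 (exp (k * r - l * z) * (1 / (1 - 2 * \<rho>)))" by simp
  also have "\<dots> \<le> (exp (k * r - l * z) * (1 / (1 - 2 * \<rho>))) powr p"
    using \<rho> p by (intro min_one_le_powr) auto
  also have "\<dots> = ?K * exp (\<kappa> * r - \<mu> * z)"
  proof -
    have "exp (k * r - l * z) powr p = exp (p * (k * r - l * z))" by (simp add: powr_def)
    also have "p * (k * r - l * z) = \<kappa> * r - \<mu> * z" using p by (simp add: k_def l_def field_simps)
    finally show ?thesis using \<rho> by (subst powr_mult) auto
  qed
  finally show "emeasure M ?E \<le> ennreal (?K * exp (\<kappa> * r - \<mu> * z))"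
    by (simp add: emeasure_eq_measure ennreal_leI)
qed

section \<open>Births of type 2 particles\<close>

definition child_time :: "bool list \<Rightarrow> nat \<Rightarrow> 'a \<Rightarrow> real" where
  "child_time v k \<omega> = child_age (\<lambda>v k. G v k \<omega>) v k"

lemma child_time_simps [simp]:
  "child_time v 0 \<omega> = G v 0 \<omega>" "child_time v (Suc k) \<omega> = child_time v k \<omega> + G v (Suc k) \<omega>"
  by (auto simp: child_time_def child_age_def)

lemma child_time_pos: "\<omega> \<in> space M \<Longrightarrow> 0 < child_time v k \<omega>"
  by (induction k) (auto simp: gaps_pos add_pos_pos)

lemma measurable_child_time:
  "Gap v ` {..k} \<subseteq> I \<Longrightarrow> child_time v k \<in> borel_measurable (clocks_algebra I)"
proof (induction k)
  case 0
  then show ?case using measurable_gap[of v 0 I] by (simp cong: measurable_cong)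
next
  case (Suc k)
  then have [measurable]: "child_time v k \<in> borel_measurable (clocks_algebra I)"
    "G v (Suc k) \<in> borel_measurable (clocks_algebra I)"
    by (auto intro!: Suc.IH measurable_gap)
  show ?case by (simp cong: measurable_cong)
qed

lemma child_time_measurable [measurable]: "child_time v k \<in> borel_measurable M"
  by (rule measurable_from_clocks_algebra[OF measurable_child_time[of _ _ UNIV]]) simp

lemma nn_integral_child_time_exp:
  assumes "0 < \<alpha>" "c < \<alpha>"
  shows "(\<integral>\<^sup>+\<omega>. ennreal (exp (c * child_time v k \<omega>)) \<partial>M) = ennreal ((\<alpha> / (\<alpha> - c)) ^ Suc k)"
proof (induction k)
  case 0
  show ?case using nn_integral_gap_exp[OF assms] by simp
next
  case (Suc k)
  let ?I = "Gap v ` {..k}" and ?J = "{Gap v (Suc k)}"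
  note [measurable] = measurable_child_time[of v k ?I] measurable_gap[of v "Suc k" ?J]
  have "(\<integral>\<^sup>+\<omega>. ennreal (exp (c * child_time v k \<omega>)) * ennreal (exp (c * G v (Suc k) \<omega>)) \<partial>M) =
      ennreal ((\<alpha> / (\<alpha> - c)) ^ Suc k) * ennreal (\<alpha> / (\<alpha> - c))"
    by (subst nn_integral_decouple_mult[of ?I ?J])
      (auto simp: Suc.IH nn_integral_gap_exp assms simp del: power_Suc)
  then show ?case
    using assms by (simp add: ennreal_mult'[symmetric] mult_exp_exp algebra_simps)
qed

definition birth2_time :: "bool list \<Rightarrow> nat \<Rightarrow> 'a \<Rightarrow> real" where
  "birth2_time v k \<omega> = elapsed Type1 v \<omega> + child_time v k \<omega>"

definition birth2_position :: "real \<Rightarrow> bool list \<Rightarrow> nat \<Rightarrow> 'a \<Rightarrow> real" where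
  "birth2_position \<sigma> v k \<omega> = travelled \<sigma> Type1 v \<omega> + \<sigma> * motion (Type1 v) (child_time v k \<omega>) \<omega>"

definition birth2_clocks :: "bool list \<Rightarrow> nat \<Rightarrow> clock set" where
  "birth2_clocks v k = insert (Motion (Type1 v)) (ancestral_clocks Type1 (length v) \<union> Gap v ` {..k})"

lemma measurable_birth2:
  assumes "birth2_clocks v k \<subseteq> I"
  shows "birth2_time v k \<in> borel_measurable (clocks_algebra I)"
    and "birth2_position \<sigma> v k \<in> borel_measurable (clocks_algebra I)"
proof -
  have sub: "ancestral_clocks Type1 (length v) \<subseteq> I" "Gap v ` {..k} \<subseteq> I" "Motion (Type1 v) \<in> I"
    using assms by (auto simp: birth2_clocks_def)
  note [measurable] = measurable_elapsed[OF sub(1)] measurable_travelled[OF sub(1)]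
    measurable_child_time[OF sub(2)]
    measurable_motion_compose[OF sub(3) measurable_child_time[OF sub(2)] measurable_ident_sets[OF refl]]
  show "birth2_time v k \<in> borel_measurable (clocks_algebra I)"
    unfolding birth2_time_def[abs_def] by measurable
  show "birth2_position \<sigma> v k \<in> borel_measurable (clocks_algebra I)"
    unfolding birth2_position_def[abs_def] by measurable
qed

text \<open>The path to the birth splits into the strict ancestors of \<open>v\<close> and the
  stretch of \<open>Type1 v\<close> itself up to its \<open>k\<close>-th Poisson point, which depend
  on disjoint clocks. Each gap contributes a factor below 1, so the series over \<open>k\<close>
  will converge geometrically.\<close>

lemma nn_integral_birth2_exp:
  assumes b: "0 < \<beta>" "0 < \<alpha>" and \<kappa>: "l\<^sup>2 * \<sigma>\<^sup>2 / 2 < \<kappa>"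
  shows "(\<integral>\<^sup>+\<omega>. ennreal (exp (l * birth2_position \<sigma> v k \<omega> - \<kappa> * birth2_time v k \<omega>)) \<partial>M) =
    ennreal ((\<beta> / (\<beta> + \<kappa> - l\<^sup>2 * \<sigma>\<^sup>2 / 2)) ^ length v * (\<alpha> / (\<alpha> + \<kappa> - l\<^sup>2 * \<sigma>\<^sup>2 / 2)) ^ Suc k)"
proof -
  let ?I = "ancestral_clocks Type1 (length v)" and ?J = "insert (Motion (Type1 v)) (Gap v ` {..k})"
  let ?f = "\<lambda>\<omega>. ennreal (exp (l * travelled \<sigma> Type1 v \<omega> - \<kappa> * elapsed Type1 v \<omega>))"
  let ?g = "\<lambda>\<omega>. ennreal (exp (- \<kappa> * child_time v k \<omega>)) *
    ennreal (exp ((l * \<sigma>) * motion (Type1 v) (child_time v k \<omega>) \<omega>))"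
  have disj: "?I \<inter> ?J = {}"
    by (auto simp: ancestral_clocks_def own_clocks_def)
  note [measurable] = measurable_elapsed[of Type1 v ?I] measurable_travelled[of Type1 v ?I]
  have [measurable]: "child_time v k \<in> borel_measurable (clocks_algebra ?J)"
    by (rule measurable_child_time) auto
  have [measurable]: "(\<lambda>\<omega>. motion (Type1 v) (child_time v k \<omega>) \<omega>) \<in> borel_measurable (clocks_algebra ?J)"
    by (rule measurable_motion_compose[OF _ measurable_child_time measurable_ident_sets[OF refl]]) auto
  have f: "(\<integral>\<^sup>+\<omega>. ?f \<omega> \<partial>M) = ennreal ((\<beta> / (\<beta> + \<kappa> - l\<^sup>2 * \<sigma>\<^sup>2 / 2)) ^ length v)"
    by (rule nn_integral_line_exp) (use assms in \<open>auto simp: inj_def\<close>)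
  have "(\<integral>\<^sup>+\<omega>. ?g \<omega> \<partial>M) = (\<integral>\<^sup>+\<omega>. ennreal (exp (- \<kappa> * child_time v k \<omega>)) *
      ennreal (exp ((l * \<sigma>)\<^sup>2 * child_time v k \<omega> / 2)) \<partial>M)"
  proof (rule nn_integral_motion_at_exp[of _ "Gap v ` {..k}"])
    note [measurable] = measurable_child_time[of v k "Gap v ` {..k}"]
    show "child_time v k \<in> borel_measurable (clocks_algebra (Gap v ` {..k}))"
      "(\<lambda>\<omega>. ennreal (exp (- \<kappa> * child_time v k \<omega>))) \<in> borel_measurable (clocks_algebra (Gap v ` {..k}))"
      by measurable
  qed (auto simp: child_time_pos less_imp_le)
  also have "\<dots> = (\<integral>\<^sup>+\<omega>. ennreal (exp ((l\<^sup>2 * \<sigma>\<^sup>2 / 2 - \<kappa>) * child_time v k \<omega>)) \<partial>M)"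
    by (simp add: ennreal_mult'[symmetric] mult_exp_exp algebra_simps)
  also have "\<dots> = ennreal ((\<alpha> / (\<alpha> + \<kappa> - l\<^sup>2 * \<sigma>\<^sup>2 / 2)) ^ Suc k)"
    using nn_integral_child_time_exp[of "l\<^sup>2 * \<sigma>\<^sup>2 / 2 - \<kappa>" v k] assms by (simp add: algebra_simps)
  finally have g: "(\<integral>\<^sup>+\<omega>. ?g \<omega> \<partial>M) = ennreal ((\<alpha> / (\<alpha> + \<kappa> - l\<^sup>2 * \<sigma>\<^sup>2 / 2)) ^ Suc k)" .
  have "(\<integral>\<^sup>+\<omega>. ?f \<omega> * ?g \<omega> \<partial>M) = (\<integral>\<^sup>+\<omega>. ?f \<omega> \<partial>M) * (\<integral>\<^sup>+\<omega>. ?g \<omega> \<partial>M)"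
    by (rule nn_integral_decouple_mult[OF disj]) measurable
  moreover have "?f \<omega> * ?g \<omega> =
      ennreal (exp (l * birth2_position \<sigma> v k \<omega> - \<kappa> * birth2_time v k \<omega>))" for \<omega>
    by (simp add: ennreal_mult'[symmetric] mult_exp_exp birth2_position_def birth2_time_def algebra_simps)
  ultimately show ?thesis
    using f g assms by (simp add: ennreal_mult'[symmetric] del: power_Suc)
qed

text \<open>An enlargement of the actual event: Poisson points after the death of the mother are
  counted as births too. The overcount costs a geometric series in \<open>k\<close>.\<close>

definition type2_above :: "real \<Rightarrow> real \<Rightarrow> real \<Rightarrow> bool list \<Rightarrow> nat \<Rightarrow> 'a \<Rightarrow> bool" where
  "type2_above \<sigma> t z v k \<omega> \<longleftrightarrow> birth2_time v k \<omega> \<le> t \<and>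
    (\<exists>w. line_above 1 (Type2 v k) (t - birth2_time v k \<omega>) (z - birth2_position \<sigma> v k \<omega>) w \<omega>)"

lemma measurable_line_above_pair:
  assumes "own_clocks (range \<nu>) \<subseteq> J" "r \<in> borel_measurable N" "z \<in> borel_measurable N"
  shows "Measurable.pred (N \<Otimes>\<^sub>M clocks_algebra J) (\<lambda>p. line_above d \<nu> (r (fst p)) (z (fst p)) w (snd p))"
proof -
  have "ancestral_clocks \<nu> (length w) \<subseteq> J" "Split (\<nu> w) \<in> J" and mot: "Motion (\<nu> w) \<in> J"
    using assms by (auto simp: ancestral_clocks_def own_clocks_def)
  note [measurable] = measurable_elapsed[OF this(1)] measurable_travelled[OF this(1)]
    measurable_lifetime[OF this(2)] assms(2,3)
  have [measurable]: "(\<lambda>p. motion (\<nu> w) (r (fst p) - elapsed \<nu> w (snd p)) (snd p)) \<in>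
      borel_measurable (N \<Otimes>\<^sub>M clocks_algebra J)"
    by (rule measurable_motion_compose[OF mot]) measurable
  show ?thesis unfolding line_above_def by measurable
qed

lemma emeasure_type2_above_le:
  assumes b: "0 < \<beta>" "0 < \<alpha>" and p: "0 < p" "p \<le> 1" and "0 \<le> \<mu>"
    and \<kappa>1: "\<beta> + \<mu>\<^sup>2 * \<sigma>\<^sup>2 / 2 < \<kappa>" and \<kappa>2: "p + \<mu>\<^sup>2 / (2 * p) < \<kappa>"
  obtains K where "0 \<le> K" and "\<And>t z. {\<omega> \<in> space M. \<exists>v k. type2_above \<sigma> t z v k \<omega>} \<in> sets M \<and>
    emeasure M {\<omega> \<in> space M. \<exists>v k. type2_above \<sigma> t z v k \<omega>} \<le> ennreal (K * exp (\<kappa> * t - \<mu> * z))"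
proof -
  obtain K where K: "0 \<le> K" "\<And>\<nu> r z. inj \<nu> \<Longrightarrow> (\<And>w. branching_rate \<beta> (\<nu> w) = 1) \<Longrightarrow>
    emeasure M {\<omega> \<in> space M. \<exists>w. line_above 1 \<nu> r z w \<omega>} \<le> ennreal (K * exp (\<kappa> * r - \<mu> * z))"
    by (rule emeasure_tree_above_le[of 1 p \<mu> 1 \<kappa>]) (use assms in auto)
  define \<psi> where "\<psi> = \<mu>\<^sup>2 * \<sigma>\<^sup>2 / 2"
  define \<rho> q where "\<rho> = \<beta> / (\<beta> + \<kappa> - \<psi>)" and "q = \<alpha> / (\<alpha> + \<kappa> - \<psi>)"
  have \<rho>: "0 \<le> \<rho>" "\<rho> < 1 / 2" and q: "0 \<le> q" "q < 1"
    using b \<kappa>1 by (auto simp: \<rho>_def q_def \<psi>_def field_simps)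
  define E where "E t z v k = {\<omega> \<in> space M. type2_above \<sigma> t z v k \<omega>}" for t z v k
  have one: "E t z v k \<in> sets M \<and>
      emeasure M (E t z v k) \<le> ennreal (K * exp (\<kappa> * t - \<mu> * z) * (\<rho> ^ length v * q ^ Suc k))"
    for t z v k
  proof -
    let ?I = "birth2_clocks v k" and ?J = "own_clocks (range (Type2 v k))"
    let ?R = "birth2_time v k" and ?Y = "birth2_position \<sigma> v k"
    let ?P = "clocks_algebra ?I \<Otimes>\<^sub>M clocks_algebra ?J"
    define Q where "Q p \<longleftrightarrow> ?R (fst p) \<le> t \<and>
      (\<exists>w. line_above 1 (Type2 v k) (t - ?R (fst p)) (z - ?Y (fst p)) w (snd p))" for p
    have disj: "?I \<inter> ?J = {}"
      by (auto simp: birth2_clocks_def ancestral_clocks_def own_clocks_def)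
    note [measurable] = measurable_birth2[of v k ?I, OF order_refl]
    have [measurable]: "Measurable.pred ?P
        (\<lambda>p. line_above 1 (Type2 v k) (t - ?R (fst p)) (z - ?Y (fst p)) w (snd p))" for w
      by (rule measurable_line_above_pair) auto
    have Q [measurable]: "Measurable.pred ?P Q"
      unfolding Q_def[abs_def] by measurable
    have [measurable]: "?R \<in> borel_measurable M" "?Y \<in> borel_measurable M"
      by (auto intro: measurable_from_clocks_algebra measurable_birth2[OF order_refl])
    have "(\<lambda>\<omega>. (\<omega>, \<omega>)) \<in> measurable M ?P"
      by (intro measurable_Pair measurable_from_clocks_algebra[OF measurable_ident_sets[OF refl]])
    from measurable_compose[OF this Q]
    have Em: "E t z v k \<in> sets M"
      unfolding E_def type2_above_def Q_def by simp
    have "emeasure M (E t z v k) = (\<integral>\<^sup>+\<omega>. indicator {p. Q p} (\<omega>, \<omega>) \<partial>M)"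
      unfolding nn_integral_indicator[OF Em, symmetric]
      by (rule nn_integral_cong) (auto simp: E_def Q_def type2_above_def indicator_def)
    also have "\<dots> = (\<integral>\<^sup>+\<omega>'. (\<integral>\<^sup>+\<omega>. indicator {p. Q p} (\<omega>', \<omega>) \<partial>M) \<partial>M)"
      by (rule nn_integral_decouple[OF disj]) measurable
    also have "\<dots> \<le> (\<integral>\<^sup>+\<omega>'. ennreal (K * exp (\<kappa> * t - \<mu> * z)) *
        ennreal (exp (\<mu> * ?Y \<omega>' - \<kappa> * ?R \<omega>')) \<partial>M)"
    proof (rule nn_integral_mono)
      fix \<omega>'
      let ?L = "{\<omega> \<in> space M. \<exists>w. line_above 1 (Type2 v k) (t - ?R \<omega>') (z - ?Y \<omega>') w \<omega>}"
      have "(\<integral>\<^sup>+\<omega>. indicator {p. Q p} (\<omega>', \<omega>) \<partial>M) \<le> (\<integral>\<^sup>+\<omega>. indicator ?L \<omega> \<partial>M)"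
        by (rule nn_integral_mono) (auto simp: Q_def indicator_def)
      also have "\<dots> = emeasure M ?L" by simp
      also have "\<dots> \<le> ennreal (K * exp (\<kappa> * (t - ?R \<omega>') - \<mu> * (z - ?Y \<omega>')))"
        by (rule K(2)) (auto simp: inj_def)
      also have "\<dots> = ennreal (K * exp (\<kappa> * t - \<mu> * z)) * ennreal (exp (\<mu> * ?Y \<omega>' - \<kappa> * ?R \<omega>'))"
        using K(1) by (simp add: ennreal_mult'[symmetric] mult_exp_exp algebra_simps)
      finally show "(\<integral>\<^sup>+\<omega>. indicator {p. Q p} (\<omega>', \<omega>) \<partial>M) \<le> \<dots>" .
    qed
    also have "\<dots> = ennreal (K * exp (\<kappa> * t - \<mu> * z)) * ennreal (\<rho> ^ length v * q ^ Suc k)"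
      using nn_integral_birth2_exp[of \<mu> \<sigma> \<kappa> v k] assms
      by (simp add: nn_integral_cmult \<rho>_def q_def \<psi>_def)
    also have "\<dots> = ennreal (K * exp (\<kappa> * t - \<mu> * z) * (\<rho> ^ length v * q ^ Suc k))"
      using K(1) \<rho> q by (simp add: ennreal_mult'[symmetric])
    finally show ?thesis using Em by simp
  qed
  have two: "(\<Union>k. E t z v k) \<in> sets M \<and>
      emeasure M (\<Union>k. E t z v k) \<le> ennreal (K * exp (\<kappa> * t - \<mu> * z) * (q / (1 - q)) * \<rho> ^ length v)"
    for t z v
  proof -
    have "emeasure M (\<Union>k. E t z v k) \<le> (\<Sum>k. emeasure M (E t z v k))"
      by (rule emeasure_subadditive_countably) (use one in auto)
    also have "\<dots> \<le> (\<Sum>k. ennreal (K * exp (\<kappa> * t - \<mu> * z) * (\<rho> ^ length v * q ^ Suc k)))"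
      by (rule suminf_le) (use one in auto)
    also have "\<dots> = ennreal (K * exp (\<kappa> * t - \<mu> * z) * (\<rho> ^ length v * (q * (1 / (1 - q)))))"
    proof -
      have "(\<lambda>k. K * exp (\<kappa> * t - \<mu> * z) * (\<rho> ^ length v * (q * q ^ k))) sums
          (K * exp (\<kappa> * t - \<mu> * z) * (\<rho> ^ length v * (q * (1 / (1 - q)))))"
        by (intro sums_mult geometric_sums) (use q in auto)
      moreover have "0 \<le> K * exp (\<kappa> * t - \<mu> * z) * (\<rho> ^ length v * (q * q ^ k))" for k
        using K(1) \<rho> q by simp
      ultimately show ?thesis
        unfolding power_Suc by (intro suminf_ennreal_eq)
    qed
    finally show ?thesis using one by (auto simp: ac_simps)
  qed
  define K' where "K' = K * (q / (1 - q)) / (1 - 2 * \<rho>)"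
  have eq: "{\<omega> \<in> space M. \<exists>v k. type2_above \<sigma> t z v k \<omega>} = (\<Union>v. \<Union>k. E t z v k)" for t z
    by (auto simp: E_def)
  show thesis
  proof (rule that)
    show "0 \<le> K'" using K(1) \<rho> q by (simp add: K'_def)
    fix t z
    have meas: "(\<Union>v. \<Union>k. E t z v k) \<in> sets M"
      by (rule sets.countable_UN) (use two in auto)
    have "emeasure M (\<Union>v. \<Union>k. E t z v k) \<le>
        ennreal (K * exp (\<kappa> * t - \<mu> * z) * (q / (1 - q)) / (1 - 2 * \<rho>))"
      by (rule emeasure_UN_words_le) (use two K(1) \<rho> q in auto)
    also have "K * exp (\<kappa> * t - \<mu> * z) * (q / (1 - q)) / (1 - 2 * \<rho>) = K' * exp (\<kappa> * t - \<mu> * z)"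
      by (simp add: K'_def)
    finally have "emeasure M (\<Union>v. \<Union>k. E t z v k) \<le> ennreal (K' * exp (\<kappa> * t - \<mu> * z))" .
    then show "{\<omega> \<in> space M. \<exists>v k. type2_above \<sigma> t z v k \<omega>} \<in> sets M \<and>
        emeasure M {\<omega> \<in> space M. \<exists>v k. type2_above \<sigma> t z v k \<omega>} \<le>
        ennreal (K' * exp (\<kappa> * t - \<mu> * z))"
      unfolding eq using meas by simp
  qed
qed

end

section \<open>The maximal position\<close>

lemma sum_ancestors_shift: "sum_ancestors f x w = x + sum_ancestors f 0 w"
  by (induction w) auto

text \<open>\<open>Max\<close> is a fold, and a fold over an infinite set returns its start value.
  Hence one constant covers both degenerate cases when measurability of the maximum is
  checked.\<close>

lemma Max_infinite: "infinite A \<Longrightarrow> Max A = Max {}"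
  by (simp add: Max.eq_fold')

context two_type_reducible_bbm_clocks
begin

definition alive :: "real \<Rightarrow> 'a \<Rightarrow> particle set" where
  "alive t \<omega> = alive_particles (\<lambda>u. T u \<omega>) (\<lambda>v k. G v k \<omega>) t"

definition position :: "real \<Rightarrow> real \<Rightarrow> particle \<Rightarrow> 'a \<Rightarrow> real" where
  "position \<sigma> t u \<omega> = particle_position \<sigma> (\<lambda>u. T u \<omega>) (\<lambda>v k. G v k \<omega>) (\<lambda>u s. B u s \<omega>) t u"

definition maximum :: "real \<Rightarrow> real \<Rightarrow> 'a \<Rightarrow> real" where
  "maximum \<sigma> t \<omega> = max_position \<sigma> (\<lambda>u. T u \<omega>) (\<lambda>v k. G v k \<omega>) (\<lambda>u s. B u s \<omega>) t"

fun born :: "particle \<Rightarrow> 'a \<Rightarrow> real" where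
  "born (Type1 v) \<omega> = elapsed Type1 v \<omega>"
| "born (Type2 v k w) \<omega> = birth2_time v k \<omega> + elapsed (Type2 v k) w \<omega>"

fun birthplace :: "real \<Rightarrow> particle \<Rightarrow> 'a \<Rightarrow> real" where
  "birthplace \<sigma> (Type1 v) \<omega> = travelled \<sigma> Type1 v \<omega>"
| "birthplace \<sigma> (Type2 v k w) \<omega> = birth2_position \<sigma> v k \<omega> + travelled 1 (Type2 v k) w \<omega>"

lemma birth_time_eq: "birth_time (\<lambda>u. T u \<omega>) (\<lambda>v k. G v k \<omega>) u = born u \<omega>"
  by (cases u) (simp_all add: birth_time1_def elapsed_def birth2_time_def child_time_def
      sum_ancestors_shift[of _ "_ + _"])

lemma travelled_eq:
  "\<omega> \<in> space M \<Longrightarrow> travelled d \<nu> w \<omega> = sum_ancestors (\<lambda>w'. d * B (\<nu> w') (T (\<nu> w') \<omega>) \<omega>) 0 w"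
  by (simp add: travelled_def motion_eq lifetimes_pos less_imp_le)

lemma birth_position_eq:
  "\<omega> \<in> space M \<Longrightarrow>
    birth_position \<sigma> (\<lambda>u. T u \<omega>) (\<lambda>v k. G v k \<omega>) (\<lambda>u s. B u s \<omega>) u = birthplace \<sigma> u \<omega>"
  by (cases u) (simp_all add: birth_position1_def travelled_eq birth2_position_def motion_eq
      child_time_pos less_imp_le child_time_def[symmetric] sum_ancestors_shift[of _ "_ + _"])

lemma alive_Type1: "Type1 v \<in> alive t \<omega> \<longleftrightarrow> born (Type1 v) \<omega> \<le> t \<and> t < born (Type1 v) \<omega> + T (Type1 v) \<omega>"
  by (simp add: alive_def alive_particles_def birth_time_eq)

lemma alive_Type2: "Type2 v k w \<in> alive t \<omega> \<longleftrightarrow> child_time v k \<omega> < T (Type1 v) \<omega> \<and>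
    born (Type2 v k w) \<omega> \<le> t \<and> t < born (Type2 v k w) \<omega> + T (Type2 v k w) \<omega>"
  by (simp add: alive_def alive_particles_def birth_time_eq child_time_def)

lemma alive_born: "u \<in> alive t \<omega> \<Longrightarrow> born u \<omega> \<le> t"
  by (cases u) (auto simp: alive_Type1 alive_Type2)

text \<open>A version of the position built from \<open>motion\<close>, hence measurable also where
  \<open>t\<close> precedes the birth; the two agree on living particles.\<close>

definition place :: "real \<Rightarrow> real \<Rightarrow> particle \<Rightarrow> 'a \<Rightarrow> real" where
  "place \<sigma> t u \<omega> = birthplace \<sigma> u \<omega> + diffusivity \<sigma> u * motion u (t - born u \<omega>) \<omega>"

lemma position_alive:
  assumes "\<omega> \<in> space M" "u \<in> alive t \<omega>"
  shows "position \<sigma> t u \<omega> = place \<sigma> t u \<omega>"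
  using alive_born[OF assms(2)]
  by (simp add: position_def particle_position_def birth_position_eq[OF assms(1)] birth_time_eq
      motion_eq place_def)

lemma birth2_measurable [measurable]:
  "birth2_time v k \<in> borel_measurable M" "birth2_position \<sigma> v k \<in> borel_measurable M"
  by (auto intro: measurable_from_clocks_algebra measurable_birth2[OF order_refl])

lemma born_measurable [measurable]: "born u \<in> borel_measurable M"
  by (cases u) (simp_all cong: measurable_cong)

lemma birthplace_measurable [measurable]: "birthplace \<sigma> u \<in> borel_measurable M"
  by (cases u) (simp_all cong: measurable_cong)

lemma place_measurable [measurable]: "place \<sigma> t u \<in> borel_measurable M"
proof -
  have [measurable]: "(\<lambda>\<omega>. motion u (t - born u \<omega>) \<omega>) \<in> borel_measurable M"
    by (rule motion_at_measurable) measurable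
  show ?thesis unfolding place_def[abs_def] by measurable
qed

lemma alive_measurable [measurable]: "Measurable.pred M (\<lambda>\<omega>. u \<in> alive t \<omega>)"
proof (cases u)
  case (Type1 v)
  then show ?thesis unfolding Type1 alive_Type1 by measurable
next
  case (Type2 v k w)
  then show ?thesis unfolding Type2 alive_Type2 by measurable
qed

text \<open>Stands in for the maximum: a countable union over particles, measurable whether or not
  the population is finite, and for \<open>0 \<le> t\<close> almost surely the same event as the
  maximum being at least \<open>z\<close>.\<close>

definition above :: "real \<Rightarrow> real \<Rightarrow> real \<Rightarrow> 'a \<Rightarrow> bool" where
  "above \<sigma> t z \<omega> \<longleftrightarrow> (\<exists>u. u \<in> alive t \<omega> \<and> z \<le> place \<sigma> t u \<omega>)"

lemma above_measurable [measurable]: "Measurable.pred M (above \<sigma> t z)"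
  unfolding above_def[abs_def] by measurable

lemma above_cases:
  assumes \<omega>: "\<omega> \<in> space M" and "above \<sigma> t z \<omega>"
  shows "(\<exists>v. line_above \<sigma> Type1 t z v \<omega>) \<or> (\<exists>v k. type2_above \<sigma> t z v k \<omega>)"
proof -
  obtain u where u: "u \<in> alive t \<omega>" "z \<le> place \<sigma> t u \<omega>" using assms by (auto simp: above_def)
  show ?thesis
  proof (cases u)
    case (Type1 v)
    then have "line_above \<sigma> Type1 t z v \<omega>"
      using u by (simp add: alive_Type1 line_above_def place_def)
    then show ?thesis by blast
  next
    case (Type2 v k w)
    then have "line_above 1 (Type2 v k) (t - birth2_time v k \<omega>) (z - birth2_position \<sigma> v k \<omega>) w \<omega>"
      using u by (simp add: alive_Type2 line_above_def place_def algebra_simps)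
    moreover have "birth2_time v k \<omega> \<le> t"
      using alive_born[OF u(1)] elapsed_nonneg[OF \<omega>, of "Type2 v k" w] by (simp add: Type2)
    ultimately show ?thesis unfolding type2_above_def by blast
  qed
qed

text \<open>The type 1 tree is bounded with power 1, since \<open>\<kappa>\<close> exceeds its
  critical value; only the type 2 trees take the power \<open>p\<close>.\<close>

lemma prob_above_le:
  assumes b: "0 < \<beta>" "0 < \<alpha>" and p: "0 < p" "p \<le> 1" and "0 \<le> \<mu>"
    and \<kappa>1: "\<beta> + \<mu>\<^sup>2 * \<sigma>\<^sup>2 / 2 < \<kappa>" and \<kappa>2: "p + \<mu>\<^sup>2 / (2 * p) < \<kappa>"
  shows "\<exists>K. \<forall>t z. prob {\<omega> \<in> space M. above \<sigma> t z \<omega>} \<le> K * exp (\<kappa> * t - \<mu> * z)"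
proof -
  obtain K1 where K1: "0 \<le> K1" "\<And>\<nu> r z. inj \<nu> \<Longrightarrow> (\<And>w. branching_rate \<beta> (\<nu> w) = \<beta>) \<Longrightarrow>
    emeasure M {\<omega> \<in> space M. \<exists>w. line_above \<sigma> \<nu> r z w \<omega>} \<le> ennreal (K1 * exp (\<kappa> * r - \<mu> * z))"
    by (rule emeasure_tree_above_le[of \<beta> 1 \<mu> \<sigma> \<kappa>]) (use assms in auto)
  obtain K2 where K2: "0 \<le> K2" "\<And>t z. {\<omega> \<in> space M. \<exists>v k. type2_above \<sigma> t z v k \<omega>} \<in> sets M \<and>
    emeasure M {\<omega> \<in> space M. \<exists>v k. type2_above \<sigma> t z v k \<omega>} \<le> ennreal (K2 * exp (\<kappa> * t - \<mu> * z))"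
    using emeasure_type2_above_le[OF assms] by blast
  show ?thesis
  proof (intro exI[of _ "K1 + K2"] allI)
    fix t z
    let ?A = "{\<omega> \<in> space M. \<exists>w. line_above \<sigma> Type1 t z w \<omega>}"
    let ?B = "{\<omega> \<in> space M. \<exists>v k. type2_above \<sigma> t z v k \<omega>}"
    have A: "?A \<in> sets M" by measurable
    have "{\<omega> \<in> space M. above \<sigma> t z \<omega>} \<subseteq> ?A \<union> ?B"
      using above_cases by blast
    then have "prob {\<omega> \<in> space M. above \<sigma> t z \<omega>} \<le> prob (?A \<union> ?B)"
      using A K2(2) by (intro finite_measure_mono) auto
    also have "\<dots> \<le> prob ?A + prob ?B"
      using A K2(2) by (intro measure_Un_le) auto
    also have "prob ?A \<le> K1 * exp (\<kappa> * t - \<mu> * z)"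
      using K1(2)[of Type1 t z] K1(1) by (simp add: inj_def emeasure_eq_measure)
    also have "prob ?B \<le> K2 * exp (\<kappa> * t - \<mu> * z)"
      using K2(2)[of t z] K2(1) by (simp add: emeasure_eq_measure)
    finally show "prob {\<omega> \<in> space M. above \<sigma> t z \<omega>} \<le> (K1 + K2) * exp (\<kappa> * t - \<mu> * z)"
      by (simp add: algebra_simps)
  qed
qed

section \<open>Almost sure finiteness and measurability of the maximum\<close>

lemma AE_finite_elapsed:
  assumes "inj \<nu>" and rate: "\<And>w. branching_rate \<beta> (\<nu> w) = b" and b: "0 < b"
  shows "AE \<omega> in M. finite {w. elapsed \<nu> w \<omega> \<le> t}"
proof -
  have "AE \<omega> in M. finite {w. \<omega> \<in> {\<omega> \<in> space M. elapsed \<nu> w \<omega> \<le> t}}"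
  proof (rule AE_finite_words)
    fix w
    have "emeasure M {\<omega> \<in> space M. elapsed \<nu> w \<omega> \<le> t} =
        (\<integral>\<^sup>+\<omega>. indicator {\<omega> \<in> space M. elapsed \<nu> w \<omega> \<le> t} \<omega> \<partial>M)" by simp
    \<comment> \<open>Tilt and diffusivity 0 with \<open>\<kappa> = 2 * b\<close>: the ratio becomes
      1/3, below the 1/2 needed against the doubling of words.\<close>
    also have "\<dots> \<le> (\<integral>\<^sup>+\<omega>. ennreal (exp (2 * b * t)) * ennreal (exp (0 * travelled 0 \<nu> w \<omega> - 2 * b * elapsed \<nu> w \<omega>)) \<partial>M)"
      by (rule nn_integral_mono)
        (use b in \<open>auto simp: indicator_def ennreal_mult'[symmetric] mult_exp_exp\<close>)
    also have "\<dots> = ennreal (exp (2 * b * t)) * ennreal ((b / (b + 2 * b - 0\<^sup>2 * 0\<^sup>2 / 2)) ^ length w)"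
      using nn_integral_line_exp[of \<nu> b 0 0 "2 * b" w] assms by (simp add: nn_integral_cmult)
    also have "\<dots> = ennreal (exp (2 * b * t) * (1 / 3) ^ length w)"
      using b by (simp add: ennreal_mult'[symmetric])
    finally show "emeasure M {\<omega> \<in> space M. elapsed \<nu> w \<omega> \<le> t} \<le> ennreal (exp (2 * b * t) * (1 / 3) ^ length w)" .
  qed auto
  then show ?thesis by (rule AE_mp) (auto intro!: AE_I2)
qed

lemma AE_finite_child_time:
  assumes "0 < \<alpha>"
  shows "AE \<omega> in M. finite {k. child_time v k \<omega> \<le> t}"
proof -
  let ?A = "\<lambda>k. {\<omega> \<in> space M. child_time v k \<omega> \<le> t}"
  have le: "prob (?A k) \<le> exp (\<alpha> * t) * (1 / 2) ^ Suc k" for k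
  proof -
    have "emeasure M (?A k) = (\<integral>\<^sup>+\<omega>. indicator (?A k) \<omega> \<partial>M)" by simp
    also have "\<dots> \<le> (\<integral>\<^sup>+\<omega>. ennreal (exp (\<alpha> * t)) * ennreal (exp ((- \<alpha>) * child_time v k \<omega>)) \<partial>M)"
      by (rule nn_integral_mono)
        (use assms in \<open>auto simp: indicator_def ennreal_mult'[symmetric] mult_exp_exp\<close>)
    also have "\<dots> = ennreal (exp (\<alpha> * t)) * ennreal ((\<alpha> / (\<alpha> - (- \<alpha>))) ^ Suc k)"
      using nn_integral_child_time_exp[of "- \<alpha>" v k] assms by (simp add: nn_integral_cmult)
    also have "\<dots> = ennreal (exp (\<alpha> * t) * (1 / 2) ^ Suc k)"
      using assms by (simp add: ennreal_mult'[symmetric] del: power_Suc)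
    finally show ?thesis by (simp add: emeasure_eq_measure del: power_Suc)
  qed
  have "summable (\<lambda>k. measure M (?A k))"
  proof (rule summable_comparison_test')
    show "summable (\<lambda>k. exp (\<alpha> * t) * (1 / 2) ^ Suc k)"
      by (intro summable_mult summable_ignore_initial_segment[of "\<lambda>k. (1 / 2) ^ k" 1, simplified]
          summable_geometric) auto
  qed (use le in simp)
  then have "AE \<omega> in M. eventually (\<lambda>k. \<omega> \<in> space M - ?A k) sequentially"
    by (intro borel_cantelli_AE1) (auto simp: less_top[symmetric])
  then show ?thesis
  proof (rule AE_mp[OF _ AE_I2], intro impI)
    fix \<omega> assume "\<omega> \<in> space M" "eventually (\<lambda>k. \<omega> \<in> space M - ?A k) sequentially"
    then obtain N where "\<And>k. k \<ge> N \<Longrightarrow> \<not> child_time v k \<omega> \<le> t" by (auto simp: eventually_sequentially)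
    then have "{k. child_time v k \<omega> \<le> t} \<subseteq> {..<N}" by (auto simp: not_less[symmetric])
    then show "finite {k. child_time v k \<omega> \<le> t}" using finite_subset by blast
  qed
qed

lemma AE_alive_finite_nonempty:
  assumes "0 < \<beta>" "0 < \<alpha>" "0 \<le> t"
  shows "AE \<omega> in M. finite (alive t \<omega>) \<and> alive t \<omega> \<noteq> {}"
proof -
  have "AE \<omega> in M. finite {v. elapsed Type1 v \<omega> \<le> t}"
    by (rule AE_finite_elapsed[where b = \<beta>]) (auto simp: inj_def assms)
  moreover have "AE \<omega> in M. \<forall>v. finite {k. child_time v k \<omega> \<le> t}"
    using AE_finite_child_time[OF \<open>0 < \<alpha>\<close>] by (simp add: AE_all_countable)
  moreover have "AE \<omega> in M. \<forall>v k. finite {w. elapsed (Type2 v k) w \<omega> \<le> t}"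
    unfolding AE_all_countable
    by (intro allI AE_finite_elapsed[where b = 1]) (auto simp: inj_def)
  ultimately show ?thesis
    using AE_space
  proof eventually_elim
    case (elim \<omega>)
    let ?V = "{v. elapsed Type1 v \<omega> \<le> t}" and ?K = "\<lambda>v. {k. child_time v k \<omega> \<le> t}"
      and ?W = "\<lambda>v k. {w. elapsed (Type2 v k) w \<omega> \<le> t}"
    have "alive t \<omega> \<subseteq> Type1 ` ?V \<union> (\<Union>v\<in>?V. \<Union>k\<in>?K v. Type2 v k ` ?W v k)"
    proof
      fix u assume u: "u \<in> alive t \<omega>"
      then have le: "born u \<omega> \<le> t" by (rule alive_born)
      show "u \<in> Type1 ` ?V \<union> (\<Union>v\<in>?V. \<Union>k\<in>?K v. Type2 v k ` ?W v k)"
      proof (cases u)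
        case (Type1 v)
        then show ?thesis using le by simp
      next
        case (Type2 v k w)
        then have "elapsed Type1 v \<omega> \<le> t" "child_time v k \<omega> \<le> t" "elapsed (Type2 v k) w \<omega> \<le> t"
          using le elapsed_nonneg[OF elim(4), of Type1 v] elapsed_nonneg[OF elim(4), of "Type2 v k" w]
            child_time_pos[OF elim(4), of v k] by (auto simp: birth2_time_def)
        then show ?thesis using Type2 by auto
      qed
    qed
    moreover have "finite (Type1 ` ?V \<union> (\<Union>v\<in>?V. \<Union>k\<in>?K v. Type2 v k ` ?W v k))"
      using elim(1-3) by (intro finite_UnI finite_imageI finite_UN_I) auto
    ultimately have "finite (alive t \<omega>)" by (rule finite_subset)
    moreover have "alive t \<omega> \<noteq> {}"
    proof -
      \<comment> \<open>Along one infinite line the birth times pass \<open>t\<close>, as only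
        finitely many words are born by then; the particle just before the first one born after
        \<open>t\<close> is alive.\<close>
      let ?v = "\<lambda>n. replicate n False"
      have "\<exists>n. t < elapsed Type1 (?v n) \<omega>"
      proof (rule ccontr)
        assume "\<not> ?thesis"
        then have "range ?v \<subseteq> ?V" by (auto simp: not_less)
        moreover have "inj ?v" by (auto simp: inj_def)
        ultimately show False
          using elim(1) finite_subset range_inj_infinite by blast
      qed
      then obtain n where n: "t < elapsed Type1 (?v n) \<omega>" "\<And>m. m < n \<Longrightarrow> \<not> t < elapsed Type1 (?v m) \<omega>"
        using exists_least_iff[of "\<lambda>n. t < elapsed Type1 (?v n) \<omega>"] by blast
      with \<open>0 \<le> t\<close> obtain m where m: "n = Suc m" by (cases n) auto
      have "Type1 (?v m) \<in> alive t \<omega>"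
        using n(1) n(2)[of m] by (simp add: m alive_Type1)
      then show ?thesis by blast
    qed
    ultimately show ?case by blast
  qed
qed

text \<open>Finite sets of particles are coded by lists, of which there are countably many; this
  turns finiteness of the image into a countable combination of measurable events.\<close>

lemma pred_finite_positions: "Measurable.pred M (\<lambda>\<omega>. finite ((\<lambda>u. place \<sigma> t u \<omega>) ` alive t \<omega>))"
proof -
  have eq: "finite ((\<lambda>u. place \<sigma> t u \<omega>) ` alive t \<omega>) \<longleftrightarrow>
      (\<exists>us. (\<forall>u\<in>set us. u \<in> alive t \<omega>) \<and>
        (\<forall>u. u \<in> alive t \<omega> \<longrightarrow> (\<exists>u'\<in>set us. place \<sigma> t u \<omega> = place \<sigma> t u' \<omega>)))" for \<omega>
  proof
    assume "finite ((\<lambda>u. place \<sigma> t u \<omega>) ` alive t \<omega>)"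
    then obtain C where "C \<subseteq> alive t \<omega>" "finite C"
        "(\<lambda>u. place \<sigma> t u \<omega>) ` alive t \<omega> = (\<lambda>u. place \<sigma> t u \<omega>) ` C"
      by (rule finite_subset_image[OF _ order_refl, elim_format]) auto
    moreover obtain us where "set us = C" using finite_list[OF \<open>finite C\<close>] by blast
    ultimately show "\<exists>us. (\<forall>u\<in>set us. u \<in> alive t \<omega>) \<and>
        (\<forall>u. u \<in> alive t \<omega> \<longrightarrow> (\<exists>u'\<in>set us. place \<sigma> t u \<omega> = place \<sigma> t u' \<omega>))"
      by (intro exI[of _ us]) blast
  next
    assume "\<exists>us. (\<forall>u\<in>set us. u \<in> alive t \<omega>) \<and>
        (\<forall>u. u \<in> alive t \<omega> \<longrightarrow> (\<exists>u'\<in>set us. place \<sigma> t u \<omega> = place \<sigma> t u' \<omega>))"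
    then obtain us where "(\<lambda>u. place \<sigma> t u \<omega>) ` alive t \<omega> \<subseteq> (\<lambda>u. place \<sigma> t u \<omega>) ` set us"
      by (fastforce simp: image_subset_iff)
    then show "finite ((\<lambda>u. place \<sigma> t u \<omega>) ` alive t \<omega>)"
      using finite_subset by blast
  qed
  show ?thesis unfolding eq by measurable
qed

lemma maximum_eq:
  assumes "\<omega> \<in> space M"
  shows "maximum \<sigma> t \<omega> = Max ((\<lambda>u. place \<sigma> t u \<omega>) ` alive t \<omega>)"
proof -
  have "maximum \<sigma> t \<omega> = Max ((\<lambda>u. position \<sigma> t u \<omega>) ` alive t \<omega>)"
    by (simp add: maximum_def max_position_def position_def alive_def)
  also have "(\<lambda>u. position \<sigma> t u \<omega>) ` alive t \<omega> = (\<lambda>u. place \<sigma> t u \<omega>) ` alive t \<omega>"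
    using position_alive[OF assms] by (intro image_cong) auto
  finally show ?thesis .
qed

text \<open>As the underlying space need not be complete, measurability has to be checked on the null set
  where the set of positions is infinite or empty; there the maximum is an unspecified constant.\<close>

lemma pred_maximum_ge: "Measurable.pred M (\<lambda>\<omega>. z \<le> maximum \<sigma> t \<omega>)"
proof -
  note [measurable] = pred_finite_positions[of \<sigma> t]
  let ?P = "\<lambda>\<omega>. (\<lambda>u. place \<sigma> t u \<omega>) ` alive t \<omega>"
  have "z \<le> maximum \<sigma> t \<omega> \<longleftrightarrow> (if finite (?P \<omega>) \<and> (\<exists>u. u \<in> alive t \<omega>) then above \<sigma> t z \<omega>
      else z \<le> Max {})" if "\<omega> \<in> space M" for \<omega>
  proof (cases "finite (?P \<omega>) \<and> (\<exists>u. u \<in> alive t \<omega>)")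
    case True
    then show ?thesis
      by (simp add: maximum_eq[OF that] above_def) (subst Max_ge_iff, auto)
  next
    case False
    then have "Max (?P \<omega>) = Max {}"
      using Max_infinite[of "?P \<omega>"] by (cases "alive t \<omega> = {}") auto
    with False show ?thesis using maximum_eq[OF that] by auto
  qed
  then show ?thesis by (simp cong: measurable_cong)
qed

lemma prob_maximum_eq:
  assumes "0 < \<beta>" "0 < \<alpha>" "0 \<le> t"
  shows "\<P>(\<omega> in M. z \<le> maximum \<sigma> t \<omega>) = prob {\<omega> \<in> space M. above \<sigma> t z \<omega>}"
proof (rule finite_measure_eq_AE)
  show "AE \<omega> in M. (\<omega> \<in> {\<omega> \<in> space M. z \<le> maximum \<sigma> t \<omega>}) = (\<omega> \<in> {\<omega> \<in> space M. above \<sigma> t z \<omega>})"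
    using AE_alive_finite_nonempty[OF assms] AE_space
  proof eventually_elim
    case (elim \<omega>)
    then have "z \<le> maximum \<sigma> t \<omega> \<longleftrightarrow> above \<sigma> t z \<omega>"
      by (simp add: maximum_eq above_def) (subst Max_ge_iff, auto)
    with elim show ?case by simp
  qed
  show "{\<omega> \<in> space M. z \<le> maximum \<sigma> t \<omega>} \<in> sets M"
    using pred_maximum_ge by (simp add: pred_def)
qed measurable

end

section \<open>Survival of subcritical trees\<close>

text \<open>From \<open>(x - D)\<^sup>2 \<ge> 0\<close>, with \<open>x = 0\<close> treated apart.
  Integrated for a variable whose second moment is at most \<open>D\<close> times its mean, it
  bounds the probability of being positive below by the mean over \<open>D\<close>: the second
  moment method in pointwise form.\<close>

lemma two_mult_le_square_plus:
  fixes x :: ennreal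
  assumes "0 < D"
  shows "2 * x \<le> x\<^sup>2 * ennreal (1 / D) + ennreal D * indicator {0<..} x"
proof (cases x)
  case (real y)
  show ?thesis
  proof (cases "y = 0")
    case False
    with real have y: "0 < y" by simp
    have "2 * y \<le> y\<^sup>2 * (1 / D) + D"
    proof -
      have "0 \<le> (y - D)\<^sup>2 / D" using assms by simp
      also have "\<dots> = y\<^sup>2 * (1 / D) + D - 2 * y"
        using assms by (simp add: power2_diff field_simps power2_eq_square)
      finally show ?thesis by simp
    qed
    then have "ennreal (2 * y) \<le> ennreal (y\<^sup>2 * (1 / D) + D)" by (rule ennreal_leI)
    also have "\<dots> = ennreal (y\<^sup>2) * ennreal (1 / D) + ennreal D"
      using assms by (subst ennreal_plus) (simp_all add: ennreal_mult'[symmetric])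
    finally show ?thesis
      using y real by (simp add: ennreal_mult' ennreal_power)
  qed (use real in simp)
next
  case top
  then show ?thesis using assms by (simp add: ennreal_top_mult)
qed

text \<open>A tree of sites, grown level by level: \<open>C j\<close> labels the children \<open>ch j v c\<close> of a site \<open>v\<close> of
  level \<open>j\<close>, and the edge to such a child is open if \<open>ok j v c\<close> holds. An edge depends on the clocks
  \<open>E j v\<close> only and the subtree above \<open>v\<close> on the clocks \<open>D v\<close>. Only the lower bounds \<open>m j\<close> on the mean
  number of open edges matter.\<close>

locale random_tree = two_type_reducible_bbm_clocks M \<beta> \<alpha> T G B
  for M :: "'a measure" and \<beta> \<alpha> T G B +
  fixes N :: nat and S :: "nat \<Rightarrow> 's set" and C :: "nat \<Rightarrow> 'c set" and ch :: "nat \<Rightarrow> 's \<Rightarrow> 'c \<Rightarrow> 's"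
    and ok :: "nat \<Rightarrow> 's \<Rightarrow> 'c \<Rightarrow> 'a \<Rightarrow> bool" and E :: "nat \<Rightarrow> 's \<Rightarrow> clock set"
    and D :: "'s \<Rightarrow> clock set" and m :: "nat \<Rightarrow> real" and k q0 q :: real
  assumes finite_letters: "finite (C j)" and card_letters: "real (card (C j)) \<le> k"
    and child_site: "j < N \<Longrightarrow> v \<in> S j \<Longrightarrow> c \<in> C j \<Longrightarrow> ch j v c \<in> S (Suc j)"
    and edge_pred: "j < N \<Longrightarrow> v \<in> S j \<Longrightarrow> c \<in> C j \<Longrightarrow>
      Measurable.pred (clocks_algebra (E j v)) (ok j v c)"
    and edge_clocks: "j < N \<Longrightarrow> v \<in> S j \<Longrightarrow> E j v \<subseteq> D v"
    and child_clocks: "j < N \<Longrightarrow> v \<in> S j \<Longrightarrow> c \<in> C j \<Longrightarrow> D (ch j v c) \<subseteq> D v"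
    and child_disjoint: "j < N \<Longrightarrow> v \<in> S j \<Longrightarrow> c \<in> C j \<Longrightarrow> E j v \<inter> D (ch j v c) = {}"
    and children_disjoint: "j < N \<Longrightarrow> v \<in> S j \<Longrightarrow> c \<in> C j \<Longrightarrow> c' \<in> C j \<Longrightarrow> c \<noteq> c' \<Longrightarrow>
      D (ch j v c) \<inter> D (ch j v c') = {}"
    and mean_ge: "j < N \<Longrightarrow> v \<in> S j \<Longrightarrow> m j \<le> (\<Sum>c\<in>C j. prob {\<omega> \<in> space M. ok j v c \<omega>})"
    and m_bounds: "j < N \<Longrightarrow> q0 \<le> m j" "j < N \<Longrightarrow> m j \<le> q" and q_bounds: "0 < q0" "q < 1"
begin

definition mean :: "nat \<Rightarrow> 's \<Rightarrow> real" where
  "mean j v = (\<Sum>c\<in>C j. prob {\<omega> \<in> space M. ok j v c \<omega>})"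

text \<open>The weights \<open>m j / mean j v \<le> 1\<close> make the mean number of paths depend on the levels only.\<close>

primrec weighted_paths :: "nat \<Rightarrow> nat \<Rightarrow> 's \<Rightarrow> 'a \<Rightarrow> ennreal" where
  "weighted_paths 0 j v \<omega> = 1"
| "weighted_paths (Suc n) j v \<omega> = ennreal (m j / mean j v) *
     (\<Sum>c\<in>C j. indicator {\<omega>. ok j v c \<omega>} \<omega> * weighted_paths n (Suc j) (ch j v c) \<omega>)"

primrec reach :: "nat \<Rightarrow> nat \<Rightarrow> 's \<Rightarrow> 's \<Rightarrow> 'a \<Rightarrow> bool" where
  "reach 0 j v u \<omega> \<longleftrightarrow> u = v"
| "reach (Suc n) j v u \<omega> \<longleftrightarrow> (\<exists>c\<in>C j. ok j v c \<omega> \<and> reach n (Suc j) (ch j v c) u \<omega>)"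

lemma weighted_paths_pos: "0 < weighted_paths n j v \<omega> \<Longrightarrow> \<exists>u. reach n j v u \<omega>"
proof (induction n arbitrary: j v)
  case (Suc n)
  then have "(\<Sum>c\<in>C j. indicator {\<omega>. ok j v c \<omega>} \<omega> * weighted_paths n (Suc j) (ch j v c) \<omega>) \<noteq> 0"
    by (auto simp: zero_less_iff_neq_zero)
  then obtain c where "c \<in> C j" "indicator {\<omega>. ok j v c \<omega>} \<omega> * weighted_paths n (Suc j) (ch j v c) \<omega> \<noteq> 0"
    by (rule sum.not_neutral_contains_not_neutral)
  then have "ok j v c \<omega>" "0 < weighted_paths n (Suc j) (ch j v c) \<omega>"
    by (auto simp: indicator_def zero_less_iff_neq_zero split: if_splits)
  moreover from this(2) obtain u where "reach n (Suc j) (ch j v c) u \<omega>"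
    using Suc.IH by blast
  ultimately show ?case using \<open>c \<in> C j\<close> by auto
qed simp

lemma reach_site: "j + n \<le> N \<Longrightarrow> v \<in> S j \<Longrightarrow> reach n j v u \<omega> \<Longrightarrow> u \<in> S (j + n)"
proof (induction n arbitrary: j v)
  case (Suc n)
  then obtain c where "c \<in> C j" "reach n (Suc j) (ch j v c) u \<omega>" by auto
  then show ?case
    using Suc.IH[of "Suc j" "ch j v c"] child_site[of j v c] Suc.prems by auto
qed simp

lemma measurable_weighted_paths:
  "j + n \<le> N \<Longrightarrow> v \<in> S j \<Longrightarrow> weighted_paths n j v \<in> borel_measurable (clocks_algebra (D v))"
proof (induction n arbitrary: j v)
  case (Suc n)
  then have j: "j < N" by simp
  note v = \<open>v \<in> S j\<close>
  have [measurable]: "weighted_paths n (Suc j) (ch j v c) \<in> borel_measurable (clocks_algebra (D v))"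
    if c: "c \<in> C j" for c
    using Suc.IH[of "Suc j" "ch j v c"] Suc.prems child_site[OF j v c]
    by (intro measurable_clocks_algebra_mono[OF _ child_clocks[OF j v c]]) simp
  have [measurable]: "Measurable.pred (clocks_algebra (D v)) (ok j v c)" if c: "c \<in> C j" for c
    using measurable_clocks_algebra_mono[OF edge_pred[OF j v c] edge_clocks[OF j v]] .
  have "(\<lambda>\<omega>. ennreal (m j / mean j v) *
     (\<Sum>c\<in>C j. indicator {\<omega>. ok j v c \<omega>} \<omega> * weighted_paths n (Suc j) (ch j v c) \<omega>))
     \<in> borel_measurable (clocks_algebra (D v))"
    by measurable
  then show ?case by (simp cong: measurable_cong)
qed (simp cong: measurable_cong)

lemma m_pos: "j < N \<Longrightarrow> 0 < m j"
  using m_bounds(1) q_bounds(1) by force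

lemma weight_bounds:
  assumes "j < N" "v \<in> S j"
  shows "0 < mean j v" "0 \<le> m j / mean j v" "m j / mean j v \<le> 1"
  using mean_ge[OF assms] m_pos[OF assms(1)] by (auto simp: mean_def[symmetric])

lemma edge_sets: "j < N \<Longrightarrow> v \<in> S j \<Longrightarrow> c \<in> C j \<Longrightarrow> {\<omega> \<in> space M. ok j v c \<omega>} \<in> sets M"
  using measurable_from_clocks_algebra[OF edge_pred] by (simp add: pred_def)

lemma nn_integral_edge:
  "j < N \<Longrightarrow> v \<in> S j \<Longrightarrow> c \<in> C j \<Longrightarrow>
    (\<integral>\<^sup>+\<omega>. indicator {\<omega>. ok j v c \<omega>} \<omega> \<partial>M) = ennreal (prob {\<omega> \<in> space M. ok j v c \<omega>})"
  unfolding emeasure_eq_measure[symmetric] nn_integral_indicator[OF edge_sets, symmetric]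
  by (rule nn_integral_cong) (simp add: indicator_def)

text \<open>An edge and the subtree above it use disjoint clocks, and the weight cancels
  \<open>mean j v\<close>. Equality matters: the mean is a lower bound in the survival estimate and
  an upper bound in the mixed terms of the second moment.\<close>

lemma first_moment:
  "j + n \<le> N \<Longrightarrow> v \<in> S j \<Longrightarrow>
    (\<integral>\<^sup>+\<omega>. weighted_paths n j v \<omega> \<partial>M) = ennreal (\<Prod>i\<in>{j..<j + n}. m i)"
proof (induction n arbitrary: j v)
  case 0
  then show ?case by (simp add: emeasure_space_1)
next
  case (Suc n)
  then have j: "j < N" by simp
  note v = \<open>v \<in> S j\<close>
  let ?P = "\<Prod>i\<in>{Suc j..<Suc j + n}. m i"
  have P: "0 \<le> ?P" using Suc.prems by (intro prod_nonneg) (auto intro!: less_imp_le[OF m_pos])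
  have mM: "weighted_paths n (Suc j) (ch j v c) \<in> borel_measurable (clocks_algebra (D (ch j v c)))"
    if c: "c \<in> C j" for c
    using measurable_weighted_paths[of "Suc j" n "ch j v c"] Suc.prems child_site[OF j v c] by simp
  note edge [measurable] = edge_pred[OF j v]
  have one: "(\<integral>\<^sup>+\<omega>. indicator {\<omega>. ok j v c \<omega>} \<omega> * weighted_paths n (Suc j) (ch j v c) \<omega> \<partial>M) =
      ennreal (prob {\<omega> \<in> space M. ok j v c \<omega>}) * ennreal ?P" if c: "c \<in> C j" for c
    using Suc.IH[of "Suc j" "ch j v c"] Suc.prems child_site[OF j v c]
    by (subst nn_integral_decouple_mult[OF child_disjoint[OF j v c] _ mM[OF c]])
      (use c nn_integral_edge[OF j v c] in auto)
  have meas: "(\<lambda>\<omega>. indicator {\<omega>. ok j v c \<omega>} \<omega> * weighted_paths n (Suc j) (ch j v c) \<omega>) \<in> borel_measurable M"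
    if c: "c \<in> C j" for c
  proof -
    have [measurable]: "weighted_paths n (Suc j) (ch j v c) \<in> borel_measurable M"
      by (rule measurable_from_clocks_algebra[OF mM[OF c]])
    have [measurable]: "Measurable.pred M (ok j v c)"
      by (rule measurable_from_clocks_algebra[OF edge[OF c]])
    show ?thesis by measurable
  qed
  have "(\<integral>\<^sup>+\<omega>. weighted_paths (Suc n) j v \<omega> \<partial>M) = ennreal (m j / mean j v) *
      (\<Sum>c\<in>C j. ennreal (prob {\<omega> \<in> space M. ok j v c \<omega>}) * ennreal ?P)"
    using meas one by (simp add: nn_integral_cmult nn_integral_sum)
  also have "\<dots> = ennreal (m j / mean j v) * (ennreal (mean j v) * ennreal ?P)"
    by (simp add: sum_distrib_right[symmetric] mean_def sum_ennreal)
  also have "\<dots> = ennreal (m j * ?P)"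
    using weight_bounds[OF j v] P by (simp add: ennreal_mult'[symmetric])
  also have "m j * ?P = (\<Prod>i\<in>{j..<j + Suc n}. m i)"
    by (simp add: prod.atLeast_Suc_lessThan)
  finally show ?case .
qed

definition moment_const :: "nat \<Rightarrow> real" where
  "moment_const n = 1 + k\<^sup>2 / q0 * (\<Sum>i<n. q ^ i)"

text \<open>Pairs of paths are sorted by their first edges. Equal edges reproduce the second moment
  one level further on; different edges give at most \<open>P\<^sup>2\<close>, where
  \<open>P \<le> q ^ n\<close>. As \<open>q < 1\<close>, the excess over the mean sums to a
  convergent geometric series, so the second moment stays comparable to the mean.\<close>

lemma second_moment:
  "j + n \<le> N \<Longrightarrow> v \<in> S j \<Longrightarrow>
    (\<integral>\<^sup>+\<omega>. (weighted_paths n j v \<omega>)\<^sup>2 \<partial>M) \<le> ennreal (moment_const n * (\<Prod>i\<in>{j..<j + n}. m i))"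
proof (induction n arbitrary: j v)
  case 0
  then show ?case by (simp add: emeasure_space_1 moment_const_def)
next
  case (Suc n)
  then have j: "j < N" and jn: "Suc j + n \<le> N" by simp_all
  note v = \<open>v \<in> S j\<close>
  define P where "P = (\<Prod>i\<in>{Suc j..<Suc j + n}. m i)"
  let ?r = "m j / mean j v"
  let ?p = "\<lambda>c. prob {\<omega> \<in> space M. ok j v c \<omega>}"
  let ?Z = "\<lambda>c. weighted_paths n (Suc j) (ch j v c)"
  let ?I = "\<lambda>c \<omega>. indicator {\<omega>. ok j v c \<omega>} \<omega> :: ennreal"
  have P: "0 \<le> P" unfolding P_def using Suc.prems by (intro prod_nonneg) (auto intro!: less_imp_le[OF m_pos])
  have q: "0 \<le> q" using m_bounds[OF j] q_bounds by linarith
  have D: "0 \<le> moment_const n"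
    unfolding moment_const_def using q q_bounds
    by (intro add_nonneg_nonneg mult_nonneg_nonneg sum_nonneg divide_nonneg_nonneg) auto
  have P': "P \<le> q ^ n"
  proof -
    have "P \<le> (\<Prod>i\<in>{Suc j..<Suc j + n}. q)"
      unfolding P_def using jn by (intro prod_mono) (auto intro!: less_imp_le[OF m_pos] m_bounds)
    then show ?thesis by simp
  qed
  have ch: "ch j v c \<in> S (Suc j)" if "c \<in> C j" for c
    by (rule child_site[OF j v that])
  have mZ: "?Z c \<in> borel_measurable (clocks_algebra (D (ch j v c)))" if c: "c \<in> C j" for c
    using measurable_weighted_paths[OF jn ch[OF c]] .
  have mI: "?I c \<in> borel_measurable (clocks_algebra (E j v))" if c: "c \<in> C j" for c
  proof -
    note [measurable] = edge_pred[OF j v c]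
    show ?thesis by measurable
  qed
  have pair: "(\<integral>\<^sup>+\<omega>. (?I c \<omega> * ?Z c \<omega>) * (?I c' \<omega> * ?Z c' \<omega>) \<partial>M) \<le>
      (if c = c' then ennreal (?p c) * ennreal (moment_const n * P) else 0) + ennreal (P\<^sup>2)"
    if c: "c \<in> C j" "c' \<in> C j" for c c'
  proof (cases "c = c'")
    case True
    have "(\<integral>\<^sup>+\<omega>. (?I c \<omega> * ?Z c \<omega>) * (?I c \<omega> * ?Z c \<omega>) \<partial>M) = (\<integral>\<^sup>+\<omega>. ?I c \<omega> * (?Z c \<omega>)\<^sup>2 \<partial>M)"
      by (rule nn_integral_cong) (simp add: indicator_def power2_eq_square)
    also have "\<dots> = (\<integral>\<^sup>+\<omega>. ?I c \<omega> \<partial>M) * (\<integral>\<^sup>+\<omega>. (?Z c \<omega>)\<^sup>2 \<partial>M)"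
      using mZ[OF c(1)] by (intro nn_integral_decouple_mult[OF child_disjoint[OF j v c(1)] mI[OF c(1)]]) measurable
    also have "\<dots> \<le> ennreal (?p c) * ennreal (moment_const n * P)"
      using Suc.IH[OF jn ch[OF c(1)], folded P_def] nn_integral_edge[OF j v c(1)] by (simp add: mult_left_mono)
    finally show ?thesis using True by (simp add: add_increasing2)
  next
    case False
    let ?D = "D (ch j v c) \<union> D (ch j v c')"
    have mD: "?Z c \<in> borel_measurable (clocks_algebra ?D)" "?Z c' \<in> borel_measurable (clocks_algebra ?D)"
      by (auto intro: measurable_clocks_algebra_mono mZ c)
    have disj: "E j v \<inter> ?D = {}"
      using child_disjoint[OF j v c(1)] child_disjoint[OF j v c(2)] by blast
    have "(\<integral>\<^sup>+\<omega>. (?I c \<omega> * ?Z c \<omega>) * (?I c' \<omega> * ?Z c' \<omega>) \<partial>M) =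
        (\<integral>\<^sup>+\<omega>. (?I c \<omega> * ?I c' \<omega>) * (?Z c \<omega> * ?Z c' \<omega>) \<partial>M)" by (simp add: ac_simps)
    also have "\<dots> = (\<integral>\<^sup>+\<omega>. ?I c \<omega> * ?I c' \<omega> \<partial>M) * (\<integral>\<^sup>+\<omega>. ?Z c \<omega> * ?Z c' \<omega> \<partial>M)"
      by (rule nn_integral_decouple_mult[OF disj borel_measurable_times_ennreal[OF mI[OF c(1)] mI[OF c(2)]]
            borel_measurable_times_ennreal[OF mD]])
    also have "(\<integral>\<^sup>+\<omega>. ?Z c \<omega> * ?Z c' \<omega> \<partial>M) = (\<integral>\<^sup>+\<omega>. ?Z c \<omega> \<partial>M) * (\<integral>\<^sup>+\<omega>. ?Z c' \<omega> \<partial>M)"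
      by (rule nn_integral_decouple_mult[OF children_disjoint[OF j v c False] mZ[OF c(1)] mZ[OF c(2)]])
    also have "\<dots> = ennreal (P\<^sup>2)"
      using first_moment[OF jn ch[OF c(1)], folded P_def] first_moment[OF jn ch[OF c(2)], folded P_def] P
      by (simp add: ennreal_mult'[symmetric] power2_eq_square)
    \<comment> \<open>Edges at one site share clocks, so their joint probability is only bounded by
      1.\<close>
    also have "(\<integral>\<^sup>+\<omega>. ?I c \<omega> * ?I c' \<omega> \<partial>M) \<le> (\<integral>\<^sup>+\<omega>. 1 \<partial>M)"
      by (rule nn_integral_mono) (simp add: indicator_def)
    also have "(\<integral>\<^sup>+\<omega>. 1 \<partial>M) = 1" by (simp add: emeasure_space_1)
    finally have "(\<integral>\<^sup>+\<omega>. (?I c \<omega> * ?Z c \<omega>) * (?I c' \<omega> * ?Z c' \<omega>) \<partial>M) \<le> ennreal (P\<^sup>2)"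
      by (simp add: mult_right_mono)
    then show ?thesis using False by simp
  qed
  have mM: "(\<lambda>\<omega>. ?I c \<omega> * ?Z c \<omega>) \<in> borel_measurable M" if c: "c \<in> C j" for c
    by (intro borel_measurable_times_ennreal measurable_from_clocks_algebra[OF mZ[OF c]]
        measurable_from_clocks_algebra[OF mI[OF c]])
  define a where "a c = ennreal (?p c) * ennreal (moment_const n * P)" for c
  define N2 where "N2 = (real (card (C j)))\<^sup>2"
  have "(\<Sum>c'\<in>C j. (if c = c' then a c else 0) + ennreal (P\<^sup>2)) =
      a c + of_nat (card (C j)) * ennreal (P\<^sup>2)" if "c \<in> C j" for c
    using that finite_letters[of j] by (simp add: sum.distrib)
  then have "(\<Sum>c\<in>C j. \<Sum>c'\<in>C j. (if c = c' then a c else 0) + ennreal (P\<^sup>2)) =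
      (\<Sum>c\<in>C j. a c + of_nat (card (C j)) * ennreal (P\<^sup>2))"
    by (intro sum.cong refl)
  also have "\<dots> = (\<Sum>c\<in>C j. a c) + of_nat (card (C j)) * (of_nat (card (C j)) * ennreal (P\<^sup>2))"
    by (simp only: sum.distrib sum_constant)
  also have "of_nat (card (C j)) * (of_nat (card (C j)) * ennreal (P\<^sup>2)) = ennreal (N2 * P\<^sup>2)"
    by (simp add: N2_def ennreal_of_nat_eq_real_of_nat ennreal_mult'[symmetric] power2_eq_square ac_simps)
  also have "(\<Sum>c\<in>C j. a c) = ennreal (mean j v * (moment_const n * P))"
  proof -
    have "(\<Sum>c\<in>C j. a c) = (\<Sum>c\<in>C j. ennreal (?p c)) * ennreal (moment_const n * P)"
      unfolding a_def by (rule sum_distrib_right[symmetric])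
    also have "(\<Sum>c\<in>C j. ennreal (?p c)) = ennreal (mean j v)"
      unfolding mean_def by (rule sum_ennreal) simp
    finally show ?thesis
      using weight_bounds(1)[OF j v] by (simp add: ennreal_mult'[symmetric])
  qed
  also have "ennreal (mean j v * (moment_const n * P)) + ennreal (N2 * P\<^sup>2) =
      ennreal (mean j v * (moment_const n * P) + N2 * P\<^sup>2)"
    using weight_bounds(1)[OF j v] D P by (intro ennreal_plus[symmetric]) (auto simp: N2_def)
  finally have sum: "(\<Sum>c\<in>C j. \<Sum>c'\<in>C j. (if c = c' then a c else 0) + ennreal (P\<^sup>2)) =
      ennreal (mean j v * (moment_const n * P) + N2 * P\<^sup>2)" .
  have sq: "(weighted_paths (Suc n) j v \<omega>)\<^sup>2 =
      ennreal (?r\<^sup>2) * (\<Sum>c\<in>C j. \<Sum>c'\<in>C j. (?I c \<omega> * ?Z c \<omega>) * (?I c' \<omega> * ?Z c' \<omega>))" for \<omega>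
    unfolding weighted_paths.simps(2) power_mult_distrib power2_eq_square[of "sum _ _"] sum_product
    using weight_bounds(2)[OF j v] by (simp only: ennreal_power)
  let ?Q = "\<integral>\<^sup>+\<omega>. (\<Sum>c\<in>C j. \<Sum>c'\<in>C j. (?I c \<omega> * ?Z c \<omega>) * (?I c' \<omega> * ?Z c' \<omega>)) \<partial>M"
  have "?Q = (\<Sum>c\<in>C j. \<integral>\<^sup>+\<omega>. (\<Sum>c'\<in>C j. (?I c \<omega> * ?Z c \<omega>) * (?I c' \<omega> * ?Z c' \<omega>)) \<partial>M)"
    by (intro nn_integral_sum borel_measurable_sum borel_measurable_times_ennreal mM)
  also have "\<dots> = (\<Sum>c\<in>C j. \<Sum>c'\<in>C j. \<integral>\<^sup>+\<omega>. (?I c \<omega> * ?Z c \<omega>) * (?I c' \<omega> * ?Z c' \<omega>) \<partial>M)"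
    by (intro sum.cong refl nn_integral_sum borel_measurable_times_ennreal mM)
  also have "\<dots> \<le> (\<Sum>c\<in>C j. \<Sum>c'\<in>C j. (if c = c' then a c else 0) + ennreal (P\<^sup>2))"
    unfolding a_def by (intro sum_mono pair)
  finally have Q: "?Q \<le> ennreal (mean j v * (moment_const n * P) + N2 * P\<^sup>2)"
    unfolding sum .
  have "(\<integral>\<^sup>+\<omega>. (weighted_paths (Suc n) j v \<omega>)\<^sup>2 \<partial>M) = ennreal (?r\<^sup>2) * ?Q"
    unfolding sq by (intro nn_integral_cmult borel_measurable_sum borel_measurable_times_ennreal mM)
  also have "\<dots> \<le> ennreal (?r\<^sup>2) * ennreal (mean j v * (moment_const n * P) + N2 * P\<^sup>2)"
    using Q by (rule mult_left_mono) simp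
  also have "ennreal (?r\<^sup>2) * ennreal (mean j v * (moment_const n * P) + N2 * P\<^sup>2) =
      ennreal (?r\<^sup>2 * (mean j v * (moment_const n * P) + N2 * P\<^sup>2))"
    by (rule ennreal_mult'[symmetric]) simp
  also have "\<dots> \<le> ennreal (moment_const (Suc n) * (m j * P))"
  proof (rule ennreal_leI)
    have r: "?r\<^sup>2 \<le> ?r" "?r\<^sup>2 \<le> 1" "0 \<le> ?r\<^sup>2"
      using weight_bounds(2,3)[OF j v] power_decreasing[of 1 2 ?r] power_le_one[of ?r 2] by auto
    have "?r\<^sup>2 * (mean j v * (moment_const n * P)) \<le> ?r * (mean j v * (moment_const n * P))"
      by (rule mult_right_mono[OF r(1)]) (intro mult_nonneg_nonneg D P less_imp_le[OF weight_bounds(1)[OF j v]])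
    also have "\<dots> = moment_const n * (m j * P)"
      using weight_bounds(1)[OF j v] by simp
    finally have 1: "?r\<^sup>2 * (mean j v * (moment_const n * P)) \<le> moment_const n * (m j * P)" .
    have "N2 \<le> k\<^sup>2" unfolding N2_def using card_letters[of j] by (intro power_mono) auto
    then have "?r\<^sup>2 * (N2 * P\<^sup>2) \<le> 1 * (k\<^sup>2 * P\<^sup>2)"
      by (intro mult_mono[OF r(2)] mult_right_mono zero_le_power2 mult_nonneg_nonneg)
        (simp_all add: N2_def)
    also have "\<dots> = k\<^sup>2 * (P * P)" by (simp add: power2_eq_square)
    \<comment> \<open>One of the two factors \<open>P\<close> is spent on \<open>q ^ n\<close>; the
      factor \<open>m j\<close> that the claim demands is supplied by
      \<open>1 \<le> m j / q0\<close>.\<close>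
    also have "\<dots> \<le> k\<^sup>2 * ((m j / q0 * q ^ n) * P)"
    proof -
      have "1 \<le> m j / q0" using m_bounds(1)[OF j] q_bounds(1) by simp
      then have "1 * P \<le> m j / q0 * q ^ n"
        by (rule mult_mono[OF _ P' _ P]) (use m_pos[OF j] q_bounds(1) in simp)
      then have "P * P \<le> (m j / q0 * q ^ n) * P"
        using P by (simp only: mult_1 mult_right_mono)
      then show ?thesis by (rule mult_left_mono) simp
    qed
    also have "\<dots> = k\<^sup>2 / q0 * q ^ n * (m j * P)" by (simp only: times_divide_eq_left times_divide_eq_right ac_simps)
    finally have 2: "?r\<^sup>2 * (N2 * P\<^sup>2) \<le> k\<^sup>2 / q0 * q ^ n * (m j * P)" .
    have mc: "moment_const (Suc n) = moment_const n + k\<^sup>2 / q0 * q ^ n"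
      by (simp add: moment_const_def distrib_left)
    show "?r\<^sup>2 * (mean j v * (moment_const n * P) + N2 * P\<^sup>2) \<le>
        moment_const (Suc n) * (m j * P)"
      unfolding mc distrib_left distrib_right using 1 2 by (rule add_mono)
  qed
  also have "m j * P = (\<Prod>i\<in>{j..<j + Suc n}. m i)"
    by (simp add: prod.atLeast_Suc_lessThan P_def)
  finally show ?case .
qed

lemma pred_reach:
  assumes I: "\<And>j v. j < N \<Longrightarrow> v \<in> S j \<Longrightarrow> E j v \<subseteq> I"
  shows "j + n \<le> N \<Longrightarrow> v \<in> S j \<Longrightarrow> Measurable.pred (clocks_algebra I) (reach n j v u)"
proof (induction n arbitrary: j v)
  case (Suc n)
  then have j: "j < N" by simp
  note v = \<open>v \<in> S j\<close>
  have [measurable]: "Measurable.pred (clocks_algebra I) (ok j v c)"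
      "Measurable.pred (clocks_algebra I) (reach n (Suc j) (ch j v c) u)"
    if c: "c \<in> C j" for c
    using measurable_clocks_algebra_mono[OF edge_pred[OF j v c] I[OF j v]]
      Suc.IH[OF _ child_site[OF j v c]] Suc.prems by auto
  have "Measurable.pred (clocks_algebra I) (\<lambda>\<omega>. \<exists>c\<in>C j. ok j v c \<omega> \<and> reach n (Suc j) (ch j v c) u \<omega>)"
    by (rule pred_intros_finite(4)[OF finite_letters]) measurable
  then show ?case by (simp cong: measurable_cong)
qed (simp cong: measurable_cong)

text \<open>The geometric series bounds \<open>moment_const\<close> uniformly in the number of
  levels, so on the exponential scale only the product of the means counts.\<close>

lemma prob_reach_ge:
  assumes v: "v \<in> S 0" and A: "{\<omega> \<in> space M. \<exists>u. reach N 0 v u \<omega>} \<in> sets M"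
  shows "(\<Prod>i<N. m i) / (1 + k\<^sup>2 / (q0 * (1 - q))) \<le> prob {\<omega> \<in> space M. \<exists>u. reach N 0 v u \<omega>}"
proof -
  let ?Z = "weighted_paths N 0 v" and ?P = "\<Prod>i<N. m i"
  let ?A = "{\<omega> \<in> space M. \<exists>u. reach N 0 v u \<omega>}"
  define D' where "D' = 1 + k\<^sup>2 / (q0 * (1 - q))"
  have P: "0 \<le> ?P" by (intro prod_nonneg) (auto intro!: less_imp_le[OF m_pos])
  have D: "1 \<le> D'" using q_bounds by (simp add: D'_def)
  have DN: "moment_const N \<le> D'"
  proof (cases "N = 0")
    case False
    then have q: "0 \<le> q" using m_bounds[of 0] q_bounds by simp
    have "(\<Sum>i<N. q ^ i) = (1 - q ^ N) / (1 - q)"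
      using q_bounds by (subst sum_gp_strict) auto
    also have "\<dots> \<le> 1 / (1 - q)" using q q_bounds by (intro divide_right_mono) auto
    finally have "k\<^sup>2 / q0 * (\<Sum>i<N. q ^ i) \<le> k\<^sup>2 / q0 * (1 / (1 - q))"
      using q_bounds by (intro mult_left_mono) auto
    then show ?thesis by (simp add: moment_const_def D'_def)
  qed (use D in \<open>simp add: moment_const_def\<close>)
  have mZ: "?Z \<in> borel_measurable M"
    using measurable_from_clocks_algebra[OF measurable_weighted_paths[of 0 N v]] v by simp
  note [measurable] = mZ A
  have "2 * ennreal ?P = (\<integral>\<^sup>+\<omega>. 2 * ?Z \<omega> \<partial>M)"
    using first_moment[of 0 N v] v by (simp add: nn_integral_cmult atLeast0LessThan)
  also have "\<dots> \<le> (\<integral>\<^sup>+\<omega>. (?Z \<omega>)\<^sup>2 * ennreal (1 / D') + ennreal D' * indicator ?A \<omega> \<partial>M)"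
  proof (rule nn_integral_mono)
    fix \<omega> assume "\<omega> \<in> space M"
    then have "indicator {0<..} (?Z \<omega>) \<le> (indicator ?A \<omega> :: ennreal)"
      using weighted_paths_pos[of N 0 v \<omega>] by (auto simp: indicator_def)
    then have "(?Z \<omega>)\<^sup>2 * ennreal (1 / D') + ennreal D' * indicator {0<..} (?Z \<omega>) \<le>
        (?Z \<omega>)\<^sup>2 * ennreal (1 / D') + ennreal D' * indicator ?A \<omega>"
      by (intro add_left_mono mult_left_mono) auto
    then show "2 * ?Z \<omega> \<le> (?Z \<omega>)\<^sup>2 * ennreal (1 / D') + ennreal D' * indicator ?A \<omega>"
      using D by (intro order_trans[OF two_mult_le_square_plus[of D' "?Z \<omega>"]]) (rule less_le_trans[OF zero_less_one])
  qed
  also have "\<dots> = (\<integral>\<^sup>+\<omega>. (?Z \<omega>)\<^sup>2 \<partial>M) * ennreal (1 / D') + ennreal D' * emeasure M ?A"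
    by (subst nn_integral_add) (auto simp: nn_integral_multc nn_integral_cmult_indicator)
  also have "\<dots> \<le> ennreal (D' * ?P) * ennreal (1 / D') + ennreal D' * emeasure M ?A"
  proof (intro add_right_mono mult_right_mono)
    have "(\<integral>\<^sup>+\<omega>. (?Z \<omega>)\<^sup>2 \<partial>M) \<le> ennreal (moment_const N * ?P)"
      using second_moment[of 0 N v] v by (simp add: atLeast0LessThan)
    also have "\<dots> \<le> ennreal (D' * ?P)"
      using DN P by (intro ennreal_leI mult_right_mono)
    finally show "(\<integral>\<^sup>+\<omega>. (?Z \<omega>)\<^sup>2 \<partial>M) \<le> ennreal (D' * ?P)" .
  qed simp
  also have "\<dots> = ennreal (?P + D' * prob ?A)"
  proof -
    have "ennreal (D' * ?P) * ennreal (1 / D') = ennreal ?P"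
      using D P by (simp add: ennreal_mult'[symmetric])
    moreover have "ennreal D' * emeasure M ?A = ennreal (D' * prob ?A)"
      using D by (simp add: emeasure_eq_measure ennreal_mult'[symmetric])
    ultimately show ?thesis
      using D P by (simp only:) (subst ennreal_plus, simp_all)
  qed
  finally have "ennreal (2 * ?P) \<le> ennreal (?P + D' * prob ?A)" using P by (simp add: ennreal_mult')
  then have "2 * ?P \<le> ?P + D' * prob ?A" using P D by (subst (asm) ennreal_le_iff) auto
  then have "?P \<le> D' * prob ?A" by simp
  then show ?thesis using D by (simp add: pos_divide_le_eq ac_simps flip: D'_def)
qed

end

section \<open>Construction of a particle above a given level\<close>

lemma suffix_append_same_length:
  "suffix (c @ v) x \<Longrightarrow> suffix (c' @ v) x \<Longrightarrow> length c = length c' \<Longrightarrow> c = c'"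
  by (auto simp: suffix_def)

lemma prod_three_phases:
  "(\<Prod>i<n1 + 1 + n2. if i < n1 then a else if i = n1 then b else c) = a ^ n1 * b * (c :: real) ^ n2"
proof (induction n2)
  case 0
  have "(\<Prod>i<n1. if i < n1 then a else if i = n1 then b else c) = (\<Prod>i<n1. a)"
    by (rule prod.cong) auto
  then show ?case by simp
qed simp

lemma sum_three_phases:
  "(\<Sum>i<n1 + 1 + n2. if i < n1 then a else if i = n1 then b else c) = real n1 * a + b + real n2 * c"
proof (induction n2)
  case 0
  have "(\<Sum>i<n1. if i < n1 then a else if i = n1 then b else c) = (\<Sum>i<n1. a)"
    by (rule sum.cong) auto
  then show ?case by simp
qed (simp add: algebra_simps)

section \<open>Descent and disjointness of clocks\<close>

fun owner :: "clock \<Rightarrow> particle" where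
  "owner (Split u) = u"
| "owner (Motion u) = u"
| "owner (Gap v k) = Type1 v"

text \<open>Labels grow at the head, so ancestry within a line is the suffix order. A type 2
  particle also descends from the mother of its line's founder and from all her ancestors.\<close>

fun descends :: "particle \<Rightarrow> particle \<Rightarrow> bool" where
  "descends (Type1 v) (Type1 v') \<longleftrightarrow> suffix v v'"
| "descends (Type1 v) (Type2 v' k w) \<longleftrightarrow> suffix v v'"
| "descends (Type2 v k w) (Type1 v') \<longleftrightarrow> False"
| "descends (Type2 v k w) (Type2 v' k' w') \<longleftrightarrow> v = v' \<and> k = k' \<and> suffix w w'"

definition descendant_clocks :: "particle \<Rightarrow> clock set" where
  "descendant_clocks s = {c. descends s (owner c)}"

fun line_from :: "particle \<Rightarrow> bool list \<Rightarrow> particle" where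
  "line_from (Type1 v) w = Type1 (w @ v)"
| "line_from (Type2 v k w') w = Type2 v k (w @ w')"

lemma inj_line_from: "inj (line_from s)"
  by (cases s) (auto simp: inj_def)

lemma rate_line_from: "branching_rate \<beta> (line_from s w) = branching_rate \<beta> s"
  by (cases s) auto

lemma descends_line_from: "descends s (line_from s w)"
  by (cases s) (auto simp: suffix_def)

lemma descends_trans: "descends s u \<Longrightarrow> descends u x \<Longrightarrow> descends s x"
  by (cases s; cases u; cases x) (auto dest: suffix_order.trans)

lemma descends_line_from_eq:
  "descends (line_from s c) x \<Longrightarrow> descends (line_from s c') x \<Longrightarrow> length c = length c' \<Longrightarrow> c = c'"
  by (cases s; cases x) (auto dest: suffix_append_same_length)

lemma not_descends_shorter: "length w < length c \<Longrightarrow> \<not> descends (line_from s c) (line_from s w)"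
  by (cases s) (auto dest: suffix_length_le)

section \<open>Edges of the tree and the last particle\<close>

context two_type_reducible_bbm_clocks
begin

text \<open>The duration is confined on both sides, since the path has to end shortly before
  \<open>t\<close>; the displacement only from below, because going further does no harm.\<close>

definition block :: "real \<Rightarrow> (bool list \<Rightarrow> particle) \<Rightarrow> real \<Rightarrow> real \<Rightarrow> real \<Rightarrow> bool list \<Rightarrow> 'a \<Rightarrow> bool" where
  "block d \<nu> lo hi y w \<omega> \<longleftrightarrow>
     lo \<le> elapsed \<nu> w \<omega> \<and> elapsed \<nu> w \<omega> \<le> hi \<and> y \<le> travelled d \<nu> w \<omega>"

lemma pred_block:
  "ancestral_clocks \<nu> (length w) \<subseteq> I \<Longrightarrow> Measurable.pred (clocks_algebra I) (block d \<nu> lo hi y w)"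
proof -
  assume I: "ancestral_clocks \<nu> (length w) \<subseteq> I"
  note [measurable] = measurable_elapsed[OF I] measurable_travelled[OF I]
  show ?thesis unfolding block_def[abs_def] by measurable
qed

text \<open>A crude sufficient event for a type 2 birth: the first Poisson point comes within time
  1, the mother survives it, and no height is lost. Its probability is bounded below by a constant,
  invisible on the exponential scale. The value \<open>False\<close> is a default; transitions start
  from type 1 sites.\<close>

fun transition :: "particle \<Rightarrow> 'a \<Rightarrow> bool" where
  "transition (Type1 v) \<omega> \<longleftrightarrow> G v 0 \<omega> \<le> 1 \<and> 1 < T (Type1 v) \<omega> \<and> 0 \<le> motion (Type1 v) (G v 0 \<omega>) \<omega>"
| "transition (Type2 v k w) \<omega> \<longleftrightarrow> False"

lemma measurable_gap_motion:
  assumes "Gap v 0 \<in> I" "Motion (Type1 v) \<in> I"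
  shows "(\<lambda>\<omega>. motion (Type1 v) (G v 0 \<omega>) \<omega>) \<in> borel_measurable (clocks_algebra I)"
  by (rule measurable_motion_compose[OF assms(2) measurable_gap[OF assms(1)] measurable_ident_sets[OF refl]])

lemma pred_transition:
  assumes "{Split (Type1 v), Motion (Type1 v), Gap v 0} \<subseteq> I"
  shows "Measurable.pred (clocks_algebra I) (transition (Type1 v))"
proof -
  have I: "Split (Type1 v) \<in> I" "Motion (Type1 v) \<in> I" "Gap v 0 \<in> I" using assms by auto
  note [measurable] = measurable_lifetime[OF I(1)] measurable_gap[OF I(3)] measurable_gap_motion[OF I(3,2)]
  have "Measurable.pred (clocks_algebra I)
      (\<lambda>\<omega>. G v 0 \<omega> \<le> 1 \<and> 1 < T (Type1 v) \<omega> \<and> 0 \<le> motion (Type1 v) (G v 0 \<omega>) \<omega>)"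
    by measurable
  then show ?thesis by (simp cong: measurable_cong)
qed

lemma prob_motion_nonneg_at:
  assumes I: "Motion u \<notin> I" and R: "R \<in> borel_measurable (clocks_algebra I)"
    and X: "X \<in> sets (clocks_algebra I)" and nn: "\<And>\<omega>. \<omega> \<in> X \<Longrightarrow> 0 \<le> R \<omega>"
  shows "prob X / 2 \<le> prob (X \<inter> {\<omega> \<in> space M. 0 \<le> motion u (R \<omega>) \<omega>})"
proof -
  have XM: "X \<in> sets M" using X sets_clocks_algebra_subset by blast
  have "R \<in> borel_measurable M" by (rule measurable_from_clocks_algebra[OF R])
  then have [measurable]: "(\<lambda>\<omega>. motion u (R \<omega>) \<omega>) \<in> borel_measurable M"
    by (rule motion_at_measurable)
  have h: "indicator {0..} \<in> borel_measurable (borel :: real measure)" by simp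
  have f: "indicator X \<in> borel_measurable (clocks_algebra I)" using X by simp
  have "ennreal (prob X / 2) = ennreal (prob X) * ennreal (1 / 2)"
    by (subst ennreal_mult''[symmetric]) simp_all
  also have "\<dots> = (\<integral>\<^sup>+\<omega>. indicator X \<omega> * ennreal (1 / 2) \<partial>M)"
    using XM by (simp add: nn_integral_multc emeasure_eq_measure)
  also have "\<dots> \<le> (\<integral>\<^sup>+\<omega>. indicator X \<omega> * (\<integral>\<^sup>+\<omega>'. indicator {0..} (motion u (R \<omega>) \<omega>') \<partial>M) \<partial>M)"
  proof (rule nn_integral_mono)
    fix \<omega>
    have "(\<integral>\<^sup>+\<omega>'. indicator {0..} (motion u (R \<omega>) \<omega>') \<partial>M) =
        (\<integral>\<^sup>+\<omega>'. indicator {\<omega>' \<in> space M. 0 \<le> motion u (R \<omega>) \<omega>'} \<omega>' \<partial>M)"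
      by (rule nn_integral_cong) (simp add: indicator_def)
    also have "\<dots> = emeasure M {\<omega>' \<in> space M. 0 \<le> motion u (R \<omega>) \<omega>'}"
      by (rule nn_integral_indicator) measurable
    finally show "indicator X \<omega> * ennreal (1 / 2) \<le>
        indicator X \<omega> * (\<integral>\<^sup>+\<omega>'. indicator {0..} (motion u (R \<omega>) \<omega>') \<partial>M)"
      using emeasure_motion_nonneg[of "R \<omega>" u] nn[of \<omega>] by (auto simp: indicator_def)
  qed
  also have "\<dots> = (\<integral>\<^sup>+\<omega>. indicator X \<omega> * indicator {0..} (motion u (R \<omega>) \<omega>) \<partial>M)"
    by (rule nn_integral_motion_at[OF I R f h, symmetric])
  also have "\<dots> = (\<integral>\<^sup>+\<omega>. indicator (X \<inter> {\<omega> \<in> space M. 0 \<le> motion u (R \<omega>) \<omega>}) \<omega> \<partial>M)"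
    by (rule nn_integral_cong) (simp add: indicator_def)
  also have "\<dots> = emeasure M (X \<inter> {\<omega> \<in> space M. 0 \<le> motion u (R \<omega>) \<omega>})"
    by (rule nn_integral_indicator) (use XM in measurable)
  finally show ?thesis
    by (simp add: emeasure_eq_measure)
qed

lemma prob_transition_ge:
  assumes "0 < \<beta>" "0 < \<alpha>"
  shows "exp (- \<beta>) * (1 - exp (- \<alpha>)) / 2 \<le> prob {\<omega> \<in> space M. transition (Type1 v) \<omega>}"
proof -
  let ?X = "{\<omega> \<in> space M. 1 < T (Type1 v) \<omega>}" and ?Y = "{\<omega> \<in> space M. G v 0 \<omega> \<le> 1}"
  note [measurable] = measurable_lifetime[of "Type1 v" "{Split (Type1 v)}"] measurable_gap[of v 0 "{Gap v 0}"]
  have "{\<omega> \<in> space (clocks_algebra {Split (Type1 v)}). 1 < T (Type1 v) \<omega>} \<in> sets (clocks_algebra {Split (Type1 v)})"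
    and "{\<omega> \<in> space (clocks_algebra {Gap v 0}). G v 0 \<omega> \<le> 1} \<in> sets (clocks_algebra {Gap v 0})"
    by measurable
  then have "?X \<in> sets (clocks_algebra {Split (Type1 v)})" "?Y \<in> sets (clocks_algebra {Gap v 0})"
    by simp_all
  then have ind: "prob (?X \<inter> ?Y) = prob ?X * prob ?Y"
    using indep_setD[OF indep_clocks_algebra[of "{Split (Type1 v)}" "{Gap v 0}"]] by simp
  have "prob ?X = exp (- \<beta>)"
    using exponential_distributedD_gt[OF lifetimes, of 1 "Type1 v"] assms by simp
  moreover have "prob ?Y = 1 - exp (- \<alpha>)"
    using exponential_distributedD_le[OF gaps, of 1 v 0] assms by simp
  moreover have "prob (?X \<inter> ?Y) / 2 \<le> prob ((?X \<inter> ?Y) \<inter> {\<omega> \<in> space M. 0 \<le> motion (Type1 v) (G v 0 \<omega>) \<omega>})"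
  proof (rule prob_motion_nonneg_at)
    let ?I = "{Split (Type1 v), Gap v 0}"
    show "Motion (Type1 v) \<notin> ?I" by simp
    show G: "G v 0 \<in> borel_measurable (clocks_algebra ?I)" by (rule measurable_gap) simp
    note [measurable] = G measurable_lifetime[of "Type1 v" ?I]
    have "{\<omega> \<in> space (clocks_algebra ?I). 1 < T (Type1 v) \<omega> \<and> G v 0 \<omega> \<le> 1} \<in> sets (clocks_algebra ?I)"
      by measurable
    moreover have "{\<omega> \<in> space (clocks_algebra ?I). 1 < T (Type1 v) \<omega> \<and> G v 0 \<omega> \<le> 1} = ?X \<inter> ?Y"
      by auto
    ultimately show "?X \<inter> ?Y \<in> sets (clocks_algebra ?I)" by simp
  qed (auto simp: gaps_pos less_imp_le)
  moreover have "(?X \<inter> ?Y) \<inter> {\<omega> \<in> space M. 0 \<le> motion (Type1 v) (G v 0 \<omega>) \<omega>} =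
      {\<omega> \<in> space M. transition (Type1 v) \<omega>}" by auto
  ultimately show ?thesis using ind by simp
qed

lemma born_line_from: "born (line_from s c) \<omega> = born s \<omega> + elapsed (line_from s) c \<omega>"
proof (induction c)
  case Nil
  show ?case by (cases s) auto
next
  case (Cons b c)
  then show ?case by (cases s) auto
qed

lemma birthplace_line_from:
  "birthplace \<sigma> (line_from s c) \<omega> = birthplace \<sigma> s \<omega> + travelled (diffusivity \<sigma> s) (line_from s) c \<omega>"
proof (induction c)
  case Nil
  show ?case by (cases s) auto
next
  case (Cons b c)
  then show ?case by (cases s) auto
qed

text \<open>Which endpoints are reached is decided by the clocks of \<open>I\<close>. Removing from
  \<open>A u\<close> what other endpoints already cover gives disjoint events to which
  \<open>le\<close> still applies, as it is asked for all subevents of \<open>A u\<close> in the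
  algebra of \<open>I\<close>. So \<open>e\<close> multiplies the probability of the whole union,
  although the \<open>F u\<close> may depend on each other.\<close>

lemma prob_disjointify:
  assumes "finite U" "0 \<le> e" and A: "\<And>u. u \<in> U \<Longrightarrow> A u \<in> sets (clocks_algebra I)"
    and F: "\<And>u. u \<in> U \<Longrightarrow> F u \<in> sets M"
    and le: "\<And>u X. u \<in> U \<Longrightarrow> X \<in> sets (clocks_algebra I) \<Longrightarrow> X \<subseteq> A u \<Longrightarrow> e * prob X \<le> prob (X \<inter> F u)"
  shows "e * prob (\<Union>u\<in>U. A u) \<le> prob (\<Union>u\<in>U. A u \<inter> F u)"
  using assms(1) A F le
proof (induction U rule: finite_induct)
  case (insert u U)
  let ?V = "\<Union>u\<in>U. A u" and ?W = "\<Union>u\<in>U. A u \<inter> F u"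
  have AM: "A x \<in> sets M" if "x \<in> insert u U" for x
    using insert.prems(1)[OF that] sets_clocks_algebra_subset by blast
  have V: "?V \<in> sets (clocks_algebra I)"
    using insert.prems(1) insert.hyps(1) by (intro sets.finite_UN) auto
  have WM: "?W \<in> sets M"
    using AM insert.prems(2) insert.hyps(1) by (intro sets.finite_UN) auto
  have VM: "?V \<in> sets M" using V sets_clocks_algebra_subset by blast
  have "prob (?V \<union> (A u - ?V)) = prob ?V + prob (A u - ?V)"
    using VM AM by (intro finite_measure_Union) auto
  moreover have "?V \<union> (A u - ?V) = (\<Union>u\<in>insert u U. A u)" by auto
  ultimately have "e * prob (\<Union>u\<in>insert u U. A u) = e * prob ?V + e * prob (A u - ?V)"
    by (simp add: algebra_simps)
  also have "\<dots> \<le> prob ?W + prob ((A u - ?V) \<inter> F u)"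
    using insert.IH insert.prems V by (intro add_mono insert.prems(3)) auto
  also have "\<dots> = prob (?W \<union> ((A u - ?V) \<inter> F u))"
    using WM VM AM insert.prems(2) by (intro finite_measure_Union[symmetric]) auto
  also have "\<dots> \<le> prob (\<Union>u\<in>insert u U. A u \<inter> F u)"
    using AM insert.prems(2) insert.hyps(1) by (intro finite_measure_mono sets.finite_UN) auto
  finally show ?case .
qed simp

text \<open>For the last particle: \<open>R\<close> will be the random time from its birth to
  \<open>t\<close>, and \<open>L\<close> a bound on it. Living longer than \<open>L\<close> and
  ending no lower than the birthplace is enough, and both are decided by clocks outside
  \<open>I\<close>.\<close>

lemma prob_survive_nonneg_ge:
  assumes rate: "branching_rate \<beta> u = 1" and u: "Split u \<notin> I" "Motion u \<notin> I"
    and R: "R \<in> borel_measurable (clocks_algebra I)" and X: "X \<in> sets (clocks_algebra I)"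
    and nn: "\<And>\<omega>. \<omega> \<in> X \<Longrightarrow> 0 \<le> R \<omega>" and L: "0 \<le> L"
  shows "exp (- L) / 2 * prob X \<le> prob (X \<inter> {\<omega> \<in> space M. L < T u \<omega> \<and> 0 \<le> motion u (R \<omega>) \<omega>})"
proof -
  let ?Y = "{\<omega> \<in> space M. L < T u \<omega>}" and ?I = "insert (Split u) I"
  note [measurable] = measurable_lifetime[of u "{Split u}"]
  have "{\<omega> \<in> space (clocks_algebra {Split u}). L < T u \<omega>} \<in> sets (clocks_algebra {Split u})"
    by measurable
  then have Y: "?Y \<in> sets (clocks_algebra {Split u})" by simp
  have "prob (X \<inter> ?Y) = prob X * prob ?Y"
    using indep_setD[OF indep_clocks_algebra[of I "{Split u}"] X Y] u by simp
  also have "prob ?Y = exp (- L)"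
    using exponential_distributedD_gt[OF lifetimes, of L u] L rate by simp
  finally have "exp (- L) / 2 * prob X = prob (X \<inter> ?Y) / 2" by simp
  also have "\<dots> \<le> prob ((X \<inter> ?Y) \<inter> {\<omega> \<in> space M. 0 \<le> motion u (R \<omega>) \<omega>})"
  proof (rule prob_motion_nonneg_at)
    show "Motion u \<notin> ?I" using u by simp
    show "R \<in> borel_measurable (clocks_algebra ?I)"
      using R by (rule measurable_clocks_algebra_mono) auto
    show "X \<inter> ?Y \<in> sets (clocks_algebra ?I)"
      using X Y sets_clocks_algebra_mono[of I ?I] sets_clocks_algebra_mono[of "{Split u}" ?I] by blast
  qed (use nn in auto)
  also have "(X \<inter> ?Y) \<inter> {\<omega> \<in> space M. 0 \<le> motion u (R \<omega>) \<omega>} =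
      X \<inter> {\<omega> \<in> space M. L < T u \<omega> \<and> 0 \<le> motion u (R \<omega>) \<omega>}" by auto
  finally show ?thesis .
qed

end

text \<open>Particles descending from the root through \<open>n1\<close> blocks of \<open>K\<close> generations of type 1, the birth
  of a type 2 particle, and \<open>n2\<close> blocks of \<open>K\<close> generations of type 2.\<close>

locale two_phase_tree = two_type_reducible_bbm_clocks M \<beta> \<alpha> T G B
  for M :: "'a measure" and \<beta> \<alpha> T G B +
  fixes \<sigma> :: real and n1 n2 K :: nat and lo1 hi1 y1 m1 lo2 hi2 y2 m2 q0 q :: real
  assumes rates_pos: "0 < \<beta>" "0 < \<alpha>"
    and block1: "m1 \<le> (\<Sum>c | length c = K. prob {\<omega> \<in> space M. block \<sigma> (line_from (Type1 v)) lo1 hi1 y1 c \<omega>})"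
    and block2: "m2 \<le> (\<Sum>c | length c = K. prob {\<omega> \<in> space M. block 1 (line_from (Type2 v 0 w)) lo2 hi2 y2 c \<omega>})"
    and q0: "0 < q0" "q0 \<le> m1" "q0 \<le> m2" "q0 \<le> exp (- \<beta>) * (1 - exp (- \<alpha>)) / 2"
    and q: "q < 1" "m1 \<le> q" "m2 \<le> q" "exp (- \<beta>) * (1 - exp (- \<alpha>)) / 2 \<le> q"
begin

definition levels :: nat where "levels = n1 + 1 + n2"

definition sites :: "nat \<Rightarrow> particle set" where
  "sites j = (if j \<le> n1 then {Type1 v |v. length v = j * K}
     else {Type2 v 0 w |v w. length v = n1 * K \<and> length w = (j - (n1 + 1)) * K})"

text \<open>The level of the type 2 birth has one dummy letter, since only the first type 2 child,
  \<open>k = 0\<close>, is followed.\<close>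

definition letters :: "nat \<Rightarrow> bool list set" where
  "letters j = (if j = n1 then {[]} else {c. length c = K})"

definition child :: "nat \<Rightarrow> particle \<Rightarrow> bool list \<Rightarrow> particle" where
  "child j s c = (if j = n1 then (case s of Type1 v \<Rightarrow> Type2 v 0 [] | Type2 v k w \<Rightarrow> s) else line_from s c)"

definition edge :: "nat \<Rightarrow> particle \<Rightarrow> bool list \<Rightarrow> 'a \<Rightarrow> bool" where
  "edge j s c \<omega> \<longleftrightarrow> (if j < n1 then block \<sigma> (line_from s) lo1 hi1 y1 c \<omega>
     else if j = n1 then transition s \<omega> else block 1 (line_from s) lo2 hi2 y2 c \<omega>)"

definition edge_clocks :: "nat \<Rightarrow> particle \<Rightarrow> clock set" where
  "edge_clocks j s = (if j = n1 then {Split s, Motion s} \<union> (case s of Type1 v \<Rightarrow> {Gap v 0} | Type2 v k w \<Rightarrow> {})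
     else ancestral_clocks (line_from s) K)"

definition transition_prob :: real where
  "transition_prob = exp (- \<beta>) * (1 - exp (- \<alpha>)) / 2"

definition level_mean :: "nat \<Rightarrow> real" where
  "level_mean j = (if j < n1 then m1 else if j = n1 then transition_prob else m2)"

lemma site_cases:
  assumes "s \<in> sites j"
  obtains (before) v where "j < n1" "s = Type1 v" "length v = j * K"
    | (switch) v where "j = n1" "s = Type1 v" "length v = n1 * K"
    | (after) v w where "n1 < j" "s = Type2 v 0 w" "length v = n1 * K" "length w = (j - (n1 + 1)) * K"
  using assms by (cases "j < n1"; cases "j = n1") (auto simp: sites_def)

lemma child_in_sites:
  assumes "s \<in> sites j" "c \<in> letters j"
  shows "child j s c \<in> sites (Suc j)"
  using assms(1)
proof (cases rule: site_cases)
  case (after v w)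
  then have "(Suc j - (n1 + 1)) * K = K + (j - (n1 + 1)) * K"
    by (metis Suc_diff_le Suc_eq_plus1 Suc_leI mult_Suc)
  then show ?thesis
    using after assms(2) by (auto simp: child_def sites_def letters_def)
qed (use assms(2) in \<open>auto simp: child_def sites_def letters_def\<close>)

lemma descends_refl: "descends s s"
  by (cases s) auto

lemma descends_child: "descends s (child j s c)"
  by (cases s) (auto simp: child_def suffix_def)

text \<open>The clocks of a block belong to words of fewer than \<open>K\<close> letters, those of a
  child's subtree to extensions of a word of \<open>K\<close> letters; two such words of equal
  length have no common extension. At the type 2 birth the edge uses clocks of the mother and the
  subtree those of type 2 particles.\<close>

sublocale tree: random_tree M \<beta> \<alpha> T G B levels sites letters child edge edge_clocks descendant_clocks
  level_mean "2 ^ K" q0 q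
proof
  show "finite (letters j)" for j
    by (simp add: letters_def finite_words)
  show "real (card (letters j)) \<le> 2 ^ K" for j
    by (simp add: letters_def card_words)
  show "child j v c \<in> sites (Suc j)" if "v \<in> sites j" "c \<in> letters j" for j v c
    using that by (rule child_in_sites)
  show "Measurable.pred (clocks_algebra (edge_clocks j s)) (edge j s c)"
    if "s \<in> sites j" "c \<in> letters j" for j s c
    using that(1)
  proof (cases rule: site_cases)
    case (before v)
    then show ?thesis
      using pred_block[of "line_from s" c "edge_clocks j s"] that(2)
      by (simp add: edge_def[abs_def] edge_clocks_def letters_def)
  next
    case (switch v)
    then show ?thesis
      using pred_transition[of v "edge_clocks j s"]
      by (simp add: edge_def[abs_def] edge_clocks_def)
  next
    case (after v w)
    then show ?thesis
      using pred_block[of "line_from s" c "edge_clocks j s"] that(2)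
      by (simp add: edge_def[abs_def] edge_clocks_def letters_def)
  qed
  show "edge_clocks j s \<subseteq> descendant_clocks s" for j s
    by (auto simp: edge_clocks_def descendant_clocks_def ancestral_clocks_def own_clocks_def
        descends_line_from descends_refl suffix_def split: particle.splits if_splits)
  show "descendant_clocks (child j s c) \<subseteq> descendant_clocks s" for j s c
    using descends_trans[OF descends_child] by (auto simp: descendant_clocks_def)
  show "edge_clocks j s \<inter> descendant_clocks (child j s c) = {}" if "s \<in> sites j" "c \<in> letters j" for j s c
    using that(1)
  proof (cases rule: site_cases)
    case (switch v)
    then show ?thesis by (auto simp: edge_clocks_def child_def descendant_clocks_def)
  qed (use that(2) in \<open>auto simp: edge_clocks_def child_def descendant_clocks_def ancestral_clocks_def
      own_clocks_def letters_def not_descends_shorter simp del: line_from.simps\<close>)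
  show "descendant_clocks (child j s c) \<inter> descendant_clocks (child j s c') = {}"
    if "c \<in> letters j" "c' \<in> letters j" "c \<noteq> c'" for j s c c'
    using that descends_line_from_eq[of s c _ c']
    by (auto simp: letters_def child_def descendant_clocks_def split: if_splits)
  show "level_mean j \<le> (\<Sum>c\<in>letters j. prob {\<omega> \<in> space M. edge j s c \<omega>})" if "s \<in> sites j" for j s
    using that
  proof (cases rule: site_cases)
    case (before v)
    then show ?thesis using block1[of v] by (simp add: level_mean_def letters_def edge_def)
  next
    case (switch v)
    then show ?thesis
      using prob_transition_ge[OF rates_pos, of v]
      by (simp add: level_mean_def letters_def edge_def transition_prob_def)
  next
    case (after v w)
    then show ?thesis using block2[of v w] by (simp add: level_mean_def letters_def edge_def)
  qed
qed (use q0 q in \<open>auto simp: level_mean_def transition_prob_def\<close>)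

definition time_lo :: "nat \<Rightarrow> real" where "time_lo j = (if j < n1 then lo1 else if j = n1 then 0 else lo2)"
definition time_hi :: "nat \<Rightarrow> real" where "time_hi j = (if j < n1 then hi1 else if j = n1 then 1 else hi2)"
definition gain :: "nat \<Rightarrow> real" where "gain j = (if j < n1 then y1 else if j = n1 then 0 else y2)"

fun is_really_born :: "particle \<Rightarrow> 'a \<Rightarrow> bool" where
  "is_really_born (Type1 v) \<omega> \<longleftrightarrow> True"
| "is_really_born (Type2 v k w) \<omega> \<longleftrightarrow> child_time v k \<omega> < T (Type1 v) \<omega>"

lemma edge_step:
  assumes \<omega>: "\<omega> \<in> space M" and \<sigma>: "0 \<le> \<sigma>" and s: "s \<in> sites j" and e: "edge j s c \<omega>"
  shows "born s \<omega> + time_lo j \<le> born (child j s c) \<omega> \<and> born (child j s c) \<omega> \<le> born s \<omega> + time_hi j \<and>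
    birthplace \<sigma> s \<omega> + gain j \<le> birthplace \<sigma> (child j s c) \<omega> \<and>
    (is_really_born s \<omega> \<longrightarrow> is_really_born (child j s c) \<omega>)"
  using s
proof (cases rule: site_cases)
  case (before v)
  then show ?thesis
    using e by (simp add: edge_def block_def child_def time_lo_def time_hi_def gain_def born_line_from
        birthplace_line_from del: born.simps birthplace.simps line_from.simps) (simp add: before)
next
  case (switch v)
  have "0 < G v 0 \<omega>" by (rule gaps_pos[OF \<omega>])
  with switch show ?thesis
    using e \<sigma> by (simp add: edge_def child_def time_lo_def time_hi_def gain_def
        birth2_time_def birth2_position_def)
next
  case (after v w)
  then show ?thesis
    using e by (simp add: edge_def block_def child_def time_lo_def time_hi_def gain_def born_line_from
        birthplace_line_from del: born.simps birthplace.simps line_from.simps) (simp add: after)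
qed

lemma reach_bounds:
  assumes \<omega>: "\<omega> \<in> space M" and \<sigma>: "0 \<le> \<sigma>"
  shows "s \<in> sites j \<Longrightarrow> tree.reach n j s u \<omega> \<Longrightarrow>
    born s \<omega> + (\<Sum>i\<in>{j..<j + n}. time_lo i) \<le> born u \<omega> \<and>
    born u \<omega> \<le> born s \<omega> + (\<Sum>i\<in>{j..<j + n}. time_hi i) \<and>
    birthplace \<sigma> s \<omega> + (\<Sum>i\<in>{j..<j + n}. gain i) \<le> birthplace \<sigma> u \<omega> \<and>
    (is_really_born s \<omega> \<longrightarrow> is_really_born u \<omega>)"
proof (induction n arbitrary: j s)
  case (Suc n)
  then obtain c where c: "c \<in> letters j" "edge j s c \<omega>" "tree.reach n (Suc j) (child j s c) u \<omega>" by auto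
  have "sum f {j..<j + Suc n} = f j + sum f {Suc j..<Suc j + n}" for f :: "nat \<Rightarrow> real"
    by (simp add: sum.atLeast_Suc_lessThan)
  then show ?case
    using Suc.IH[OF child_in_sites[OF Suc.prems(1) c(1)] c(3)] edge_step[OF \<omega> \<sigma> Suc.prems(1) c(2)]
    by simp
qed simp

text \<open>The path to an endpoint and its birth time are decided by these clocks, whereas the
  lifetime and motion of every endpoint stay outside and hence independent.\<close>

definition other_clocks :: "clock set" where
  "other_clocks = {c. owner c \<notin> sites levels}"

lemma edge_clocks_other:
  assumes "j < levels" "s \<in> sites j"
  shows "edge_clocks j s \<subseteq> other_clocks"
  using assms(2)
proof (cases rule: site_cases)
  case (after v w)
  then have "(j - (n1 + 1)) + 1 \<le> n2" using assms(1) by (simp add: levels_def)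
  then have "(j - (n1 + 1)) * K + K \<le> n2 * K"
    by (metis add_mult_distrib mult_1 mult_le_mono1)
  then show ?thesis
    using after by (auto simp: edge_clocks_def other_clocks_def sites_def levels_def ancestral_clocks_def own_clocks_def)
qed (auto simp: edge_clocks_def other_clocks_def sites_def levels_def ancestral_clocks_def own_clocks_def)

lemma finite_endpoints: "finite (sites levels)"
proof -
  have "sites levels \<subseteq> (\<lambda>(v, w). Type2 v 0 w) ` ({v. length v = n1 * K} \<times> {w. length w = n2 * K})"
    by (auto simp: sites_def levels_def)
  then show ?thesis using finite_words by (meson finite_SigmaI finite_imageI finite_subset)
qed

lemma endpoint_clocks:
  assumes "u \<in> sites levels"
  shows "born u \<in> borel_measurable (clocks_algebra other_clocks)"
    and "Split u \<notin> other_clocks" "Motion u \<notin> other_clocks"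
proof -
  obtain v w where u: "u = Type2 v 0 w" "length w = n2 * K"
    using assms by (auto simp: sites_def levels_def)
  have "birth2_clocks v 0 \<subseteq> other_clocks" "ancestral_clocks (Type2 v 0) (length w) \<subseteq> other_clocks"
    using u by (auto simp: birth2_clocks_def other_clocks_def sites_def levels_def ancestral_clocks_def own_clocks_def)
  note [measurable] = measurable_birth2(1)[OF this(1)] measurable_elapsed[OF this(2)]
  show "born u \<in> borel_measurable (clocks_algebra other_clocks)"
    unfolding u by (simp cong: measurable_cong)
  show "Split u \<notin> other_clocks" "Motion u \<notin> other_clocks"
    using assms by (auto simp: other_clocks_def)
qed

text \<open>Some endpoint is reached with probability at least a constant times the product of the
  level means. It is born before \<open>t\<close> by \<open>hi\<close>, with the summand 1 for the
  type 2 birth, and no more than \<open>L\<close> before \<open>t\<close> by \<open>lo\<close>. To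
  be alive at \<open>t\<close> without having lost height costs
  \<open>exp (- L) / 2\<close>.\<close>

lemma prob_above_ge:
  assumes \<sigma>: "0 \<le> \<sigma>" and L: "0 \<le> L" and hi: "n1 * hi1 + 1 + n2 * hi2 \<le> t"
    and lo: "t - (n1 * lo1 + n2 * lo2) \<le> L" and z: "z \<le> n1 * y1 + n2 * y2"
  shows "exp (- L) / 2 * (m1 ^ n1 * transition_prob * m2 ^ n2 / (1 + (2 ^ K)\<^sup>2 / (q0 * (1 - q)))) \<le>
    prob {\<omega> \<in> space M. above \<sigma> t z \<omega>}"
proof -
  let ?U = "sites levels" and ?I = other_clocks
  let ?root = "Type1 []"
  define A where "A u = {\<omega> \<in> space M. tree.reach levels 0 ?root u \<omega>}" for u
  define F where "F u = {\<omega> \<in> space M. L < T u \<omega> \<and> 0 \<le> motion u (t - born u \<omega>) \<omega>}" for u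
  have root: "?root \<in> sites 0" by (simp add: sites_def)
  have A: "A u \<in> sets (clocks_algebra ?I)" for u
  proof -
    have "Measurable.pred (clocks_algebra ?I) (tree.reach levels 0 ?root u)"
      by (rule tree.pred_reach[OF edge_clocks_other _ root]) simp_all
    then show ?thesis by (simp add: A_def pred_def)
  qed
  have F: "F u \<in> sets M" for u
  proof -
    have [measurable]: "(\<lambda>\<omega>. motion u (t - born u \<omega>) \<omega>) \<in> borel_measurable M"
      by (rule motion_at_measurable) measurable
    show ?thesis unfolding F_def by measurable
  qed
  have bounds: "n1 * lo1 + n2 * lo2 \<le> born u \<omega> \<and> born u \<omega> \<le> t \<and> z \<le> birthplace \<sigma> u \<omega> \<and> is_really_born u \<omega>"
    if "\<omega> \<in> A u" for u \<omega>
  proof -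
    have \<omega>: "\<omega> \<in> space M" "tree.reach levels 0 ?root u \<omega>" using that by (auto simp: A_def)
    have "(\<Sum>i\<in>{0..<0 + levels}. time_lo i) = n1 * lo1 + n2 * lo2"
      "(\<Sum>i\<in>{0..<0 + levels}. time_hi i) = n1 * hi1 + 1 + n2 * hi2"
      "(\<Sum>i\<in>{0..<0 + levels}. gain i) = n1 * y1 + n2 * y2"
      unfolding time_lo_def time_hi_def gain_def levels_def add_0 atLeast0LessThan sum_three_phases by simp_all
    then show ?thesis
      using reach_bounds[OF \<omega>(1) \<sigma> root \<omega>(2)] hi z by simp
  qed
  have eq: "{\<omega> \<in> space M. \<exists>u. tree.reach levels 0 ?root u \<omega>} = (\<Union>u\<in>?U. A u)"
    using tree.reach_site[of 0 levels ?root] root by (auto simp: A_def)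
  have UM: "(\<Union>u\<in>?U. A u) \<in> sets M"
    using A sets_clocks_algebra_subset finite_endpoints by (intro sets.finite_UN) auto
  have prod: "(\<Prod>i<levels. level_mean i) = m1 ^ n1 * transition_prob * m2 ^ n2"
    unfolding level_mean_def levels_def prod_three_phases by simp
  have "exp (- L) / 2 * (m1 ^ n1 * transition_prob * m2 ^ n2 / (1 + (2 ^ K)\<^sup>2 / (q0 * (1 - q)))) \<le>
      exp (- L) / 2 * prob (\<Union>u\<in>?U. A u)"
    using tree.prob_reach_ge[OF root] UM by (intro mult_left_mono) (auto simp: eq prod)
  also have "\<dots> \<le> prob (\<Union>u\<in>?U. A u \<inter> F u)"
  proof (rule prob_disjointify[OF finite_endpoints, where I = ?I])
    fix u X assume u: "u \<in> ?U" and X: "X \<in> sets (clocks_algebra ?I)" "X \<subseteq> A u"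
    note [measurable] = endpoint_clocks(1)[OF u]
    show "exp (- L) / 2 * prob X \<le> prob (X \<inter> F u)"
      unfolding F_def
    proof (rule prob_survive_nonneg_ge[OF _ endpoint_clocks(2,3)[OF u] _ X(1) _ L])
      show "branching_rate \<beta> u = 1" using u by (auto simp: sites_def levels_def)
      show "(\<lambda>\<omega>. t - born u \<omega>) \<in> borel_measurable (clocks_algebra ?I)" by measurable
      show "0 \<le> t - born u \<omega>" if "\<omega> \<in> X" for \<omega> using bounds[of \<omega> u] that X(2) by auto
    qed
  qed (use A F in auto)
  also have "\<dots> \<le> prob {\<omega> \<in> space M. above \<sigma> t z \<omega>}"
  proof (rule finite_measure_mono)
    show "(\<Union>u\<in>?U. A u \<inter> F u) \<subseteq> {\<omega> \<in> space M. above \<sigma> t z \<omega>}"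
    proof
      fix \<omega> assume "\<omega> \<in> (\<Union>u\<in>?U. A u \<inter> F u)"
      then obtain u where u: "u \<in> ?U" "\<omega> \<in> A u" "\<omega> \<in> F u" by auto
      obtain v w where uvw: "u = Type2 v 0 w" using u(1) by (auto simp: sites_def levels_def)
      have \<omega>: "\<omega> \<in> space M" "L < T u \<omega>" "0 \<le> motion u (t - born u \<omega>) \<omega>" using u(3) by (auto simp: F_def)
      have "u \<in> alive t \<omega>"
        using bounds[OF u(2)] \<omega>(2) lo unfolding uvw alive_Type2 by simp
      moreover have "z \<le> place \<sigma> t u \<omega>"
        using bounds[OF u(2)] \<omega>(3) unfolding place_def by (simp add: uvw)
      ultimately show "\<omega> \<in> {\<omega> \<in> space M. above \<sigma> t z \<omega>}" using \<omega>(1) by (auto simp: above_def)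
    qed
  qed measurable
  finally show ?thesis .
qed

end

section \<open>Growth rates of blocks\<close>

text \<open>Both sides agree at \<open>h = 0\<close>, and the derivative of their difference there
  is \<open>u - 2 * b * t < 0\<close>.\<close>

lemma small_tilt:
  fixes b t u v :: real
  assumes "0 < b" "u < 2 * b * t"
  obtains h where "0 < h" "2 * b * exp (- h * t) < 2 * b - (u * h + v * h\<^sup>2)"
proof -
  let ?f = "\<lambda>h. 2 * b * exp (- h * t) - 2 * b + u * h + v * h\<^sup>2"
  have "DERIV ?f 0 :> u - 2 * b * t"
    by (auto intro!: derivative_eq_intros)
  then obtain e where e: "0 < e" "\<And>h. 0 < h \<Longrightarrow> h < e \<Longrightarrow> ?f (0 + h) < ?f 0"
    using DERIV_neg_dec_right[of ?f "u - 2 * b * t" 0] assms by auto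
  show thesis
    by (rule that[of "e / 2"]) (use e(1) e(2)[of "e / 2"] in auto)
qed

context two_type_reducible_bbm_clocks
begin

text \<open>Under the law tilted by \<open>exp (l Y - \<kappa> S)\<close>, where \<open>S\<close> is the duration and \<open>Y\<close> the displacement
  of a line, \<open>(S, Y)\<close> concentrates at \<open>|w| / (2 b)\<close> times \<open>(1, l d\<^sup>2)\<close>.\<close>

lemma tilted_tail:
  assumes b: "0 < b" and \<kappa>: "\<kappa> = b + l\<^sup>2 * d\<^sup>2 / 2" and t: "x + l * y * d\<^sup>2 < 2 * b * t"
  shows "\<exists>\<rho>. 0 < \<rho> \<and> \<rho> < 1 \<and> (\<forall>\<nu> w. inj \<nu> \<longrightarrow> (\<forall>w. branching_rate \<beta> (\<nu> w) = b) \<longrightarrow>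
      (\<integral>\<^sup>+\<omega>. ennreal (exp (l * travelled d \<nu> w \<omega> - \<kappa> * elapsed \<nu> w \<omega>)) *
        indicator {\<omega>. t * length w \<le> x * elapsed \<nu> w \<omega> + y * travelled d \<nu> w \<omega>} \<omega> \<partial>M)
      \<le> ennreal ((\<rho> / 2) ^ length w))"
proof -
  obtain h where h: "0 < h"
      "2 * b * exp (- h * t) < 2 * b - ((x + l * y * d\<^sup>2) * h + (y\<^sup>2 * d\<^sup>2 / 2) * h\<^sup>2)"
    using small_tilt[OF b t] .
  \<comment> \<open>A second, small tilt by \<open>exp (h * (x * S + y * Y))\<close>, as in
    Chernoff's bound. At the critical \<open>\<kappa>\<close> the denominator is
    \<open>2 * b\<close>; the new tilt lowers it by \<open>g\<close>, and \<open>\<rho> < 1\<close>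
    says that the factor \<open>exp (- h * t)\<close> outweighs this.\<close>
  define g where "g = (x + l * y * d\<^sup>2) * h + (y\<^sup>2 * d\<^sup>2 / 2) * h\<^sup>2"
  define \<rho> where "\<rho> = 2 * b * exp (- h * t) / (2 * b - g)"
  have pos: "0 < 2 * b * exp (- h * t)" using b by simp
  then have g: "0 < 2 * b - g" using h(2) by (simp add: g_def)
  show ?thesis
  proof (intro exI[of _ \<rho>] conjI allI impI)
    show "0 < \<rho>" using pos g by (simp add: \<rho>_def)
    show "\<rho> < 1" using h(2) g by (simp add: \<rho>_def g_def)
    fix \<nu> :: "bool list \<Rightarrow> particle" and w
    assume \<nu>': "inj \<nu>" "\<forall>w. branching_rate \<beta> (\<nu> w) = b"
    note \<nu> = \<nu>'(1) \<nu>'(2)[rule_format]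
    let ?S = "elapsed \<nu> w" and ?Y = "travelled d \<nu> w" and ?n = "real (length w)"
    have eq: "b + (\<kappa> - h * x) - (l + h * y)\<^sup>2 * d\<^sup>2 / 2 = 2 * b - g"
      by (simp add: \<kappa> g_def power2_eq_square algebra_simps)
    have "(\<integral>\<^sup>+\<omega>. ennreal (exp (l * ?Y \<omega> - \<kappa> * ?S \<omega>)) * indicator {\<omega>. t * ?n \<le> x * ?S \<omega> + y * ?Y \<omega>} \<omega> \<partial>M)
        \<le> (\<integral>\<^sup>+\<omega>. ennreal (exp (- h * t * ?n)) *
          ennreal (exp ((l + h * y) * ?Y \<omega> - (\<kappa> - h * x) * ?S \<omega>)) \<partial>M)"
    proof (rule nn_integral_mono)
      fix \<omega>
      have "l * ?Y \<omega> - \<kappa> * ?S \<omega> \<le> - h * t * ?n + ((l + h * y) * ?Y \<omega> - (\<kappa> - h * x) * ?S \<omega>)"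
        if "t * ?n \<le> x * ?S \<omega> + y * ?Y \<omega>"
        using mult_left_mono[OF that less_imp_le[OF h(1)]] by (simp add: algebra_simps)
      then show "ennreal (exp (l * ?Y \<omega> - \<kappa> * ?S \<omega>)) * indicator {\<omega>. t * ?n \<le> x * ?S \<omega> + y * ?Y \<omega>} \<omega>
          \<le> ennreal (exp (- h * t * ?n)) * ennreal (exp ((l + h * y) * ?Y \<omega> - (\<kappa> - h * x) * ?S \<omega>))"
        by (auto simp: indicator_def ennreal_mult'[symmetric] mult_exp_exp intro!: ennreal_leI)
    qed
    also have "\<dots> = ennreal (exp (- h * t * ?n)) * ennreal ((b / (2 * b - g)) ^ length w)"
      using nn_integral_line_exp[OF \<nu> b, of "l + h * y" d "\<kappa> - h * x" w] eq g
      by (simp add: nn_integral_cmult)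
    also have "\<dots> = ennreal (exp (- h * t * ?n) * (b / (2 * b - g)) ^ length w)"
      by (rule ennreal_mult'[symmetric]) simp
    also have "exp (- h * t * ?n) * (b / (2 * b - g)) ^ length w = (\<rho> / 2) ^ length w"
    proof -
      have "exp (- h * t * ?n) = exp (- h * t) ^ length w"
        by (simp add: exp_of_nat_mult[symmetric] ac_simps)
      moreover have "\<rho> / 2 = exp (- h * t) * (b / (2 * b - g))"
        using g by (simp add: \<rho>_def field_simps)
      ultimately show ?thesis by (simp only: power_mult_distrib)
    qed
    finally show "(\<integral>\<^sup>+\<omega>. ennreal (exp (l * ?Y \<omega> - \<kappa> * ?S \<omega>)) *
        indicator {\<omega>. t * ?n \<le> x * ?S \<omega> + y * ?Y \<omega>} \<omega> \<partial>M) \<le> ennreal ((\<rho> / 2) ^ length w)" .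
  qed
qed

text \<open>\<open>b - a\<^sup>2 / (2 * d\<^sup>2)\<close> is the growth exponent of the particles
  with velocity \<open>a\<close>. The term with \<open>\<eta>\<close> is the loss when duration and
  displacement are known up to a relative error \<open>\<eta>\<close>: the whole equals
  \<open>\<kappa> * (1 - \<eta>) - l * a * (1 + \<eta>)\<close> at the tilt
  \<open>l = a / d\<^sup>2\<close> with its critical \<open>\<kappa>\<close>.\<close>

definition block_exponent :: "real \<Rightarrow> real \<Rightarrow> real \<Rightarrow> real \<Rightarrow> real" where
  "block_exponent b d a \<eta> = b - a\<^sup>2 / (2 * d\<^sup>2) - \<eta> * (b + 3 * a\<^sup>2 / (2 * d\<^sup>2))"

text \<open>Cramer's lower bound. Under the critical weight a word of length \<open>K\<close> has
  mass \<open>(1 / 2) ^ K\<close>, and at least half of it lies outside the tails, where the block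
  event holds and the weight is at most \<open>exp D\<close>. Summing over the \<open>2 ^ K\<close>
  words cancels the mass.\<close>

lemma sum_block_ge:
  assumes b: "0 < b" and d: "0 < d" and a: "0 < a" and \<eta>: "0 < \<eta>"
  obtains K0 where "\<And>K \<nu>. K0 \<le> K \<Longrightarrow> inj \<nu> \<Longrightarrow> (\<And>w. branching_rate \<beta> (\<nu> w) = b) \<Longrightarrow>
    exp (K / (2 * b) * block_exponent b d a \<eta>) / 2 \<le>
    (\<Sum>w | length w = K. prob {\<omega> \<in> space M. block d \<nu> ((1 - \<eta>) * (K / (2 * b)))
      ((1 + \<eta>) * (K / (2 * b))) ((1 - \<eta>) * (a * (K / (2 * b)))) w \<omega>})"
proof -
  define l \<kappa> where "l = a / d\<^sup>2" and "\<kappa> = b + l\<^sup>2 * d\<^sup>2 / 2"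
  have l: "l * d\<^sup>2 = a" using d by (simp add: l_def)
  have lpos: "0 < l" using a d by (simp add: l_def)
  have \<kappa>pos: "0 < \<kappa>" using b by (simp add: \<kappa>_def add_pos_nonneg)
  let ?tail = "\<lambda>\<rho> x y t. \<forall>\<nu> w. inj \<nu> \<longrightarrow> (\<forall>w. branching_rate \<beta> (\<nu> w) = b) \<longrightarrow>
      (\<integral>\<^sup>+\<omega>. ennreal (exp (l * travelled d \<nu> w \<omega> - \<kappa> * elapsed \<nu> w \<omega>)) *
        indicator {\<omega>. t * real (length w) \<le> x * elapsed \<nu> w \<omega> + y * travelled d \<nu> w \<omega>} \<omega> \<partial>M)
      \<le> ennreal ((\<rho> / 2) ^ length w)"
  have tail: "\<exists>\<rho>. 0 < \<rho> \<and> \<rho> < 1 \<and> ?tail \<rho> x y t" if "x + l * y * d\<^sup>2 < 2 * b * t" for x y t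
    by (rule tilted_tail[OF b \<kappa>_def that])
  \<comment> \<open>The four pairs \<open>x\<close>, \<open>y\<close> that follow are the upper and
    lower tails of duration and displacement, whose tilted means per generation are
    \<open>1 / (2 * b)\<close> and \<open>a / (2 * b)\<close>.\<close>
  have "(1) + l * (0) * d\<^sup>2 < 2 * b * ((1 + \<eta>) / (2 * b))"
    using b \<eta> a l mult_pos_pos[OF \<eta> a] by (simp add: left_diff_distrib distrib_right)
  from tail[OF this] obtain \<rho>1 where 1: "0 < \<rho>1" "\<rho>1 < 1" "?tail \<rho>1 (1) (0) ((1 + \<eta>) / (2 * b))"
    by blast
  have "(- 1) + l * (0) * d\<^sup>2 < 2 * b * (- (1 - \<eta>) / (2 * b))"
    using b \<eta> a l mult_pos_pos[OF \<eta> a] by (simp add: left_diff_distrib distrib_right)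
  from tail[OF this] obtain \<rho>2 where 2: "0 < \<rho>2" "\<rho>2 < 1" "?tail \<rho>2 (- 1) (0) (- (1 - \<eta>) / (2 * b))"
    by blast
  have "(0) + l * (1) * d\<^sup>2 < 2 * b * ((1 + \<eta>) * a / (2 * b))"
    using b \<eta> a l mult_pos_pos[OF \<eta> a] by (simp add: left_diff_distrib distrib_right)
  from tail[OF this] obtain \<rho>3 where 3: "0 < \<rho>3" "\<rho>3 < 1" "?tail \<rho>3 (0) (1) ((1 + \<eta>) * a / (2 * b))"
    by blast
  have "(0) + l * (- 1) * d\<^sup>2 < 2 * b * (- (1 - \<eta>) * a / (2 * b))"
    using b \<eta> a l mult_pos_pos[OF \<eta> a] by (simp add: left_diff_distrib distrib_right)
  from tail[OF this] obtain \<rho>4 where 4: "0 < \<rho>4" "\<rho>4 < 1" "?tail \<rho>4 (0) (- 1) (- (1 - \<eta>) * a / (2 * b))"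
    by blast
  define \<rho> where "\<rho> = Max {\<rho>1, \<rho>2, \<rho>3, \<rho>4}"
  have \<rho>: "0 < \<rho>" "\<rho> < 1" "\<rho>1 \<le> \<rho>" "\<rho>2 \<le> \<rho>" "\<rho>3 \<le> \<rho>" "\<rho>4 \<le> \<rho>"
    using 1 2 3 4 by (auto simp: \<rho>_def)
  \<comment> \<open>Four tails are to carry at most half of the mass together, hence
    \<open>1 / 8\<close>.\<close>
  obtain K0 where K0: "\<And>K. K0 \<le> K \<Longrightarrow> \<rho> ^ K \<le> 1 / 8"
  proof -
    obtain K0 where "\<rho> ^ K0 < 1 / 8" using real_arch_pow_inv[of "1 / 8" \<rho>] \<rho> by auto
    moreover have "\<rho> ^ K \<le> \<rho> ^ K0" if "K0 \<le> K" for K using that \<rho> by (intro power_decreasing) auto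
    ultimately show thesis using that by (meson less_imp_le order_trans)
  qed
  show thesis
  proof (rule that)
    fix K :: nat and \<nu> :: "bool list \<Rightarrow> particle"
    assume K: "K0 \<le> K" and \<nu>: "inj \<nu>" "\<And>w. branching_rate \<beta> (\<nu> w) = b"
    define h where "h = K / (2 * b)"
    let ?blk = "\<lambda>w. {\<omega> \<in> space M. block d \<nu> ((1 - \<eta>) * h) ((1 + \<eta>) * h) ((1 - \<eta>) * (a * h)) w \<omega>}"
    \<comment> \<open>Largest exponent of the weight outside the tails: displacement at its upper
      limit, duration at its lower one. The upper tail of the displacement is cut off for this bound
      alone.\<close>
    define D where "D = l * ((1 + \<eta>) * a * h) - \<kappa> * ((1 - \<eta>) * h)"
    have one: "exp (- D) * (1 / 2) ^ K / 2 \<le> prob (?blk w)" if w: "length w = K" for w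
    proof -
      let ?S = "elapsed \<nu> w" and ?Y = "travelled d \<nu> w"
      let ?e = "\<lambda>\<omega>. ennreal (exp (l * ?Y \<omega> - \<kappa> * ?S \<omega>))"
      define A1 where "A1 = {\<omega>. (1 + \<eta>) / (2 * b) * length w \<le> 1 * ?S \<omega> + 0 * ?Y \<omega>}"
      define A2 where "A2 = {\<omega>. - (1 - \<eta>) / (2 * b) * length w \<le> - 1 * ?S \<omega> + 0 * ?Y \<omega>}"
      define A3 where "A3 = {\<omega>. (1 + \<eta>) * a / (2 * b) * length w \<le> 0 * ?S \<omega> + 1 * ?Y \<omega>}"
      define A4 where "A4 = {\<omega>. - (1 - \<eta>) * a / (2 * b) * length w \<le> 0 * ?S \<omega> + - 1 * ?Y \<omega>}"
      have T: "(\<integral>\<^sup>+\<omega>. ?e \<omega> * indicator A1 \<omega> \<partial>M) \<le> ennreal ((\<rho>1 / 2) ^ K)"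
        "(\<integral>\<^sup>+\<omega>. ?e \<omega> * indicator A2 \<omega> \<partial>M) \<le> ennreal ((\<rho>2 / 2) ^ K)"
        "(\<integral>\<^sup>+\<omega>. ?e \<omega> * indicator A3 \<omega> \<partial>M) \<le> ennreal ((\<rho>3 / 2) ^ K)"
        "(\<integral>\<^sup>+\<omega>. ?e \<omega> * indicator A4 \<omega> \<partial>M) \<le> ennreal ((\<rho>4 / 2) ^ K)"
        using 1(3)[rule_format, OF \<nu>, of w] 2(3)[rule_format, OF \<nu>, of w]
          3(3)[rule_format, OF \<nu>, of w] 4(3)[rule_format, OF \<nu>, of w]
        unfolding A1_def A2_def A3_def A4_def w by blast+
      have le: "ennreal ((r / 2) ^ K) \<le> ennreal ((\<rho> / 2) ^ K)" if "0 < r" "r \<le> \<rho>" for r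
        using that by (intro ennreal_leI power_mono) auto
      note T = order_trans[OF T(1) le[OF 1(1) \<rho>(3)]] order_trans[OF T(2) le[OF 2(1) \<rho>(4)]]
        order_trans[OF T(3) le[OF 3(1) \<rho>(5)]] order_trans[OF T(4) le[OF 4(1) \<rho>(6)]]
      have meas: "(\<lambda>\<omega>. ?e \<omega> * indicator A1 \<omega>) \<in> borel_measurable M"
        "(\<lambda>\<omega>. ?e \<omega> * indicator A2 \<omega>) \<in> borel_measurable M"
        "(\<lambda>\<omega>. ?e \<omega> * indicator A3 \<omega>) \<in> borel_measurable M"
        "(\<lambda>\<omega>. ?e \<omega> * indicator A4 \<omega>) \<in> borel_measurable M"
        unfolding A1_def A2_def A3_def A4_def by measurable
      have blk: "?blk w \<in> sets M"
        unfolding block_def by measurable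
      have "ennreal ((1 / 2) ^ K) = (\<integral>\<^sup>+\<omega>. ?e \<omega> \<partial>M)"
        using nn_integral_line_exp[OF \<nu> b, of l d \<kappa> w] b w by (simp add: \<kappa>_def)
      also have "\<dots> \<le> (\<integral>\<^sup>+\<omega>. ennreal (exp D) * indicator (?blk w) \<omega> + (?e \<omega> * indicator A1 \<omega> +
          (?e \<omega> * indicator A2 \<omega> + (?e \<omega> * indicator A3 \<omega> + ?e \<omega> * indicator A4 \<omega>))) \<partial>M)"
      proof (rule nn_integral_mono)
        fix \<omega> assume \<omega>: "\<omega> \<in> space M"
        consider "\<omega> \<in> A1" | "\<omega> \<in> A2" | "\<omega> \<in> A3" | "\<omega> \<in> A4" | "\<omega> \<notin> A1" "\<omega> \<notin> A2" "\<omega> \<notin> A3" "\<omega> \<notin> A4"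
          by blast
        then show "?e \<omega> \<le> ennreal (exp D) * indicator (?blk w) \<omega> + (?e \<omega> * indicator A1 \<omega> +
          (?e \<omega> * indicator A2 \<omega> + (?e \<omega> * indicator A3 \<omega> + ?e \<omega> * indicator A4 \<omega>)))"
        proof cases
          case 5
          have eqs: "(1 + \<eta>) / (2 * b) * length w = (1 + \<eta>) * h"
            "- (1 - \<eta>) / (2 * b) * length w = - ((1 - \<eta>) * h)"
            "(1 + \<eta>) * a / (2 * b) * length w = (1 + \<eta>) * a * h"
            "- (1 - \<eta>) * a / (2 * b) * length w = - ((1 - \<eta>) * (a * h))"
            using b by (simp_all add: h_def w field_simps)
          from 5 have S: "(1 - \<eta>) * h \<le> ?S \<omega>" "?S \<omega> \<le> (1 + \<eta>) * h"
            and Y: "(1 - \<eta>) * (a * h) \<le> ?Y \<omega>" "?Y \<omega> \<le> (1 + \<eta>) * a * h"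
            unfolding A1_def A2_def A3_def A4_def eqs by simp_all
          then have "\<omega> \<in> ?blk w" using \<omega> by (simp add: block_def)
          moreover have "l * ?Y \<omega> - \<kappa> * ?S \<omega> \<le> D"
            unfolding D_def using S Y lpos \<kappa>pos by (intro diff_mono mult_left_mono) auto
          then have "?e \<omega> \<le> ennreal (exp D)" by (intro ennreal_leI) simp
          ultimately show ?thesis by (simp add: add_increasing2)
        qed (simp_all add: add_increasing add_increasing2)
      qed
      also have "\<dots> = ennreal (exp D) * emeasure M (?blk w) + ((\<integral>\<^sup>+\<omega>. ?e \<omega> * indicator A1 \<omega> \<partial>M) +
          ((\<integral>\<^sup>+\<omega>. ?e \<omega> * indicator A2 \<omega> \<partial>M) + ((\<integral>\<^sup>+\<omega>. ?e \<omega> * indicator A3 \<omega> \<partial>M) +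
          (\<integral>\<^sup>+\<omega>. ?e \<omega> * indicator A4 \<omega> \<partial>M))))"
        using meas blk by (simp add: nn_integral_add nn_integral_cmult_indicator)
      also have "\<dots> \<le> ennreal (exp D) * emeasure M (?blk w) + (ennreal ((\<rho> / 2) ^ K) +
          (ennreal ((\<rho> / 2) ^ K) + (ennreal ((\<rho> / 2) ^ K) + ennreal ((\<rho> / 2) ^ K))))"
        by (intro add_mono order_refl T)
      also have "\<dots> = ennreal (exp D * prob (?blk w) + 4 * (\<rho> / 2) ^ K)"
      proof -
        have "ennreal x * ennreal p + (ennreal c + (ennreal c + (ennreal c + ennreal c))) = ennreal (x * p + 4 * c)"
          if "0 \<le> x" "0 \<le> p" "0 \<le> c" for x p c
        proof -
          have "4 * c = c + (c + (c + c))" by simp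
          then show ?thesis
            using that by (simp only: ennreal_mult ennreal_plus add_nonneg_nonneg mult_nonneg_nonneg)
        qed
        then show ?thesis using \<rho>(1) by (simp add: emeasure_eq_measure)
      qed
      finally have "(1 / 2) ^ K \<le> exp D * prob (?blk w) + 4 * (\<rho> / 2) ^ K"
        using \<rho>(1) by (subst (asm) ennreal_le_iff) auto
      moreover have "4 * (\<rho> / 2) ^ K \<le> (1 / 2) ^ K / 2"
        using K0[OF K] by (simp add: power_divide field_simps)
      ultimately have "(1 / 2) ^ K / 2 \<le> exp D * prob (?blk w)" by linarith
      then have "exp (- D) * ((1 / 2) ^ K / 2) \<le> exp (- D) * (exp D * prob (?blk w))"
        by (rule mult_left_mono) simp
      also have "\<dots> = prob (?blk w)" by (simp add: exp_minus)
      finally show ?thesis by simp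
    qed
    have "exp (- D) / 2 = (\<Sum>w :: bool list | length w = K. exp (- D) * (1 / 2) ^ K / 2)"
      by (simp add: card_words power_divide)
    also have "\<dots> \<le> (\<Sum>w | length w = K. prob (?blk w))"
      by (intro sum_mono one) simp
    also have "- D = h * block_exponent b d a \<eta>"
      using d by (simp add: D_def \<kappa>_def l_def block_exponent_def field_simps power2_eq_square)
    finally show "exp (K / (2 * b) * block_exponent b d a \<eta>) / 2 \<le>
      (\<Sum>w | length w = K. prob {\<omega> \<in> space M. block d \<nu> ((1 - \<eta>) * (K / (2 * b)))
      ((1 + \<eta>) * (K / (2 * b))) ((1 - \<eta>) * (a * (K / (2 * b)))) w \<omega>})"
      by (simp add: h_def)
  qed
qed

end

section \<open>Rate of decay\<close>

lemma tendsto_log_rate: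
  fixes P :: "real \<Rightarrow> real"
  assumes lower: "\<And>\<epsilon>. 0 < \<epsilon> \<Longrightarrow> eventually (\<lambda>t. exp (t * (A - \<epsilon>)) \<le> P t) at_top"
    and upper: "\<And>\<epsilon>. 0 < \<epsilon> \<Longrightarrow> \<exists>K. \<forall>t. P t \<le> K * exp (t * (A + \<epsilon>))"
  shows "((\<lambda>t. 1 / t * ln (P t)) \<longlongrightarrow> A) at_top"
proof (rule tendstoI)
  fix e :: real assume e: "0 < e"
  obtain K where K: "\<And>t. P t \<le> K * exp (t * (A + e / 3))" using upper[of "e / 3"] e by auto
  have low: "eventually (\<lambda>t. exp (t * (A - e / 2)) \<le> P t) at_top" using lower[of "e / 2"] e by simp
  have big: "eventually (\<lambda>t. 3 / e * ln K < t) at_top" by (rule eventually_gt_at_top)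
  show "eventually (\<lambda>t. dist (1 / t * ln (P t)) A < e) at_top"
    using low big eventually_gt_at_top[of 0]
  proof eventually_elim
    case (elim t)
    have P: "0 < P t" using elim(1) exp_gt_zero by (rule less_le_trans[rotated])
    have "t * (A - e / 2) \<le> ln (P t)" using elim(1) P by (simp add: ln_ge_iff)
    then have 1: "A - e / 2 \<le> 1 / t * ln (P t)" using elim(3) by (simp add: field_simps)
    have K0: "0 < K" using less_le_trans[OF P K[of t]] by (simp add: zero_less_mult_iff)
    have "ln (P t) \<le> ln (K * exp (t * (A + e / 3)))" using P K[of t] K0 by (subst ln_le_cancel_iff) auto
    also have "\<dots> = ln K + t * (A + e / 3)" using K0 by (simp add: ln_mult)
    also have "ln K < e / 3 * t" using elim(2) e by (simp add: field_simps)
    finally have 2: "1 / t * ln (P t) < A + 2 * e / 3" using elim(3) by (simp add: field_simps)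
    show ?case using 1 2 e by (simp add: dist_real_def abs_if)
  qed
qed

context two_type_reducible_bbm_clocks
begin

lemma block_exponent_neg:
  assumes "0 < b" "0 < d" "0 \<le> \<eta>" "0 \<le> a" "a \<le> a'" "b < a\<^sup>2 / (2 * d\<^sup>2)"
  shows "block_exponent b d a' \<eta> < 0"
proof -
  have "a\<^sup>2 \<le> a'\<^sup>2" using assms by (intro power_mono) auto
  then have "a\<^sup>2 / (2 * d\<^sup>2) \<le> a'\<^sup>2 / (2 * d\<^sup>2)" by (intro divide_right_mono) auto
  moreover have "0 \<le> \<eta> * (b + 3 * a'\<^sup>2 / (2 * d\<^sup>2))" using assms by simp
  ultimately show ?thesis using assms(6) unfolding block_exponent_def by linarith
qed

text \<open>A margin \<open>\<eta>\<close> gives the exponent \<open>\<Phi> \<eta>\<close>, which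
  tends to the ideal one as \<open>\<eta>\<close> vanishes. By \<open>neg1\<close> and
  \<open>neg2\<close> the block means of both phases stay below 1, as the second moment bound
  demands.\<close>

lemma prob_above_ge_exp:
  assumes rates: "0 < \<beta>" "0 < \<alpha>" and \<sigma>: "0 < \<sigma>" and a: "0 < a1" "0 < a2"
    and neg1: "\<beta> < a1\<^sup>2 / (2 * \<sigma>\<^sup>2)" and neg2: "1 < a2\<^sup>2 / 2"
    and s: "0 \<le> s" "s \<le> 1" and \<epsilon>: "0 < \<epsilon>"
  shows "eventually (\<lambda>t. exp (t * (s * (\<beta> - a1\<^sup>2 / (2 * \<sigma>\<^sup>2)) + (1 - s) * (1 - a2\<^sup>2 / 2) - \<epsilon>)) \<le>
    prob {\<omega> \<in> space M. above \<sigma> t ((s * a1 + (1 - s) * a2) * t) \<omega>}) at_top"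
proof -
  define A where "A = s * (\<beta> - a1\<^sup>2 / (2 * \<sigma>\<^sup>2)) + (1 - s) * (1 - a2\<^sup>2 / 2)"
  define x where "x = s * a1 + (1 - s) * a2"
  \<comment> \<open>Velocities are raised by the factor \<open>c \<eta>\<close>: blocks guarantee
    only the share \<open>1 - \<eta>\<close> of their displacement and will fill only about the
    share \<open>\<rho> = 1 / (1 + \<eta>)\<^sup>2\<close> of the time. As
    \<open>(1 - \<eta>) * c \<eta> * \<rho> = 1 + \<eta>\<close>, a surplus \<open>\<eta>\<close> is
    left for rounding.\<close>
  define c where "c \<eta> = (1 + \<eta>) ^ 3 / (1 - \<eta>)" for \<eta> :: real
  \<comment> \<open>Each phase loses a further \<open>\<eta>\<close> for the factor 1/2 in the mean
    of a block; the last term pays for the waiting time of the last particle.\<close>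
  define \<Phi> where "\<Phi> \<eta> = s * (block_exponent \<beta> \<sigma> (a1 * c \<eta>) \<eta> - \<eta>) +
    (1 - s) * (block_exponent 1 1 (a2 * c \<eta>) \<eta> - \<eta>) - (1 - (1 - \<eta>) / (1 + \<eta>)\<^sup>2)" for \<eta>
  have "isCont \<Phi> 0"
    unfolding \<Phi>_def block_exponent_def c_def using \<sigma> by (intro continuous_intros) auto
  moreover have \<Phi>0: "\<Phi> 0 = A"
    by (simp add: \<Phi>_def A_def block_exponent_def c_def)
  ultimately obtain \<delta> where \<delta>: "0 < \<delta>" "\<And>\<eta>. dist \<eta> 0 < \<delta> \<Longrightarrow> dist (\<Phi> \<eta>) A < \<epsilon> / 2"
    using \<epsilon> unfolding continuous_at_eps_delta by (metis half_gt_zero)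
  define \<eta> where "\<eta> = min (\<delta> / 2) (1 / 2)"
  have \<eta>: "0 < \<eta>" "\<eta> < 1" using \<delta> by (auto simp: \<eta>_def)
  have \<Phi>: "A - \<epsilon> / 2 \<le> \<Phi> \<eta>"
  proof -
    have "dist \<eta> 0 < \<delta>" using \<delta>(1) by (auto simp: \<eta>_def dist_real_def min_def)
    from \<delta>(2)[OF this] show ?thesis unfolding dist_real_def by linarith
  qed
  have c1: "1 \<le> c \<eta>"
  proof -
    have "1 - \<eta> \<le> 1" "1 \<le> (1 + \<eta>) ^ 3" using \<eta> by (auto intro: one_le_power)
    then have "1 - \<eta> \<le> (1 + \<eta>) ^ 3" by (rule order_trans)
    then show ?thesis using \<eta> unfolding c_def by (subst le_divide_eq_1_pos) auto
  qed
  define E1 E2 where "E1 = block_exponent \<beta> \<sigma> (a1 * c \<eta>) \<eta>" and "E2 = block_exponent 1 1 (a2 * c \<eta>) \<eta>"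
  have E: "E1 < 0" "E2 < 0"
    unfolding E1_def E2_def using a c1 rates \<sigma> \<eta> neg1 neg2
    by (auto intro: block_exponent_neg[of \<beta> \<sigma> \<eta> a1 "a1 * c \<eta>"] block_exponent_neg[of 1 1 \<eta> a2 "a2 * c \<eta>"])
  have ac: "0 < a1 * c \<eta>" "0 < a2 * c \<eta>" using a c1 by (auto intro!: mult_pos_pos)
  obtain K1 where K1: "\<And>K \<nu>. K1 \<le> K \<Longrightarrow> inj \<nu> \<Longrightarrow> (\<And>w. branching_rate \<beta> (\<nu> w) = \<beta>) \<Longrightarrow>
    exp (K / (2 * \<beta>) * E1) / 2 \<le>
    (\<Sum>w | length w = K. prob {\<omega> \<in> space M. block \<sigma> \<nu> ((1 - \<eta>) * (K / (2 * \<beta>)))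
      ((1 + \<eta>) * (K / (2 * \<beta>))) ((1 - \<eta>) * ((a1 * c \<eta>) * (K / (2 * \<beta>)))) w \<omega>})"
    using sum_block_ge[OF rates(1) \<sigma> ac(1) \<eta>(1)] unfolding E1_def by blast
  obtain K2 where K2: "\<And>K \<nu>. K2 \<le> K \<Longrightarrow> inj \<nu> \<Longrightarrow> (\<And>w. branching_rate \<beta> (\<nu> w) = 1) \<Longrightarrow>
    exp (K / (2 * 1) * E2) / 2 \<le>
    (\<Sum>w | length w = K. prob {\<omega> \<in> space M. block 1 \<nu> ((1 - \<eta>) * (K / (2 * 1)))
      ((1 + \<eta>) * (K / (2 * 1))) ((1 - \<eta>) * ((a2 * c \<eta>) * (K / (2 * 1)))) w \<omega>})"
    using sum_block_ge[OF zero_less_one zero_less_one ac(2) \<eta>(1)] unfolding E2_def by blast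
  \<comment> \<open>The last two bounds give \<open>ln 2 \<le> \<eta> * h\<close> for the typical
    duration \<open>h\<close> of a block, so that the factor 1/2 per block costs at most
    \<open>\<eta>\<close> per unit of time.\<close>
  obtain K where K: "K1 \<le> K" "K2 \<le> K" "0 < K" "2 * \<beta> * ln 2 / \<eta> \<le> K" "2 * ln 2 / \<eta> \<le> K"
  proof -
    obtain k where "max (2 * \<beta> * ln 2 / \<eta>) (2 * ln 2 / \<eta>) \<le> real k" using real_arch_simple by blast
    then show thesis by (intro that[of "Max {K1, K2, 1, k}"]) (auto intro: order_trans)
  qed
  define h1 h2 where "h1 = K / (2 * \<beta>)" and "h2 = K / (2 * 1 :: real)"
  have h: "0 < h1" "0 < h2" "ln 2 \<le> \<eta> * h1" "ln 2 \<le> \<eta> * h2"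
    using K rates \<eta> by (auto simp: h1_def h2_def field_simps)
  define m1 m2 tp where "m1 = exp (h1 * E1) / 2" and "m2 = exp (h2 * E2) / 2"
    and "tp = exp (- \<beta>) * (1 - exp (- \<alpha>)) / 2"
  have tp: "0 < tp" "tp \<le> 1 / 2"
    using rates mult_le_one[of "exp (- \<beta>)" "1 - exp (- \<alpha>)"] by (auto simp: tp_def)
  \<comment> \<open>Negative exponents together with the factor 1/2 keep the block means at most
    1/2, the value taken for \<open>q\<close>.\<close>
  have m: "0 < m1" "0 < m2" "m1 \<le> 1 / 2" "m2 \<le> 1 / 2"
    using E h by (auto simp: m1_def m2_def mult_le_0_iff)
  define q0 where "q0 = Min {m1, m2, tp}"
  define C where "C = 1 + (2 ^ K)\<^sup>2 / (q0 * (1 - 1 / 2))"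
  have q0: "0 < q0" "q0 \<le> m1" "q0 \<le> m2" "q0 \<le> tp" using m tp by (auto simp: q0_def)
  have C: "0 < C" using q0 by (auto simp: C_def intro!: add_pos_nonneg)
  \<comment> \<open>Even if all blocks last \<open>1 + \<eta>\<close> times their typical duration
    they end by \<open>t / (1 + \<eta>)\<close>, so the type 2 birth, of duration at most 1, fits in
    for large \<open>t\<close>.\<close>
  define \<rho> where "\<rho> = 1 / (1 + \<eta>)\<^sup>2"
  have \<rho>: "0 < \<rho>" "\<rho> \<le> 1" using \<eta> by (auto simp: \<rho>_def)
  have \<rho>1: "(1 + \<eta>) * \<rho> = 1 / (1 + \<eta>)" using \<eta> by (simp add: \<rho>_def power2_eq_square)
  define c0 where "c0 = tp / (2 * C) * exp (- (h1 + h2))"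
  have c0: "0 < c0" using tp C by (simp add: c0_def)
  have x: "0 < x"
  proof (cases "s = 0")
    case False
    then have "0 < s * a1" "0 \<le> (1 - s) * a2" using s a by auto
    then show ?thesis by (simp add: x_def)
  qed (use a in \<open>simp add: x_def\<close>)
  \<comment> \<open>The second condition on \<open>t\<close> makes room for the type 2 birth; by the
    third, the surplus \<open>\<eta> * x * t\<close> covers the displacement lost by rounding the
    numbers of blocks down.\<close>
  have main: "c0 * exp (t * \<Phi> \<eta>) \<le> prob {\<omega> \<in> space M. above \<sigma> t (x * t) \<omega>}"
    if t: "0 \<le> t" "(1 + \<eta>) / \<eta> \<le> t" "(1 + \<eta>) ^ 3 * (a1 * h1 + a2 * h2) / (\<eta> * x) \<le> t" for t
  proof -
    define n1 n2 where "n1 = nat \<lfloor>s * \<rho> * t / h1\<rfloor>" and "n2 = nat \<lfloor>(1 - s) * \<rho> * t / h2\<rfloor>"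
    define X1 X2 where "X1 = n1 * h1" and "X2 = n2 * h2"
    have X: "X1 \<le> s * \<rho> * t" "s * \<rho> * t - h1 \<le> X1" "X2 \<le> (1 - s) * \<rho> * t" "(1 - s) * \<rho> * t - h2 \<le> X2"
      "0 \<le> X1" "0 \<le> X2"
    proof -
      have floor: "real (nat \<lfloor>y / h\<rfloor>) * h \<le> y" "y - h \<le> real (nat \<lfloor>y / h\<rfloor>) * h"
        if "0 \<le> y" "0 < h" for y h :: real
      proof -
        have nn: "0 \<le> y / h" using that by simp
        have "real (nat \<lfloor>y / h\<rfloor>) \<le> y / h" using nn by linarith
        then have "real (nat \<lfloor>y / h\<rfloor>) * h \<le> y / h * h" using that by (intro mult_right_mono) auto
        then show "real (nat \<lfloor>y / h\<rfloor>) * h \<le> y" using that by simp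
        have "y / h - 1 \<le> real (nat \<lfloor>y / h\<rfloor>)" using nn by linarith
        then have "(y / h - 1) * h \<le> real (nat \<lfloor>y / h\<rfloor>) * h" using that by (intro mult_right_mono) auto
        then show "y - h \<le> real (nat \<lfloor>y / h\<rfloor>) * h" using that by (simp add: left_diff_distrib)
      qed
      show "X1 \<le> s * \<rho> * t" "s * \<rho> * t - h1 \<le> X1"
        unfolding X1_def n1_def using floor[of "s * \<rho> * t" h1] s \<rho> t h by auto
      show "X2 \<le> (1 - s) * \<rho> * t" "(1 - s) * \<rho> * t - h2 \<le> X2"
        unfolding X2_def n2_def using floor[of "(1 - s) * \<rho> * t" h2] s \<rho> t h by auto
      show "0 \<le> X1" "0 \<le> X2" using h by (auto simp: X1_def X2_def)
    qed
    have X12: "X1 + X2 \<le> \<rho> * t" "\<rho> * t - (h1 + h2) \<le> X1 + X2"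
      using X by (auto simp: algebra_simps)
    define L where "L = t - (1 - \<eta>) * (X1 + X2)"
    interpret tp: two_phase_tree M \<beta> \<alpha> T G B \<sigma> n1 n2 K "(1 - \<eta>) * h1" "(1 + \<eta>) * h1"
      "(1 - \<eta>) * ((a1 * c \<eta>) * h1)" m1 "(1 - \<eta>) * h2" "(1 + \<eta>) * h2" "(1 - \<eta>) * ((a2 * c \<eta>) * h2)" m2
      q0 "1 / 2"
    proof unfold_locales
      show "m1 \<le> (\<Sum>w | length w = K. prob {\<omega> \<in> space M. block \<sigma> (line_from (Type1 v)) ((1 - \<eta>) * h1)
          ((1 + \<eta>) * h1) ((1 - \<eta>) * ((a1 * c \<eta>) * h1)) w \<omega>})" for v
        unfolding m1_def h1_def
        by (rule K1[OF K(1) inj_line_from]) (simp only: rate_line_from branching_rate.simps)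
      show "m2 \<le> (\<Sum>w' | length w' = K. prob {\<omega> \<in> space M. block 1 (line_from (Type2 v 0 w)) ((1 - \<eta>) * h2)
          ((1 + \<eta>) * h2) ((1 - \<eta>) * ((a2 * c \<eta>) * h2)) w' \<omega>})" for v w
        unfolding m2_def h2_def
        by (rule K2[OF K(2) inj_line_from]) (simp only: rate_line_from branching_rate.simps)
    qed (use rates q0 m tp in \<open>auto simp: tp_def\<close>)
    have L0: "0 \<le> L"
    proof -
      have "(1 - \<eta>) * (X1 + X2) \<le> 1 * (X1 + X2)" using X \<eta> by (intro mult_right_mono) auto
      also have "\<dots> \<le> \<rho> * t" using X12 by simp
      also have "\<dots> \<le> 1 * t" using \<rho> t by (intro mult_right_mono) auto
      finally show ?thesis by (simp add: L_def)
    qed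
    have hi: "n1 * ((1 + \<eta>) * h1) + 1 + n2 * ((1 + \<eta>) * h2) \<le> t"
    proof -
      have "n1 * ((1 + \<eta>) * h1) + n2 * ((1 + \<eta>) * h2) = (1 + \<eta>) * (X1 + X2)"
        by (simp add: X1_def X2_def algebra_simps)
      also have "\<dots> \<le> (1 + \<eta>) * (\<rho> * t)" using X12 \<eta> by (intro mult_left_mono) auto
      also have "\<dots> = t / (1 + \<eta>)" using \<rho>1 by (simp add: mult.assoc[symmetric])
      finally have "n1 * ((1 + \<eta>) * h1) + n2 * ((1 + \<eta>) * h2) \<le> t / (1 + \<eta>)" .
      moreover have "t / (1 + \<eta>) + 1 \<le> t" using t(2) \<eta> by (simp add: field_simps)
      ultimately show ?thesis by linarith
    qed
    have lo: "t - (n1 * ((1 - \<eta>) * h1) + n2 * ((1 - \<eta>) * h2)) \<le> L"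
      by (simp add: L_def X1_def X2_def algebra_simps)
    have z: "x * t \<le> n1 * ((1 - \<eta>) * ((a1 * c \<eta>) * h1)) + n2 * ((1 - \<eta>) * ((a2 * c \<eta>) * h2))"
    proof -
      have e3: "(1 - \<eta>) * c \<eta> = (1 + \<eta>) ^ 3" using \<eta> by (simp add: c_def)
      have e1: "(1 + \<eta>) ^ 3 * \<rho> = 1 + \<eta>"
        using \<eta> by (simp add: \<rho>_def power3_eq_cube power2_eq_square)
      have "(1 + \<eta>) ^ 3 * (a1 * h1 + a2 * h2) \<le> t * (\<eta> * x)"
        using t(3) \<eta> x by (subst (asm) pos_divide_le_eq) auto
      then have "x * t \<le> (1 + \<eta>) * x * t - (1 + \<eta>) ^ 3 * (a1 * h1 + a2 * h2)"
        by (simp add: algebra_simps)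
      also have "\<dots> = ((1 + \<eta>) ^ 3 * \<rho>) * x * t - (1 + \<eta>) ^ 3 * (a1 * h1 + a2 * h2)" using e1 by simp
      also have "\<dots> = (1 + \<eta>) ^ 3 * (a1 * (s * \<rho> * t - h1) + a2 * ((1 - s) * \<rho> * t - h2))"
        by (simp add: x_def algebra_simps)
      also have "\<dots> \<le> (1 + \<eta>) ^ 3 * (a1 * X1 + a2 * X2)"
        using X a \<eta> by (intro mult_left_mono add_mono) auto
      also have "\<dots> = n1 * ((1 - \<eta>) * ((a1 * c \<eta>) * h1)) + n2 * ((1 - \<eta>) * ((a2 * c \<eta>) * h2))"
        unfolding e3[symmetric] by (simp add: X1_def X2_def algebra_simps)
      finally show ?thesis .
    qed
    \<comment> \<open>The exponents are negative, so making fewer blocks than the full share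
      \<open>r * t / h\<close> only raises the product of means.\<close>
    have pow: "exp (r * t * (E - \<eta>)) \<le> (exp (h * E) / 2) ^ n"
      if "E < 0" "n * h \<le> r * \<rho> * t" "0 \<le> r" "0 < h" "ln 2 \<le> \<eta> * h" for r E h :: real and n :: nat
    proof -
      have "n * h \<le> r * \<rho> * t" by fact
      also have "\<dots> \<le> r * 1 * t" using \<rho> t that by (intro mult_right_mono mult_left_mono) auto
      finally have "r * t * (E - \<eta>) \<le> n * h * (E - \<eta>)"
        using that \<eta> by (intro mult_right_mono_neg) auto
      also have "\<dots> = n * (h * E) - n * (\<eta> * h)" by (simp add: algebra_simps)
      also have "\<dots> \<le> n * (h * E) - n * ln 2" using that by (intro diff_left_mono mult_left_mono) auto
      also have "\<dots> = n * (h * E - ln 2)" by (simp add: algebra_simps)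
      finally have "exp (r * t * (E - \<eta>)) \<le> exp (n * (h * E - ln 2))" by simp
      also have "\<dots> = (exp (h * E) / 2) ^ n" by (simp add: exp_of_nat_mult exp_diff)
      finally show ?thesis .
    qed
    have p1: "exp (s * t * (E1 - \<eta>)) \<le> m1 ^ n1"
      unfolding m1_def using pow[OF E(1), of n1 h1 s] X(1) s h by (simp add: X1_def)
    have p2: "exp ((1 - s) * t * (E2 - \<eta>)) \<le> m2 ^ n2"
      unfolding m2_def using pow[OF E(2), of n2 h2 "1 - s"] X(3) s h by (simp add: X2_def)
    have Lle: "- t * (1 - (1 - \<eta>) / (1 + \<eta>)\<^sup>2) - (h1 + h2) \<le> - L"
    proof -
      have "(1 - \<eta>) * (\<rho> * t - (h1 + h2)) \<le> (1 - \<eta>) * (X1 + X2)"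
        using X12 \<eta> by (intro mult_left_mono) auto
      moreover have "(1 - \<eta>) * (h1 + h2) \<le> 1 * (h1 + h2)" using h \<eta> by (intro mult_right_mono) auto
      moreover have eq: "(1 - \<eta>) / (1 + \<eta>)\<^sup>2 = (1 - \<eta>) * \<rho>" by (simp add: \<rho>_def)
      ultimately show ?thesis unfolding eq by (simp add: L_def algebra_simps)
    qed
    have "c0 * exp (t * \<Phi> \<eta>) = exp (- t * (1 - (1 - \<eta>) / (1 + \<eta>)\<^sup>2) - (h1 + h2)) / 2 *
        (exp (s * t * (E1 - \<eta>)) * tp * exp ((1 - s) * t * (E2 - \<eta>)) / C)"
    proof -
      define w where "w = (1 - \<eta>) / (1 + \<eta>)\<^sup>2"
      have "exp (- (h1 + h2)) * exp (t * \<Phi> \<eta>) = exp (- t * (1 - (1 - \<eta>) / (1 + \<eta>)\<^sup>2) - (h1 + h2)) *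
          (exp (s * t * (E1 - \<eta>)) * exp ((1 - s) * t * (E2 - \<eta>)))"
        unfolding mult_exp_exp \<Phi>_def E1_def[symmetric] E2_def[symmetric] w_def[symmetric]
        by (simp add: algebra_simps)
      then show ?thesis by (simp add: c0_def)
    qed
    also have "\<dots> \<le> exp (- L) / 2 * (m1 ^ n1 * tp * m2 ^ n2 / C)"
      using Lle p1 p2 tp C m by (intro mult_mono divide_right_mono) auto
    also have "\<dots> \<le> prob {\<omega> \<in> space M. above \<sigma> t (x * t) \<omega>}"
      using tp.prob_above_ge[OF _ L0 hi lo z] \<sigma> unfolding tp.transition_prob_def C_def tp_def by simp
    finally show ?thesis .
  qed
  have "eventually (\<lambda>t. 0 \<le> t \<and> (1 + \<eta>) / \<eta> \<le> t \<and> (1 + \<eta>) ^ 3 * (a1 * h1 + a2 * h2) / (\<eta> * x) \<le> t \<and>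
      - ln c0 / (\<epsilon> / 2) \<le> t) at_top"
    by (intro eventually_conj eventually_ge_at_top)
  then show ?thesis
  proof eventually_elim
    case (elim t)
    have "- ln c0 / (\<epsilon> / 2) \<le> t" using elim by blast
    then have "- ln c0 \<le> t * (\<epsilon> / 2)" using \<epsilon> by (subst (asm) pos_divide_le_eq) auto
    moreover have "t * (A - \<epsilon> / 2) \<le> t * \<Phi> \<eta>" using \<Phi> elim by (intro mult_left_mono) auto
    ultimately have "t * (A - \<epsilon>) \<le> ln c0 + t * \<Phi> \<eta>" by (simp add: algebra_simps)
    then have "exp (t * (A - \<epsilon>)) \<le> exp (ln c0 + t * \<Phi> \<eta>)" by simp
    also have "\<dots> = c0 * exp (t * \<Phi> \<eta>)" using c0 by (simp add: exp_add)
    also have "\<dots> \<le> prob {\<omega> \<in> space M. above \<sigma> t (x * t) \<omega>}" using elim by (intro main) auto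
    finally show ?case by (simp add: A_def x_def)
  qed
qed

text \<open>Upper and lower bound match if the tilt \<open>\<mu>\<close> is dual to the velocities \<open>a1\<close>, \<open>a2\<close> and the time
  share \<open>s\<close> of the optimal path.\<close>

lemma tendsto_maximum_rate:
  assumes rates: "0 < \<beta>" "0 < \<alpha>" and \<sigma>: "0 < \<sigma>"
    and p: "0 < p" "p \<le> 1" and "0 \<le> \<mu>"
    and \<kappa>: "\<beta> + \<mu>\<^sup>2 * \<sigma>\<^sup>2 / 2 \<le> \<kappa>" "p + \<mu>\<^sup>2 / (2 * p) \<le> \<kappa>"
    and a: "0 < a1" "0 < a2" and neg: "\<beta> < a1\<^sup>2 / (2 * \<sigma>\<^sup>2)" "1 < a2\<^sup>2 / 2"
    and s: "0 \<le> s" "s \<le> 1" and x: "s * a1 + (1 - s) * a2 = x"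
    and A: "s * (\<beta> - a1\<^sup>2 / (2 * \<sigma>\<^sup>2)) + (1 - s) * (1 - a2\<^sup>2 / 2) = A" "\<kappa> - \<mu> * x = A"
  shows "((\<lambda>t. 1 / t * ln (\<P>(\<omega> in M. x * t \<le> maximum \<sigma> t \<omega>))) \<longlongrightarrow> A) at_top"
proof -
  have "((\<lambda>t. 1 / t * ln (prob {\<omega> \<in> space M. above \<sigma> t (x * t) \<omega>})) \<longlongrightarrow> A) at_top"
  proof (rule tendsto_log_rate)
    fix \<epsilon> :: real assume \<epsilon>: "0 < \<epsilon>"
    show "eventually (\<lambda>t. exp (t * (A - \<epsilon>)) \<le> prob {\<omega> \<in> space M. above \<sigma> t (x * t) \<omega>}) at_top"
      using prob_above_ge_exp[OF rates \<sigma> a neg s \<epsilon>] by (simp only: x A(1))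
    have "\<beta> + \<mu>\<^sup>2 * \<sigma>\<^sup>2 / 2 < \<kappa> + \<epsilon>" "p + \<mu>\<^sup>2 / (2 * p) < \<kappa> + \<epsilon>" using \<kappa> \<epsilon> by auto
    from prob_above_le[OF rates p \<open>0 \<le> \<mu>\<close> this]
    obtain K where K: "\<And>t z. prob {\<omega> \<in> space M. above \<sigma> t z \<omega>} \<le> K * exp ((\<kappa> + \<epsilon>) * t - \<mu> * z)"
      by blast
    have "prob {\<omega> \<in> space M. above \<sigma> t (x * t) \<omega>} \<le> K * exp (t * (A + \<epsilon>))" for t
      unfolding A(2)[symmetric] using K[of t "x * t"] by (simp add: algebra_simps)
    then show "\<exists>K. \<forall>t. prob {\<omega> \<in> space M. above \<sigma> t (x * t) \<omega>} \<le> K * exp (t * (A + \<epsilon>))" by blast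
  qed
  moreover have "eventually (\<lambda>t. 1 / t * ln (prob {\<omega> \<in> space M. above \<sigma> t (x * t) \<omega>}) =
      1 / t * ln (\<P>(\<omega> in M. x * t \<le> maximum \<sigma> t \<omega>))) at_top"
    using eventually_ge_at_top[of 0]
    by eventually_elim (simp add: prob_maximum_eq[OF rates])
  ultimately show ?thesis by (rule Lim_transform_eventually)
qed

end

section \<open>Choice of the tilt, the velocities and the time share\<close>

theorem theorem1p1:
  fixes M :: "'a measure" and \<beta> \<sigma> \<alpha> \<theta> :: real
    and T :: "particle \<Rightarrow> 'a \<Rightarrow> real"
    and G :: "bool list \<Rightarrow> nat \<Rightarrow> 'a \<Rightarrow> real"
    and B :: "particle \<Rightarrow> real \<Rightarrow> 'a \<Rightarrow> real"
  assumes "\<beta> > 0" and "\<sigma> > 0" and "\<alpha> > 0"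
    and "two_type_reducible_bbm_clocks M \<beta> \<alpha> T G B"
    and "(\<beta>, \<sigma>\<^sup>2) \<in> region_C_I"
    and "\<theta> > 1"
  shows "\<exists>A. ((\<lambda>t. 1 / t * ln (\<P>(\<omega> in M.
              max_position \<sigma> (\<lambda>u. T u \<omega>) (\<lambda>v k. G v k \<omega>) (\<lambda>u s. B u s \<omega>) t
                \<ge> sqrt (2 * \<beta> * \<sigma>\<^sup>2 * \<theta>\<^sup>2) * t))) \<longlongrightarrow> A) at_top \<and>
      (\<sigma>\<^sup>2 \<ge> 1 \<longrightarrow> A = \<beta> * (1 - \<theta>\<^sup>2)) \<and>
      (\<beta> > 1 \<and> \<sigma>\<^sup>2 < 1 \<longrightarrow>
        (\<theta>\<^sup>2 \<le> (\<beta> - 1) * \<sigma>\<^sup>2 / ((1 - \<sigma>\<^sup>2) * \<beta>) \<longrightarrow>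
          A = \<beta> * (1 - \<theta>\<^sup>2)) \<and>
        (\<theta>\<^sup>2 \<ge> (\<beta> - 1) / ((1 - \<sigma>\<^sup>2) * \<sigma>\<^sup>2 * \<beta>) \<longrightarrow>
          A = 1 - \<theta>\<^sup>2 * \<beta> * \<sigma>\<^sup>2) \<and>
        ((\<beta> - 1) * \<sigma>\<^sup>2 / ((1 - \<sigma>\<^sup>2) * \<beta>) < \<theta>\<^sup>2 \<and>
         \<theta>\<^sup>2 < (\<beta> - 1) / ((1 - \<sigma>\<^sup>2) * \<sigma>\<^sup>2 * \<beta>) \<longrightarrow>
          A = (- 2 * sqrt (\<beta> * (\<beta> - 1) * (1 - \<sigma>\<^sup>2)) * \<sigma> * \<theta> + \<beta> - \<sigma>\<^sup>2) / (1 - \<sigma>\<^sup>2)))"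
proof -
  interpret two_type_reducible_bbm_clocks M \<beta> \<alpha> T G B by fact
  note rates = \<open>\<beta> > 0\<close> \<open>\<alpha> > 0\<close> and \<sigma> = \<open>\<sigma> > 0\<close> and \<theta> = \<open>\<theta> > 1\<close>
  define v where "v = \<sigma>\<^sup>2"
  have v: "0 < v" using \<sigma> by (simp add: v_def)
  define x where "x = sqrt (2 * \<beta> * \<sigma>\<^sup>2 * \<theta>\<^sup>2)"
  have x2: "x\<^sup>2 = 2 * \<beta> * v * \<theta>\<^sup>2" using rates by (simp add: x_def v_def)
  have x: "0 < x" using rates \<sigma> \<theta> by (simp add: x_def)
  have \<theta>2: "1 < \<theta>\<^sup>2" using \<theta> by (simp add: one_less_power)
  have max_eq: "max_position \<sigma> (\<lambda>u. T u \<omega>) (\<lambda>v k. G v k \<omega>) (\<lambda>u s. B u s \<omega>) t = maximum \<sigma> t \<omega>" for \<omega> t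
    by (simp add: maximum_def)
  have lim: "\<exists>A. ((\<lambda>t. 1 / t * ln (\<P>(\<omega> in M. x * t \<le> maximum \<sigma> t \<omega>))) \<longlongrightarrow> A) at_top \<and> Q A"
    if "Q A" "0 < p" "p \<le> 1" "0 \<le> \<mu>" "\<beta> + \<mu>\<^sup>2 * \<sigma>\<^sup>2 / 2 \<le> \<kappa>" "p + \<mu>\<^sup>2 / (2 * p) \<le> \<kappa>" "0 < a1" "0 < a2"
      "\<beta> < a1\<^sup>2 / (2 * \<sigma>\<^sup>2)" "1 < a2\<^sup>2 / 2" "0 \<le> s" "s \<le> 1" "s * a1 + (1 - s) * a2 = x"
      "s * (\<beta> - a1\<^sup>2 / (2 * \<sigma>\<^sup>2)) + (1 - s) * (1 - a2\<^sup>2 / 2) = A" "\<kappa> - \<mu> * x = A"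
    for A p \<mu> \<kappa> a1 a2 s Q
    using tendsto_maximum_rate[OF rates \<sigma> that(2-15)] that(1) by blast
  have first: "\<exists>A. ((\<lambda>t. 1 / t * ln (\<P>(\<omega> in M. x * t \<le> maximum \<sigma> t \<omega>))) \<longlongrightarrow> A) at_top \<and> Q A"
    if Q: "Q (\<beta> * (1 - \<theta>\<^sup>2))" and p: "0 < p" "p \<le> 1" "p + (\<theta>\<^sup>2 * \<beta> / v) / p \<le> \<beta> + \<theta>\<^sup>2 * \<beta>" for Q p
  \<comment> \<open>Type 1 during the whole time: \<open>s = 1\<close>, velocity \<open>x\<close>
    and dual tilt \<open>x / v\<close>. The type 2 phase has weight 0; its velocity 2 is one above
    \<open>sqrt 2\<close>.\<close>
  proof (rule lim[of Q "\<beta> * (1 - \<theta>\<^sup>2)" p "x / v" "\<beta> + \<theta>\<^sup>2 * \<beta>" x 2 1, OF Q p(1,2)])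
    have \<mu>: "(x / v)\<^sup>2 = 2 * (\<theta>\<^sup>2 * \<beta> / v)"
      unfolding power_divide x2 using v by (simp add: power2_eq_square[of v])
    show "\<beta> + (x / v)\<^sup>2 * \<sigma>\<^sup>2 / 2 \<le> \<beta> + \<theta>\<^sup>2 * \<beta>"
      unfolding \<mu> using v by (simp add: v_def)
    show "p + (x / v)\<^sup>2 / (2 * p) \<le> \<beta> + \<theta>\<^sup>2 * \<beta>"
      unfolding \<mu> using p(3) by simp
    have gx: "x\<^sup>2 / (2 * \<sigma>\<^sup>2) = \<beta> * \<theta>\<^sup>2"
      unfolding x2 using v by (simp add: v_def)
    show "\<beta> < x\<^sup>2 / (2 * \<sigma>\<^sup>2)" unfolding gx using rates \<theta>2 by simp
    show "1 * (\<beta> - x\<^sup>2 / (2 * \<sigma>\<^sup>2)) + (1 - 1) * (1 - 2\<^sup>2 / 2) = \<beta> * (1 - \<theta>\<^sup>2)"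
      unfolding gx by (simp add: algebra_simps)
    have "x / v * x = 2 * \<beta> * \<theta>\<^sup>2"
      using v x2 by (simp add: power2_eq_square)
    then show "\<beta> + \<theta>\<^sup>2 * \<beta> - x / v * x = \<beta> * (1 - \<theta>\<^sup>2)" by (simp add: algebra_simps)
  qed (use x v in auto)
  have region: "v > of_bool (\<beta> \<le> 1) / \<beta> + of_bool (\<beta> > 1) * (\<beta> / (2 * \<beta> - 1))"
    using assms(5) by (simp add: region_C_I_def v_def)
  have "\<exists>A. ((\<lambda>t. 1 / t * ln (\<P>(\<omega> in M. x * t \<le> maximum \<sigma> t \<omega>))) \<longlongrightarrow> A) at_top \<and>
      (v \<ge> 1 \<longrightarrow> A = \<beta> * (1 - \<theta>\<^sup>2)) \<and>
      (\<beta> > 1 \<and> v < 1 \<longrightarrow>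
        (\<theta>\<^sup>2 \<le> (\<beta> - 1) * v / ((1 - v) * \<beta>) \<longrightarrow> A = \<beta> * (1 - \<theta>\<^sup>2)) \<and>
        (\<theta>\<^sup>2 \<ge> (\<beta> - 1) / ((1 - v) * v * \<beta>) \<longrightarrow> A = 1 - \<theta>\<^sup>2 * \<beta> * v) \<and>
        ((\<beta> - 1) * v / ((1 - v) * \<beta>) < \<theta>\<^sup>2 \<and> \<theta>\<^sup>2 < (\<beta> - 1) / ((1 - v) * v * \<beta>) \<longrightarrow>
          A = (- 2 * sqrt (\<beta> * (\<beta> - 1) * (1 - v)) * \<sigma> * \<theta> + \<beta> - v) / (1 - v)))"
  proof (cases "1 \<le> v")
    case True
    have bv: "1 \<le> \<beta> * v"
    proof (cases "\<beta> \<le> 1")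
      case True
      then show ?thesis using region rates by (simp add: pos_divide_less_eq mult.commute)
    next
      case False
      then show ?thesis using \<open>1 \<le> v\<close> mult_mono[of 1 \<beta> 1 v] by simp
    qed
    \<comment> \<open>\<open>p + c / p\<close> is least at \<open>p = sqrt c\<close>, with value
      \<open>2 * sqrt c\<close>; if this exceeds 1, the best admissible choice is
      \<open>p = 1\<close>.\<close>
    obtain p where p: "0 < p" "p \<le> 1" "p + (\<theta>\<^sup>2 * \<beta> / v) / p \<le> \<beta> + \<theta>\<^sup>2 * \<beta>"
    proof (cases "\<theta>\<^sup>2 * \<beta> / v \<le> 1")
      case le: True
      define r where "r = sqrt (\<theta>\<^sup>2 * \<beta> / v)"
      have r: "0 < r" "r \<le> 1" "r * r = \<theta>\<^sup>2 * \<beta> / v"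
        using le rates v \<theta> by (auto simp: r_def)
      have "(2 * r)\<^sup>2 \<le> (\<beta> + \<theta>\<^sup>2 * \<beta>)\<^sup>2"
      proof -
        have "(2 * r)\<^sup>2 = 4 * (\<theta>\<^sup>2 * \<beta> / v)" using r(3) by (simp add: power2_eq_square)
        also have "\<dots> \<le> 4 * (\<theta>\<^sup>2 * \<beta> * \<beta>)"
        proof -
          have "1 / v \<le> \<beta>" using bv v by (simp add: pos_divide_le_eq)
          then have "\<theta>\<^sup>2 * \<beta> * (1 / v) \<le> \<theta>\<^sup>2 * \<beta> * \<beta>" using rates by (intro mult_left_mono) auto
          then show ?thesis by simp
        qed
        also have "\<dots> \<le> (\<beta> + \<theta>\<^sup>2 * \<beta>)\<^sup>2"
        proof -
          have "(\<beta> + \<theta>\<^sup>2 * \<beta>)\<^sup>2 - 4 * (\<theta>\<^sup>2 * \<beta> * \<beta>) = (\<beta> - \<theta>\<^sup>2 * \<beta>)\<^sup>2"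
            by (simp add: power2_eq_square algebra_simps)
          then show ?thesis using zero_le_power2[of "\<beta> - \<theta>\<^sup>2 * \<beta>"] by linarith
        qed
        finally show ?thesis .
      qed
      then have "2 * r \<le> \<beta> + \<theta>\<^sup>2 * \<beta>"
        using rates by (intro power2_le_imp_le[of "2 * r"]) auto
      moreover have "r + (\<theta>\<^sup>2 * \<beta> / v) / r = 2 * r"
        unfolding r(3)[symmetric] using r(1) by simp
      ultimately show thesis using r by (intro that[of r]) auto
    next
      case False
      then have gt: "v < \<theta>\<^sup>2 * \<beta>" using v by (simp add: pos_divide_le_eq)
      \<comment> \<open>For \<open>p = 1\<close> the claim reads
        \<open>1 - \<beta> \<le> \<theta>\<^sup>2 * \<beta> * (1 - 1 / v)\<close>. The value
        \<open>v - 1\<close> separates the two sides: on the left by the inequality of arithmetic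
        and geometric means and \<open>\<beta> * v \<ge> 1\<close>, on the right by
        \<open>gt\<close>.\<close>
      have "2 \<le> \<beta> + v"
      proof (rule power2_le_imp_le)
        have "(\<beta> + v)\<^sup>2 - 4 * (\<beta> * v) = (\<beta> - v)\<^sup>2" by (simp add: power2_eq_square algebra_simps)
        then have "4 \<le> (\<beta> + v)\<^sup>2" using zero_le_power2[of "\<beta> - v"] bv by linarith
        then show "2\<^sup>2 \<le> (\<beta> + v)\<^sup>2" by simp
      qed (use rates v in simp)
      moreover have "v - 1 \<le> \<theta>\<^sup>2 * \<beta> - \<theta>\<^sup>2 * \<beta> / v"
      proof -
        have "v * (1 - 1 / v) \<le> \<theta>\<^sup>2 * \<beta> * (1 - 1 / v)"
          using gt True by (intro mult_right_mono) auto
        then show ?thesis using v by (simp add: algebra_simps)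
      qed
      ultimately show thesis by (intro that[of 1]) auto
    qed
    show ?thesis
      by (rule first[OF _ p]) (use True in auto)
  next
    case False
    then have v1: "v < 1" by simp
    have b1: "1 < \<beta>"
    proof (rule ccontr)
      assume "\<not> 1 < \<beta>"
      then have "1 / \<beta> < v" "1 \<le> 1 / \<beta>" using region rates by (auto simp: field_simps)
      with v1 show False by simp
    qed
    have reg: "\<beta> < (2 * \<beta> - 1) * v" using region b1 by (simp add: pos_divide_less_eq mult.commute)
    have bv: "1 < \<beta> * v"
    proof -
      have "0 \<le> (\<beta> - 1)\<^sup>2" by simp
      then have "2 * \<beta> - 1 \<le> \<beta> * \<beta>" by (simp add: power2_eq_square algebra_simps)
      also have "\<dots> < \<beta> * ((2 * \<beta> - 1) * v)" using reg b1 by simp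
      finally have "(2 * \<beta> - 1) * 1 < (2 * \<beta> - 1) * (\<beta> * v)" by (simp add: ac_simps)
      then show ?thesis using b1 by (subst (asm) mult_less_cancel_left_pos) auto
    qed
    define c1 c2 where "c1 = (\<beta> - 1) * v / ((1 - v) * \<beta>)" and "c2 = (\<beta> - 1) / ((1 - v) * v * \<beta>)"
    have c12: "c1 < c2"
    proof -
      have "v * v < 1 * 1" using v v1 by (intro mult_strict_mono) auto
      then have "(\<beta> - 1) * v * v < \<beta> - 1" using b1 by (simp add: mult.assoc)
      then have "(\<beta> - 1) * v < (\<beta> - 1) / v" using v by (simp add: pos_less_divide_eq)
      then have "(\<beta> - 1) * v / ((1 - v) * \<beta>) < (\<beta> - 1) / v / ((1 - v) * \<beta>)"
        using v1 b1 by (intro divide_strict_right_mono) auto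
      then show ?thesis by (simp add: c1_def c2_def ac_simps)
    qed
    have le_c1: "\<theta>\<^sup>2 \<le> c1 \<longleftrightarrow> \<theta>\<^sup>2 * \<beta> * (1 - v) \<le> (\<beta> - 1) * v"
      unfolding c1_def using v1 b1 by (subst pos_le_divide_eq) (auto simp: ac_simps)
    have ge_c2: "c2 \<le> \<theta>\<^sup>2 \<longleftrightarrow> \<beta> - 1 \<le> \<theta>\<^sup>2 * \<beta> * v * (1 - v)"
      unfolding c2_def using v1 b1 v by (subst pos_divide_le_eq) (auto simp: ac_simps)
    consider (small) "\<theta>\<^sup>2 \<le> c1" | (large) "c2 \<le> \<theta>\<^sup>2" | (middle) "c1 < \<theta>\<^sup>2" "\<theta>\<^sup>2 < c2" by linarith
    then show ?thesis
    proof cases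
      case small
      have "\<theta>\<^sup>2 * \<beta> / v * (1 - v) \<le> \<beta> - 1"
        using small v unfolding le_c1 by (simp add: pos_divide_le_eq)
      \<comment> \<open>With \<open>p = 1\<close> the condition on the type 2 trees is equivalent to
        \<open>\<theta>\<^sup>2 \<le> c1\<close>.\<close>
      then have "1 + (\<theta>\<^sup>2 * \<beta> / v) / 1 \<le> \<beta> + \<theta>\<^sup>2 * \<beta>"
        using v by (simp add: right_diff_distrib)
      then show ?thesis
        unfolding c1_def[symmetric] c2_def[symmetric]
        by (intro first[of _ 1]) (use small c12 v1 in auto)
    next
      case large
      show ?thesis
        unfolding c1_def[symmetric] c2_def[symmetric]
      \<comment> \<open>Type 2 from the start on the scale of \<open>t\<close>:
        \<open>s = 0\<close>, with velocity and tilt \<open>x\<close>. That the critical value of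
        type 1 does not exceed that of type 2 is equivalent to
        \<open>c2 \<le> \<theta>\<^sup>2\<close>.\<close>
      proof (rule lim[of _ "1 - \<theta>\<^sup>2 * \<beta> * v" 1 x "1 + x\<^sup>2 / 2" x x 0])
        show "\<beta> + x\<^sup>2 * \<sigma>\<^sup>2 / 2 \<le> 1 + x\<^sup>2 / 2"
          using large unfolding ge_c2 x2 v_def[symmetric] by (simp add: algebra_simps)
        have "\<beta> < \<beta> * \<theta>\<^sup>2" using rates \<theta>2 by simp
        then show "\<beta> < x\<^sup>2 / (2 * \<sigma>\<^sup>2)" unfolding x2 v_def[symmetric] using v by simp
        have "1 * 1 < (\<beta> * v) * \<theta>\<^sup>2" using bv \<theta>2 by (intro mult_strict_mono) auto
        then show "1 < x\<^sup>2 / 2" unfolding x2 by simp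
        show "0 * (\<beta> - x\<^sup>2 / (2 * \<sigma>\<^sup>2)) + (1 - 0) * (1 - x\<^sup>2 / 2) = 1 - \<theta>\<^sup>2 * \<beta> * v" unfolding x2 by simp
        have "x * x = 2 * \<beta> * v * \<theta>\<^sup>2" using x2 by (simp add: power2_eq_square)
        then show "1 + x\<^sup>2 / 2 - x * x = 1 - \<theta>\<^sup>2 * \<beta> * v" unfolding x2 by simp
      qed (use large c12 v1 x in auto)
    next
      case middle
      \<comment> \<open>The tilt at which the critical values
        \<open>\<beta> + \<mu>\<^sup>2 * v / 2\<close> and \<open>1 + \<mu>\<^sup>2 / 2\<close>
        agree. The dual velocities are \<open>\<mu> * v\<close> for type 1 and \<open>\<mu>\<close>
        for type 2; \<open>c1 < \<theta>\<^sup>2 < c2\<close> says that \<open>x\<close> lies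
        between them, and the mean velocity \<open>x\<close> then determines
        \<open>s\<close>.\<close>
      define \<mu> where "\<mu> = sqrt (2 * (\<beta> - 1) / (1 - v))"
      have \<mu>2: "\<mu>\<^sup>2 = 2 * (\<beta> - 1) / (1 - v)" using b1 v1 by (simp add: \<mu>_def)
      have \<mu>: "0 < \<mu>" using b1 v1 by (simp add: \<mu>_def)
      define \<kappa> where "\<kappa> = 1 + \<mu>\<^sup>2 / 2"
      have \<mu>3: "\<mu>\<^sup>2 * (1 - v) = 2 * (\<beta> - 1)" using v1 by (simp add: \<mu>2)
      then have \<kappa>: "\<kappa> = \<beta> + \<mu>\<^sup>2 * v / 2" unfolding \<kappa>_def by (simp add: algebra_simps)
      have x\<mu>: "x < \<mu>"
      proof (rule power2_less_imp_less)
        have "2 * (\<theta>\<^sup>2 * \<beta> * v * (1 - v)) < 2 * (\<beta> - 1)" using middle(2) ge_c2 by simp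
        then have "x\<^sup>2 * (1 - v) < \<mu>\<^sup>2 * (1 - v)" unfolding \<mu>3 x2 by (simp add: ac_simps)
        then show "x\<^sup>2 < \<mu>\<^sup>2" using v1 by (simp add: mult_less_cancel_right_pos)
      qed (use \<mu> in simp)
      have \<mu>x: "\<mu> * v < x"
      proof (rule power2_less_imp_less)
        have "(\<beta> - 1) * v < \<theta>\<^sup>2 * \<beta> * (1 - v)" using middle(1) le_c1 by simp
        then have "2 * (v * ((\<beta> - 1) * v)) < 2 * (v * (\<theta>\<^sup>2 * \<beta> * (1 - v)))" using v by simp
        then have "2 * (\<beta> - 1) * (v * v) < x\<^sup>2 * (1 - v)" unfolding x2 by (simp add: ac_simps)
        then have "(\<mu> * v)\<^sup>2 * (1 - v) < x\<^sup>2 * (1 - v)"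
          unfolding \<mu>3[symmetric] by (simp add: power2_eq_square ac_simps)
        then show "(\<mu> * v)\<^sup>2 < x\<^sup>2" using v1 by (simp add: mult_less_cancel_right_pos)
      qed (use x in simp)
      define s where "s = (\<mu> - x) / (\<mu> * (1 - v))"
      have s\<mu>: "s * (\<mu> * (1 - v)) = \<mu> - x" using \<mu> v1 by (simp add: s_def)
      have s: "0 \<le> s" "s \<le> 1"
      proof -
        show "0 \<le> s" using x\<mu> \<mu> v1 by (simp add: s_def)
        have "\<mu> - x \<le> \<mu> * (1 - v)" using \<mu>x by (simp add: algebra_simps)
        then show "s \<le> 1" using \<mu> v1 by (simp add: s_def)
      qed
      have A: "\<kappa> - \<mu> * x = (- 2 * sqrt (\<beta> * (\<beta> - 1) * (1 - v)) * \<sigma> * \<theta> + \<beta> - v) / (1 - v)"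
      proof -
        have x': "x = sqrt (2 * \<beta>) * (\<sigma> * \<theta>)"
          using \<sigma> \<theta> by (simp add: x_def real_sqrt_mult)
        have "sqrt (\<beta> * (\<beta> - 1) * (1 - v)) / (1 - v) = sqrt (\<beta> * (\<beta> - 1) / (1 - v))"
        proof -
          have "sqrt (\<beta> * (\<beta> - 1) * (1 - v)) / (1 - v) = sqrt (\<beta> * (\<beta> - 1) * (1 - v)) / sqrt ((1 - v)\<^sup>2)"
            using v1 by simp
          also have "\<dots> = sqrt (\<beta> * (\<beta> - 1) * (1 - v) / (1 - v)\<^sup>2)" by (rule real_sqrt_divide[symmetric])
          also have "\<beta> * (\<beta> - 1) * (1 - v) / (1 - v)\<^sup>2 = \<beta> * (\<beta> - 1) / (1 - v)"
            using v1 by (simp add: power2_eq_square)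
          finally show ?thesis .
        qed
        moreover have "\<mu> * sqrt (2 * \<beta>) = 2 * sqrt (\<beta> * (\<beta> - 1) / (1 - v))"
        proof -
          have "\<mu> * sqrt (2 * \<beta>) = sqrt (2\<^sup>2 * (\<beta> * (\<beta> - 1) / (1 - v)))"
            unfolding \<mu>_def real_sqrt_mult[symmetric] by (simp add: ac_simps)
          then show ?thesis by (simp only: real_sqrt_mult) simp
        qed
        ultimately have "\<mu> * x = 2 * (sqrt (\<beta> * (\<beta> - 1) * (1 - v)) / (1 - v)) * (\<sigma> * \<theta>)"
          unfolding x' by simp
        moreover have "\<kappa> = (\<beta> - v) / (1 - v)"
          unfolding \<kappa>_def \<mu>2 using v1 by (simp add: field_simps)
        moreover have "(- 2 * r * \<sigma> * \<theta> + \<beta> - v) / (1 - v) = (\<beta> - v) / (1 - v) - 2 * (r / (1 - v)) * (\<sigma> * \<theta>)" for r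
          by (simp add: diff_divide_distrib add_divide_distrib)
        ultimately show ?thesis by simp
      qed
      show ?thesis
        unfolding c1_def[symmetric] c2_def[symmetric]
      proof (rule lim[of _ "\<kappa> - \<mu> * x" 1 \<mu> \<kappa> "\<mu> * v" \<mu> s])
        show "\<beta> + \<mu>\<^sup>2 * \<sigma>\<^sup>2 / 2 \<le> \<kappa>" unfolding \<kappa> v_def by simp
        show "1 + \<mu>\<^sup>2 / (2 * 1) \<le> \<kappa>" unfolding \<kappa>_def by simp
        have g1: "(\<mu> * v)\<^sup>2 / (2 * \<sigma>\<^sup>2) = \<mu>\<^sup>2 * v / 2"
          unfolding v_def[symmetric] using v by (simp add: power2_eq_square)
        \<comment> \<open>Type 1 exceeds its critical speed: this is \<open>reg\<close>
          rearranged.\<close>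
        show "\<beta> < (\<mu> * v)\<^sup>2 / (2 * \<sigma>\<^sup>2)"
        proof -
          have "\<beta> * (1 - v) < (\<beta> - 1) * v" using reg by (simp add: algebra_simps)
          then have "\<beta> < (\<beta> - 1) * v / (1 - v)" using v1 by (simp add: pos_less_divide_eq)
          moreover have "\<mu>\<^sup>2 * v / 2 = (\<beta> - 1) * v / (1 - v)"
            unfolding \<mu>2 using v1 by (simp add: field_simps)
          ultimately show ?thesis unfolding g1 by linarith
        qed
        show "1 < \<mu>\<^sup>2 / 2"
        proof -
          have "2 - v < \<beta>"
          proof -
            have "(\<beta> - 1) * (1 - v) < (\<beta> - 1) * (\<beta> - 1)"
            proof -
              \<comment> \<open>The region also puts type 2 above its speed, since
                \<open>2 - \<beta> \<le> \<beta> / (2 * \<beta> - 1)\<close> is equivalent to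
                \<open>(\<beta> - 1)\<^sup>2 \<ge> 0\<close>.\<close>
              have "1 - v < \<beta> - 1"
              proof (rule ccontr)
                assume "\<not> 1 - v < \<beta> - 1"
                then have "(2 * \<beta> - 1) * v \<le> (2 * \<beta> - 1) * (2 - \<beta>)"
                  using b1 by (intro mult_left_mono) auto
                with reg have "\<beta> < (2 * \<beta> - 1) * (2 - \<beta>)" by linarith
                then have "(\<beta> - 1) * (\<beta> - 1) < 0" by (simp add: algebra_simps)
                then show False using zero_le_square[of "\<beta> - 1"] by linarith
              qed
              then show ?thesis using b1 by simp
            qed
            then show ?thesis using b1 by simp
          qed
          then have "1 - v < \<beta> - 1" by simp
          then have "1 < (\<beta> - 1) / (1 - v)" using v1 by (simp add: pos_less_divide_eq)
          moreover have "\<mu>\<^sup>2 / 2 = (\<beta> - 1) / (1 - v)"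
            unfolding \<mu>2 using v1 by (simp add: field_simps)
          ultimately show ?thesis by linarith
        qed
        have "s * (\<mu> * v) + (1 - s) * \<mu> = \<mu> - s * (\<mu> * (1 - v))" by (simp add: algebra_simps)
        then show sx: "s * (\<mu> * v) + (1 - s) * \<mu> = x" unfolding s\<mu> by simp
        \<comment> \<open>Both exponents lie on a line of slope \<open>- \<mu>\<close>, the common
          tangent of the two parabolas, so their mixture is the value of this line at the mean
          velocity \<open>x\<close>.\<close>
        have "\<beta> - (\<mu> * v)\<^sup>2 / (2 * \<sigma>\<^sup>2) = \<kappa> - \<mu> * (\<mu> * v)"
          unfolding g1 \<kappa> by (simp add: power2_eq_square)
        moreover have "1 - \<mu>\<^sup>2 / 2 = \<kappa> - \<mu> * \<mu>"
          unfolding \<kappa>_def by (simp add: power2_eq_square)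
        ultimately have "s * (\<beta> - (\<mu> * v)\<^sup>2 / (2 * \<sigma>\<^sup>2)) + (1 - s) * (1 - \<mu>\<^sup>2 / 2) =
            \<kappa> - \<mu> * (s * (\<mu> * v) + (1 - s) * \<mu>)"
          by (simp only:) (simp add: algebra_simps)
        then show "s * (\<beta> - (\<mu> * v)\<^sup>2 / (2 * \<sigma>\<^sup>2)) + (1 - s) * (1 - \<mu>\<^sup>2 / 2) = \<kappa> - \<mu> * x"
          unfolding sx .
      qed (use middle v1 v \<mu> s A in auto)
    qed
  qed
  then show ?thesis
    unfolding max_eq v_def x_def .
qed

end
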